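(* Let $(M,\omega^1,\ldots,\omega^k,V)$ be a $k$-symplectic manifold with $\dim M=n(k+1)$. Around every point $x\in M$, there exist local coordinates $\{q^i,p^\alpha_i\}$, with $1\leq i\leq n$ and $1\leq\alpha\leq k$, such that $$\omega^\alpha=\sum_{i=1}^n\mathrm{d}q^i\wedge\mathrm{d}p^\alpha_i,\quad \alpha=1,\ldots,k,\qquad V=\left\langle\frac{\partial}{\partial p^\alpha_i}\right\rangle_{i=1,\ldots,n,\ \alpha=1,\ldots,k}.$$
   Context: All manifolds are real, smooth, Hausdorff, connected, second countable and finite-dimensional; all structures are smooth. Let $M$ be an $n(k+1)$-dimensional manifold. A $k$-symplectic structure on $M$ is a family $(\omega^1,\ldots,\omega^k,V)$, where $V$ is an integrable distribution on $M$ of rank $nk$ and $\omega^1,\ldots,\omega^k$ are closed differential two-forms on $M$ such that (1) $\omega^\alpha|_{V\times V}=0$ for $1\leq\alpha\leq k$, and (2) $\bigcap_{\alpha=1}^k\ker\omega^\alpha=\{0\}$, where $\ker\omega^\alpha=\{v\in TM\mid \omega^\alpha(v,\cdot)=0\}$. Then $(M,\omega^1,\ldots,\omega^k,V)$ is called a $k$-symplectic manifold. *)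

theory Defs
  imports "HOL-Analysis.Analysis" "HOL-Library.Function_Algebras"
begin

section \<open>Functions as a real vector space\<close>

text \<open>Tangent vectors are encoded below as functions on a set of charts; the pointwise vector space
  structure makes \<^const>\<open>subspace\<close>, \<^const>\<open>span\<close> and \<^const>\<open>dim\<close> available for them.\<close>

instantiation "fun" :: (type, scaleR) scaleR
begin

definition "scaleR r f = (\<lambda>x. r *\<^sub>R f x)"
instance ..

end

instance "fun" :: (type, real_vector) real_vector
  by standard (auto simp: scaleR_fun_def fun_eq_iff algebra_simps)


section \<open>Smooth maps between Euclidean spaces\<close>

text \<open>Only meant for open \<open>S\<close>.\<close>

fun Ck_on :: "nat \<Rightarrow> 'e::euclidean_space set \<Rightarrow> ('e \<Rightarrow> 'f::euclidean_space) \<Rightarrow> bool" where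
  "Ck_on 0 S f \<longleftrightarrow> continuous_on S f"
| "Ck_on (Suc m) S f \<longleftrightarrow> (\<forall>x\<in>S. f differentiable (at x)) \<and>
     (\<forall>v. Ck_on m S (\<lambda>x. frechet_derivative f (at x) v))"

definition smooth_on :: "'e::euclidean_space set \<Rightarrow> ('e \<Rightarrow> 'f::euclidean_space) \<Rightarrow> bool" where
  "smooth_on S f \<longleftrightarrow> (\<forall>m. Ck_on m S f)"


section \<open>Smooth manifolds\<close>

text \<open>A chart is a pair of its domain and the coordinate map; the values of the map outside the
  domain are irrelevant.\<close>

type_synonym ('a, 'e) chart = "'a set \<times> ('a \<Rightarrow> 'e)"

definition chart_on :: "'a topology \<Rightarrow> ('a, 'e::euclidean_space) chart \<Rightarrow> bool" where
  "chart_on X c \<longleftrightarrow> openin X (fst c) \<and> open (snd c ` fst c) \<and>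
     homeomorphic_map (subtopology X (fst c)) (top_of_set (snd c ` fst c)) (snd c)"

definition chart_inv :: "('a, 'e) chart \<Rightarrow> 'e \<Rightarrow> 'a" where
  "chart_inv c = inv_into (fst c) (snd c)"

definition transition :: "('a, 'e) chart \<Rightarrow> ('a, 'f) chart \<Rightarrow> 'e \<Rightarrow> 'f" where
  "transition c d = snd d \<circ> chart_inv c"

text \<open>The model spaces of the two charts may be different types.\<close>

definition smoothly_compatible ::
    "('a, 'e::euclidean_space) chart \<Rightarrow> ('a, 'f::euclidean_space) chart \<Rightarrow> bool" where
  "smoothly_compatible c d \<longleftrightarrow>
     smooth_on (snd c ` (fst c \<inter> fst d)) (transition c d) \<and>
     smooth_on (snd d ` (fst c \<inter> fst d)) (transition d c)"

text \<open>A manifold whose dimension is that of the model space \<open>'e\<close>; \<open>A\<close> is the maximal atlas.\<close>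

definition smooth_manifold :: "'a topology \<Rightarrow> ('a, 'e::euclidean_space) chart set \<Rightarrow> bool" where
  "smooth_manifold X A \<longleftrightarrow>
     Hausdorff_space X \<and> second_countable X \<and> connected_space X \<and>
     (\<forall>c\<in>A. chart_on X c) \<and>
     (\<forall>x\<in>topspace X. \<exists>c\<in>A. x \<in> fst c) \<and>
     (\<forall>c\<in>A. \<forall>d\<in>A. smoothly_compatible c d) \<and>
     (\<forall>c. chart_on X c \<and> (\<forall>d\<in>A. smoothly_compatible c d) \<longrightarrow> c \<in> A)"

definition charts_at :: "('a, 'e) chart set \<Rightarrow> 'a \<Rightarrow> ('a, 'e) chart set" where
  "charts_at A x = {c \<in> A. x \<in> fst c}"


section \<open>Tangent vectors and vector fields\<close>

text \<open>A tangent vector at \<open>x\<close> assigns to each chart around \<open>x\<close> its component vector in that chart,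
  subject to the usual transformation rule. The value 0 at all other charts makes the
  representation unique.\<close>

type_synonym ('a, 'e) tangent = "('a, 'e) chart \<Rightarrow> 'e"

definition tangent_space ::
    "('a, 'e::euclidean_space) chart set \<Rightarrow> 'a \<Rightarrow> ('a, 'e) tangent set" where
  "tangent_space A x = {v.
     (\<forall>c. c \<notin> charts_at A x \<longrightarrow> v c = 0) \<and>
     (\<forall>c\<in>charts_at A x. \<forall>d\<in>charts_at A x.
        v d = frechet_derivative (transition c d) (at (snd c x)) (v c))}"

text \<open>The tangent vector at \<open>x\<close> with component vector \<open>b\<close> in the chart \<open>c\<close>, which may have a model
  space other than that of \<open>A\<close>.\<close>

definition chart_vector :: "('a, 'e::euclidean_space) chart set \<Rightarrow>
    ('a, 'f::euclidean_space) chart \<Rightarrow> 'a \<Rightarrow> 'f \<Rightarrow> ('a, 'e) tangent" where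
  "chart_vector A c x b = (\<lambda>d. if d \<in> charts_at A x
     then frechet_derivative (transition c d) (at (snd c x)) b else 0)"

definition smooth_vector_field ::
    "('a, 'e::euclidean_space) chart set \<Rightarrow> 'a set \<Rightarrow> ('a \<Rightarrow> ('a, 'e) tangent) \<Rightarrow> bool" where
  "smooth_vector_field A U Y \<longleftrightarrow>
     (\<forall>y\<in>U. Y y \<in> tangent_space A y) \<and>
     (\<forall>c\<in>A. smooth_on (snd c ` (fst c \<inter> U)) (\<lambda>z. Y (chart_inv c z) c))"


section \<open>Differential forms\<close>

text \<open>The differential of a function at \<open>x\<close>; the result does not depend on the chosen chart.\<close>

definition differential ::
    "('a, 'e::euclidean_space) chart set \<Rightarrow> ('a \<Rightarrow> real) \<Rightarrow> 'a \<Rightarrow> ('a, 'e) tangent \<Rightarrow> real" where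
  "differential A f x v = (let c = (SOME c. c \<in> charts_at A x) in
     frechet_derivative (f \<circ> chart_inv c) (at (snd c x)) (v c))"

definition wedge :: "('v \<Rightarrow> real) \<Rightarrow> ('v \<Rightarrow> real) \<Rightarrow> 'v \<Rightarrow> 'v \<Rightarrow> real" where
  "wedge \<eta> \<theta> v w = \<eta> v * \<theta> w - \<eta> w * \<theta> v"

type_synonym ('a, 'e) form2 = "'a \<Rightarrow> ('a, 'e) tangent \<Rightarrow> ('a, 'e) tangent \<Rightarrow> real"

text \<open>The local expression of a two-form in a chart, evaluated on constant vectors.\<close>

definition local_form :: "('a, 'e::euclidean_space) chart set \<Rightarrow> ('a, 'e) form2 \<Rightarrow>
    ('a, 'e) chart \<Rightarrow> 'e \<Rightarrow> 'e \<Rightarrow> 'e \<Rightarrow> real" where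
  "local_form A \<omega> c z a b = (let x = chart_inv c z in
     \<omega> x (chart_vector A c x a) (chart_vector A c x b))"

definition two_form ::
    "'a topology \<Rightarrow> ('a, 'e::euclidean_space) chart set \<Rightarrow> ('a, 'e) form2 \<Rightarrow> bool" where
  "two_form X A \<omega> \<longleftrightarrow>
     (\<forall>x\<in>topspace X. let T = tangent_space A x in
        (\<forall>u\<in>T. \<forall>v\<in>T. \<forall>w\<in>T. \<forall>r s. \<omega> x (r *\<^sub>R u + s *\<^sub>R v) w = r * \<omega> x u w + s * \<omega> x v w) \<and>
        (\<forall>u\<in>T. \<forall>v\<in>T. \<omega> x u v = - \<omega> x v u)) \<and>
     (\<forall>c\<in>A. \<forall>a b. smooth_on (snd c ` fst c) (\<lambda>z. local_form A \<omega> c z a b))"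

text \<open>The local expression of \<open>d\<omega>\<close>. On constant vector fields the bracket terms of the invariant
  formula vanish.\<close>

definition local_ext_deriv :: "('a, 'e::euclidean_space) chart set \<Rightarrow> ('a, 'e) form2 \<Rightarrow>
    ('a, 'e) chart \<Rightarrow> 'e \<Rightarrow> 'e \<Rightarrow> 'e \<Rightarrow> 'e \<Rightarrow> real" where
  "local_ext_deriv A \<omega> c z a b e =
     frechet_derivative (\<lambda>z. local_form A \<omega> c z b e) (at z) a
   - frechet_derivative (\<lambda>z. local_form A \<omega> c z a e) (at z) b
   + frechet_derivative (\<lambda>z. local_form A \<omega> c z a b) (at z) e"

definition closed_form ::
    "('a, 'e::euclidean_space) chart set \<Rightarrow> ('a, 'e) form2 \<Rightarrow> bool" where
  "closed_form A \<omega> \<longleftrightarrow>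
     (\<forall>c\<in>A. \<forall>z\<in>snd c ` fst c. \<forall>a b e. local_ext_deriv A \<omega> c z a b e = 0)"

definition form_kernel ::
    "('a, 'e::euclidean_space) chart set \<Rightarrow> ('a, 'e) form2 \<Rightarrow> 'a \<Rightarrow> ('a, 'e) tangent set" where
  "form_kernel A \<omega> x = {v \<in> tangent_space A x. \<forall>w\<in>tangent_space A x. \<omega> x v w = 0}"


section \<open>Distributions\<close>

definition distribution :: "'a topology \<Rightarrow> ('a, 'e::euclidean_space) chart set \<Rightarrow> nat \<Rightarrow>
    ('a \<Rightarrow> ('a, 'e) tangent set) \<Rightarrow> bool" where
  "distribution X A r V \<longleftrightarrow>
     (\<forall>x\<in>topspace X. subspace (V x) \<and> V x \<subseteq> tangent_space A x \<and> dim (V x) = r) \<and>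
     (\<forall>x\<in>topspace X. \<exists>U Y. openin X U \<and> x \<in> U \<and>
        (\<forall>j<r. smooth_vector_field A U (Y j)) \<and>
        (\<forall>y\<in>U. V y = span ((\<lambda>j. Y j y) ` {..<r})))"

text \<open>Embedded submanifolds are described by slice charts: around each of its points, \<open>N\<close> corresponds
  in some chart to a linear subspace \<open>E\<close>, which then is also its tangent space.\<close>

definition slice_chart :: "('a, 'e::euclidean_space) chart \<Rightarrow> 'e set \<Rightarrow> 'a set \<Rightarrow> bool" where
  "slice_chart c E N \<longleftrightarrow> subspace E \<and> snd c ` (fst c \<inter> N) = snd c ` fst c \<inter> E"

definition submanifold ::
    "'a topology \<Rightarrow> ('a, 'e::euclidean_space) chart set \<Rightarrow> 'a set \<Rightarrow> bool" where
  "submanifold X A N \<longleftrightarrow> N \<subseteq> topspace X \<and>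
     (\<forall>y\<in>N. \<exists>c\<in>charts_at A y. \<exists>E. slice_chart c E N)"

definition submanifold_tangent :: "('a, 'e::euclidean_space) chart set \<Rightarrow> 'a set \<Rightarrow> 'a \<Rightarrow>
    ('a, 'e) tangent set" where
  "submanifold_tangent A N y =
     {v \<in> tangent_space A y. \<exists>c\<in>charts_at A y. \<exists>E. slice_chart c E N \<and> v c \<in> E}"

text \<open>Integrability is the existence of an integral submanifold through every point, not
  involutivity and not the existence of flat charts. Since the condition is local, it makes no
  difference that integral submanifolds are embedded rather than immersed.\<close>

definition integral_submanifold :: "'a topology \<Rightarrow> ('a, 'e::euclidean_space) chart set \<Rightarrow>
    ('a \<Rightarrow> ('a, 'e) tangent set) \<Rightarrow> 'a set \<Rightarrow> bool" where
  "integral_submanifold X A V N \<longleftrightarrow> submanifold X A N \<and>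
     (\<forall>y\<in>N. submanifold_tangent A N y = V y)"

definition integrable_distribution :: "'a topology \<Rightarrow> ('a, 'e::euclidean_space) chart set \<Rightarrow> nat \<Rightarrow>
    ('a \<Rightarrow> ('a, 'e) tangent set) \<Rightarrow> bool" where
  "integrable_distribution X A r V \<longleftrightarrow> distribution X A r V \<and>
     (\<forall>x\<in>topspace X. \<exists>N. x \<in> N \<and> integral_submanifold X A V N)"


section \<open>\<open>k\<close>-symplectic manifolds\<close>

text \<open>The index type \<open>'k\<close> of the family of forms stands for \<open>{1..k}\<close>, so that \<open>k\<close> is its cardinality.\<close>

definition k_symplectic_manifold :: "'a topology \<Rightarrow> ('a, 'e::euclidean_space) chart set \<Rightarrow> nat \<Rightarrow>
    ('k::finite \<Rightarrow> ('a, 'e) form2) \<Rightarrow> ('a \<Rightarrow> ('a, 'e) tangent set) \<Rightarrow> bool" where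
  "k_symplectic_manifold X A n \<omega> V \<longleftrightarrow>
     smooth_manifold X A \<and> DIM('e) = n * (CARD('k) + 1) \<and>
     integrable_distribution X A (n * CARD('k)) V \<and>
     (\<forall>\<alpha>. two_form X A (\<omega> \<alpha>) \<and> closed_form A (\<omega> \<alpha>)) \<and>
     (\<forall>x\<in>topspace X. \<forall>\<alpha>. \<forall>v\<in>V x. \<forall>w\<in>V x. \<omega> \<alpha> x v w = 0) \<and>
     (\<forall>x\<in>topspace X. (\<Inter>\<alpha>. form_kernel A (\<omega> \<alpha>) x) = {0})"


section \<open>Local coordinates\<close>

definition coord_chart :: "'a set \<Rightarrow> ('i::finite \<Rightarrow> 'a \<Rightarrow> real) \<Rightarrow> ('a, real ^ 'i) chart" where
  "coord_chart U \<xi> = (U, \<lambda>y. \<chi> i. \<xi> i y)"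

definition local_coordinates :: "'a topology \<Rightarrow> ('a, 'e::euclidean_space) chart set \<Rightarrow> 'a set \<Rightarrow>
    ('i::finite \<Rightarrow> 'a \<Rightarrow> real) \<Rightarrow> bool" where
  "local_coordinates X A U \<xi> \<longleftrightarrow> chart_on X (coord_chart U \<xi>) \<and>
     (\<forall>c\<in>A. smoothly_compatible c (coord_chart U \<xi>))"

definition coord_vector :: "('a, 'e::euclidean_space) chart set \<Rightarrow> 'a set \<Rightarrow>
    ('i::finite \<Rightarrow> 'a \<Rightarrow> real) \<Rightarrow> 'i \<Rightarrow> 'a \<Rightarrow> ('a, 'e) tangent" where
  "coord_vector A U \<xi> i y = chart_vector A (coord_chart U \<xi>) y (axis i 1)"

definition qp :: "('n \<Rightarrow> 'a \<Rightarrow> real) \<Rightarrow> ('k \<Rightarrow> 'n \<Rightarrow> 'a \<Rightarrow> real) \<Rightarrow> 'n + 'k \<times> 'n \<Rightarrow> 'a \<Rightarrow> real" where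
  "qp q p = case_sum q (\<lambda>(\<alpha>, i). p \<alpha> i)"

end

theory Submission
  imports Defs
begin

text \<open>Integrability provides charts in which \<open>V\<close> is a constant plane field. In such a chart choose
  linear functions \<open>q i\<close> that are constant on the leaves and separate them. Every \<open>\<omega> \<alpha>\<close> is closed and
  vanishes on the leaves, so it has a local primitive that itself vanishes on the leaves; such a primitive has
  the form \<open>- (\<Sum>i. p \<alpha> i * d q i)\<close>, and its exterior derivative is \<open>\<Sum>i. d q i \<and> d p \<alpha> i\<close>. A vector on
  which all \<open>d q i\<close> and \<open>d p \<alpha> i\<close> vanish lies in the kernel of every \<open>\<omega> \<alpha>\<close> and is zero. The functions
  \<open>q i\<close>, \<open>p \<alpha> i\<close> are as many as the dimension \<open>n (k + 1)\<close>, hence they are coordinates by the inverse function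
  theorem, and \<open>V\<close>, the common kernel of the \<open>d q i\<close>, is spanned by the \<open>\<partial>/\<partial>p \<alpha> i\<close>.

  The three ingredients are the theorems \<open>flat_chart_exists\<close>, \<open>relative_poincare\<close> and
  \<open>smooth_inverse_function\<close>. The primitive comes from two successive linear homotopies, one along the leaves
  and one across them. The flat chart is Frobenius' theorem: near a point \<open>V\<close> is the field of graphs of
    linear maps
  \<open>F z\<close> over a fixed plane, and the rays in this plane are lifted to curves tangent to \<open>V\<close>. The end point
  \<open>G z\<close> of the lifted ray depends smoothly on \<open>z\<close>, and the integrability condition, read off from the integral
  submanifolds and the symmetry of second derivatives, shows that \<open>G\<close> maps parallel planes to leaves.

  The smooth dependence is the analytic core. The lifted rays are the solutions of the integral equation
  \<open>G z = z + \<integral> F (G (rad s z)) (P z) ds\<close> over \<open>0 \<le> s \<le> 1\<close>, where \<open>rad s z\<close> runs through the segment from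
  \<open>z - P z\<close> to \<open>z\<close>. Its right hand side is a contraction near \<open>0\<close>, so a continuous solution exists
  (\<open>radial_fixpoint_exists\<close>); the solution is differentiable, and its derivatives solve equations of the same
  shape (\<open>radial_fixpoint_differentiable\<close>), so smoothness follows by induction (\<open>radial_fixpoint_Ck\<close>). With
  \<open>P = 0\<close> the same equation yields the inverse function theorem and the smoothness of matrix inversion.\<close>

section \<open>Calculus of \<open>k\<close> times continuously differentiable maps\<close>

abbreviation deriv_along :: "('a::real_normed_vector \<Rightarrow> 'b::real_normed_vector) \<Rightarrow> 'a \<Rightarrow> 'a \<Rightarrow> 'b" where
  "deriv_along f x v \<equiv> frechet_derivative f (at x) v"

lemma deriv_along_eq: "(f has_derivative f') (at x) \<Longrightarrow> deriv_along f x v = f' v"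
  by (metis frechet_derivative_at)

lemma has_derivative_deriv_along:
  "f differentiable (at x) \<Longrightarrow> (f has_derivative deriv_along f x) (at x)"
  by (simp add: frechet_derivative_works)

lemma Ck_on_cong:
  assumes "open S" "\<And>x. x \<in> S \<Longrightarrow> f x = g x" "Ck_on m S f"
  shows "Ck_on m S g"
  using assms
proof (induction m arbitrary: f g)
  case 0
  then show ?case by (simp cong: continuous_on_cong)
next
  case (Suc m)
  have g: "(g has_derivative deriv_along f x) (at x)" if "x \<in> S" for x
    using has_derivative_transform_within_open[of f "deriv_along f x" x UNIV S g] Suc.prems that
    by (auto simp: has_derivative_deriv_along)
  have "Ck_on m S (\<lambda>x. deriv_along g x v)" for v
    by (rule Suc.IH[of "\<lambda>x. deriv_along f x v"]) (use Suc.prems deriv_along_eq[OF g] in auto)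
  then show ?case using g by (auto simp: differentiable_def)
qed

lemma Ck_onI_deriv:
  assumes "open S" "\<And>x. x \<in> S \<Longrightarrow> (f has_derivative f' x) (at x)" "\<And>v. Ck_on m S (\<lambda>x. f' x v)"
  shows "Ck_on (Suc m) S f"
proof -
  have "Ck_on m S (\<lambda>x. deriv_along f x v)" for v
    by (rule Ck_on_cong[OF assms(1) _ assms(3)[of v]]) (simp add: deriv_along_eq[OF assms(2)])
  then show ?thesis using assms(2) by (auto simp: differentiable_def)
qed

lemma Ck_on_differentiable: "Ck_on (Suc m) S f \<Longrightarrow> x \<in> S \<Longrightarrow> f differentiable (at x)"
  by simp

lemma Ck_on_has_derivative:
  "Ck_on (Suc m) S f \<Longrightarrow> x \<in> S \<Longrightarrow> (f has_derivative deriv_along f x) (at x)"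
  by (simp add: has_derivative_deriv_along)

lemma Ck_on_subset: "Ck_on m S f \<Longrightarrow> T \<subseteq> S \<Longrightarrow> Ck_on m T f"
proof (induction m arbitrary: f)
  case 0
  then show ?case by (auto intro: continuous_on_subset)
qed auto

lemma Ck_on_SucD: "Ck_on (Suc m) S f \<Longrightarrow> Ck_on m S f"
proof (induction m arbitrary: f)
  case 0
  then show ?case
    by (auto simp: continuous_on_eq_continuous_within intro!: differentiable_imp_continuous_within
        differentiable_at_imp_differentiable_on intro: differentiable_at_withinI)
qed auto

lemma Ck_on_le: "Ck_on m S f \<Longrightarrow> k \<le> m \<Longrightarrow> Ck_on k S f"
  by (induction m) (auto simp: le_Suc_eq dest: Ck_on_SucD simp del: Ck_on.simps)

lemma Ck_on_continuous: "Ck_on m S f \<Longrightarrow> continuous_on S f"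
  using Ck_on_le[of m S f 0] by simp

lemma Ck_on_const: "Ck_on m S (\<lambda>x. c)"
proof (induction m arbitrary: c)
  case (Suc m)
  then show ?case by (auto simp: frechet_derivative_const)
qed auto

lemma Ck_on_bounded_linear:
  assumes "bounded_linear f"
  shows "Ck_on m S f"
proof (cases m)
  case 0
  then show ?thesis using linear_continuous_on[OF assms] by simp
next
  case (Suc k)
  have "deriv_along f x v = f v" for x v
    using bounded_linear_imp_has_derivative[OF assms] by (rule deriv_along_eq)
  then show ?thesis
    using Suc Ck_on_const assms by (auto intro: bounded_linear_imp_differentiable)
qed

lemma Ck_on_add:
  assumes "open S" "Ck_on m S f" "Ck_on m S g"
  shows "Ck_on m S (\<lambda>x. f x + g x)"
  using assms(2,3)
proof (induction m arbitrary: f g)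
  case 0
  then show ?case by (auto intro: continuous_intros)
next
  case (Suc m)
  show ?case
    by (rule Ck_onI_deriv[OF assms(1) has_derivative_add[OF Ck_on_has_derivative Ck_on_has_derivative]])
      (use Suc in auto)
qed

lemma Ck_on_sum:
  assumes "open S" "\<And>i. i \<in> I \<Longrightarrow> Ck_on m S (f i)"
  shows "Ck_on m S (\<lambda>x. \<Sum>i\<in>I. f i x)"
  using assms(2) by (induction I rule: infinite_finite_induct) (auto intro: Ck_on_add[OF assms(1)] Ck_on_const)

lemma Ck_on_linear_image:
  assumes "open S" "bounded_linear L" "Ck_on m S f"
  shows "Ck_on m S (\<lambda>x. L (f x))"
  using assms(3)
proof (induction m arbitrary: f)
  case 0
  then show ?case using linear_continuous_on[OF assms(2)]
    by (auto intro: bounded_linear.continuous_on[OF assms(2)])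
next
  case (Suc m)
  show ?case
    by (rule Ck_onI_deriv[OF assms(1) bounded_linear.has_derivative[OF assms(2) Ck_on_has_derivative]])
      (use Suc in auto)
qed

lemma Ck_on_bilinear:
  assumes "open S" "bounded_bilinear b" "Ck_on m S f" "Ck_on m S g"
  shows "Ck_on m S (\<lambda>x. b (f x) (g x))"
  using assms(3,4)
proof (induction m arbitrary: f g)
  case 0
  then show ?case by (auto intro: bounded_bilinear.continuous_on[OF assms(2)])
next
  case (Suc m)
  show ?case
    by (rule Ck_onI_deriv[OF assms(1) bounded_bilinear.FDERIV[OF assms(2) Ck_on_has_derivative
      Ck_on_has_derivative]])
      (use Suc Ck_on_SucD[OF Suc.prems(1)] Ck_on_SucD[OF Suc.prems(2)] in \<open>auto intro!: Ck_on_add[OF assms(1)]\<close>)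
qed

lemmas Ck_on_scaleR = Ck_on_bilinear[OF _ bounded_bilinear_scaleR]

lemma Ck_on_uminus: "open S \<Longrightarrow> Ck_on m S f \<Longrightarrow> Ck_on m S (\<lambda>x. - f x)"
  by (rule Ck_on_linear_image[where L="\<lambda>x. - x"]) (auto intro: bounded_linear_minus bounded_linear_ident)

lemma Ck_on_diff: "open S \<Longrightarrow> Ck_on m S f \<Longrightarrow> Ck_on m S g \<Longrightarrow> Ck_on m S (\<lambda>x. f x - g x)"
  using Ck_on_add[OF _ _ Ck_on_uminus] by fastforce

lemma Ck_on_inner_left: "open S \<Longrightarrow> Ck_on m S f \<Longrightarrow> Ck_on m S (\<lambda>x. f x \<bullet> b)"
  by (rule Ck_on_linear_image[where L="\<lambda>x. x \<bullet> b"]) (auto intro: bounded_linear_inner_left)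

lemma Ck_on_componentwise:
  assumes "open S" "\<And>b. b \<in> Basis \<Longrightarrow> Ck_on m S (\<lambda>x. f x \<bullet> b)"
  shows "Ck_on m S f"
proof -
  have "Ck_on m S (\<lambda>x. \<Sum>b\<in>Basis. (f x \<bullet> b) *\<^sub>R b)"
    by (intro Ck_on_sum Ck_on_scaleR Ck_on_const assms)
  then show ?thesis by (simp add: euclidean_representation)
qed

lemma Ck_on_Pair:
  assumes "open S" "Ck_on m S f" "Ck_on m S g"
  shows "Ck_on m S (\<lambda>x. (f x, g x))"
proof -
  have "Ck_on m S (\<lambda>x. (f x, 0) + (0, g x))"
    by (intro Ck_on_add assms Ck_on_linear_image[where L="\<lambda>x. (x, 0)"] Ck_on_linear_image[where L="\<lambda>x. (0, x)"])
      (auto intro!: bounded_linear_intros)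
  then show ?thesis by simp
qed

text \<open>Expanding a linear map in a basis turns smoothness for each fixed argument into smoothness
  for an argument that moves along.\<close>

lemma Ck_on_linear_apply:
  fixes A :: "'a::euclidean_space \<Rightarrow> 'b::euclidean_space \<Rightarrow> 'c::euclidean_space"
  assumes "open S" "\<And>x. x \<in> S \<Longrightarrow> linear (A x)"
    and "\<And>w. Ck_on m S (\<lambda>x. A x w)" "Ck_on m S f"
  shows "Ck_on m S (\<lambda>x. A x (f x))"
proof (rule Ck_on_cong[OF assms(1)])
  show "Ck_on m S (\<lambda>x. \<Sum>b\<in>Basis. (f x \<bullet> b) *\<^sub>R A x b)"
    by (intro Ck_on_sum Ck_on_scaleR Ck_on_inner_left assms)
  show "(\<Sum>b\<in>Basis. (f x \<bullet> b) *\<^sub>R A x b) = A x (f x)" if "x \<in> S" for x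
    using linear_sum[OF assms(2)[OF that], of "\<lambda>b. (f x \<bullet> b) *\<^sub>R b" Basis]
    by (simp add: linear_scale[OF assms(2)[OF that]] euclidean_representation)
qed

lemma Ck_on_compose:
  assumes "open S" "open T" "Ck_on m S f" "Ck_on m T g" "f ` S \<subseteq> T"
  shows "Ck_on m S (\<lambda>x. g (f x))"
  using assms(3-5)
proof (induction m arbitrary: g)
  case 0
  then show ?case by (auto intro: continuous_on_compose2)
next
  case (Suc m)
  have fx: "f x \<in> T" if "x \<in> S" for x using Suc.prems that by auto
  show ?case
  proof (rule Ck_onI_deriv[OF assms(1)])
    show "((\<lambda>x. g (f x)) has_derivative (\<lambda>v. deriv_along g (f x) (deriv_along f x v))) (at x)"
      if "x \<in> S" for x
      using has_derivative_compose[OF Ck_on_has_derivative[OF Suc.prems(1) that]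
        Ck_on_has_derivative[OF Suc.prems(2) fx[OF that]]] .
    show "Ck_on m S (\<lambda>x. deriv_along g (f x) (deriv_along f x v))" for v
    proof (rule Ck_on_linear_apply[OF assms(1), where A="\<lambda>x. deriv_along g (f x)"])
      show "linear (deriv_along g (f x))" if "x \<in> S" for x
        using Ck_on_has_derivative[OF Suc.prems(2) fx[OF that]] has_derivative_linear by blast
      show "Ck_on m S (\<lambda>x. deriv_along g (f x) w)" for w
        by (rule Suc.IH) (use Suc.prems Ck_on_SucD[OF Suc.prems(1)] in auto)
      show "Ck_on m S (\<lambda>x. deriv_along f x v)" using Suc.prems by simp
    qed
  qed
qed

lemma linear_apply_has_derivative:
  fixes A :: "'a::euclidean_space \<Rightarrow> 'b::euclidean_space \<Rightarrow> 'c::euclidean_space"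
  assumes S: "open S" and lin: "\<And>z. z \<in> S \<Longrightarrow> linear (A z)" and sm: "\<And>w. Ck_on (Suc 0) S (\<lambda>z. A z w)"
    and xt: "x t \<in> S" and x: "(x has_derivative x') (at t)" and u: "(u has_derivative u') (at t)"
  shows "((\<lambda>t. A (x t) (u t)) has_derivative (\<lambda>h. deriv_along (\<lambda>z. A z (u t)) (x t) (x' h) + A (x t) (u'
    h))) (at t)"
proof -
  let ?\<Phi> = "\<lambda>q. A (fst q) (snd q)"
  have o: "open (S \<times> UNIV :: ('a \<times> 'b) set)" using S by (intro open_Times) auto
  have l: "bounded_linear (fst :: 'a \<times> 'b \<Rightarrow> 'a)" "bounded_linear (snd :: 'a \<times> 'b \<Rightarrow> 'b)"
    by (auto intro!: bounded_linear_intros)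
  have base: "Ck_on (Suc 0) (S \<times> UNIV) (\<lambda>q :: 'a \<times> 'b. A (fst q) w)" for w
    by (rule Ck_on_compose[OF o S Ck_on_bounded_linear[OF l(1)] sm]) auto
  have "Ck_on (Suc 0) (S \<times> UNIV) ?\<Phi>"
    by (rule Ck_on_linear_apply[OF o, where A="\<lambda>q. A (fst q)", OF _ base Ck_on_bounded_linear[OF l(2)]])
      (use lin in auto)
  then obtain D where D: "(?\<Phi> has_derivative D) (at (x t, u t))"
    using Ck_on_differentiable[of 0 "S \<times> UNIV" ?\<Phi> "(x t, u t)"] xt unfolding differentiable_def by blast
  have i: "((\<lambda>z. (z, u t)) has_derivative (\<lambda>h. (h, 0))) (at (x t))"
    "((\<lambda>w. (x t, w)) has_derivative (\<lambda>h. (0, h))) (at (u t))"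
    by (intro has_derivative_Pair has_derivative_const has_derivative_ident)+
  have 1: "deriv_along (\<lambda>z. A z (u t)) (x t) h = D (h, 0)" for h
    using has_derivative_compose[OF i(1) D] by (intro deriv_along_eq) simp
  have bl: "bounded_linear (A (x t))" using lin[OF xt] linear_conv_bounded_linear by blast
  have "((\<lambda>w. A (x t) w) has_derivative (\<lambda>h. D (0, h))) (at (u t))"
    using has_derivative_compose[OF i(2) D] by simp
  from has_derivative_unique[OF this bounded_linear_imp_has_derivative[OF bl]]
  have 2: "D (0, h) = A (x t) h" for h by metis
  have 3: "D (a, b) = deriv_along (\<lambda>z. A z (u t)) (x t) a + A (x t) b" for a b
    using linear_add[OF has_derivative_linear[OF D], of "(a, 0)" "(0, b)"] by (simp add: 1 2)
  from has_derivative_compose[OF has_derivative_Pair[OF x u] D] show ?thesis by (simp add: 3)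
qed

text \<open>The derivative as an element of the Banach space of bounded linear maps, for estimates and
  continuity in the operator norm.\<close>

definition fderiv :: "('a::real_normed_vector \<Rightarrow> 'b::real_normed_vector) \<Rightarrow> 'a \<Rightarrow> 'a \<Rightarrow>\<^sub>L 'b" where
  "fderiv f x = Blinfun (frechet_derivative f (at x))"

lemma fderiv_apply:
  assumes "f differentiable (at x)"
  shows "blinfun_apply (fderiv f x) = deriv_along f x"
  unfolding fderiv_def
  by (rule bounded_linear_Blinfun_apply) (use assms has_derivative_bounded_linear has_derivative_deriv_along
    in blast)

lemma Ck_on_has_fderiv:
  "Ck_on (Suc m) S f \<Longrightarrow> x \<in> S \<Longrightarrow> (f has_derivative blinfun_apply (fderiv f x)) (at x)"
  by (simp add: fderiv_apply has_derivative_deriv_along)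

lemma Ck_on_continuous_fderiv:
  assumes "Ck_on (Suc m) S f"
  shows "continuous_on S (fderiv f)"
proof (rule continuous_on_blinfun_componentwise)
  fix b :: 'a
  have "continuous_on S (\<lambda>x. deriv_along f x b)"
    using assms Ck_on_continuous[of m S "\<lambda>x. deriv_along f x b"] by simp
  then show "continuous_on S (\<lambda>x. blinfun_apply (fderiv f x) b)"
    by (rule continuous_on_eq) (use assms in \<open>simp add: fderiv_apply\<close>)
qed

text \<open>The integrals below depend on a parameter only through a map that is smooth in the integration
  variable and the parameter jointly; this form is stable under differentiation, so that iterating it
  gives \<open>Ck_on_integral\<close>.\<close>

lemma has_derivative_integral_param:
  fixes f :: "real \<times> 'a::euclidean_space \<Rightarrow> 'b::euclidean_space"
  assumes "open Z" "{0..1} \<times> Z \<subseteq> O'" and f: "Ck_on (Suc m) O' f" and z: "z \<in> Z"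
  shows "((\<lambda>z. integral {0..1} (\<lambda>s. f (s, z))) has_derivative
    (\<lambda>v. integral {0..1} (\<lambda>s. deriv_along f (s, z) (0, v)))) (at z)"
proof -
  have mem: "(s, z) \<in> O'" if "s \<in> {0..1}" "z \<in> Z" for s z using assms(2) that by auto
  have cont: "continuous_on O' f" using f Ck_on_continuous by blast
  have inc: "bounded_linear (\<lambda>v::'a. (0::real, v))" by (auto intro!: bounded_linear_intros)
  define i where "i = Blinfun (\<lambda>v::'a. (0::real, v))"
  have i: "blinfun_apply i v = (0, v)" for v
    unfolding i_def by (simp add: bounded_linear_Blinfun_apply[OF inc])
  obtain e where e: "e > 0" "ball z e \<subseteq> Z" using assms(1) z openE by blast
  let ?D = "\<lambda>x s. fderiv f (s, x) o\<^sub>L i"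
  have Dc: "continuous_on (ball z e \<times> cbox 0 1) (\<lambda>(x, s). ?D x s)"
    unfolding split_beta
    by (intro continuous_intros continuous_on_compose2[OF Ck_on_continuous_fderiv[OF f]])
      (use e mem in auto)
  have "((\<lambda>x. integral (cbox 0 1) (\<lambda>s. f (s, x))) has_derivative
     integral (cbox 0 1) (?D z)) (at z within ball z e)"
  proof (rule leibniz_rule[OF _ _ Dc])
    fix x and t :: real assume x: "x \<in> ball z e" "t \<in> cbox 0 1"
    then have fd: "(f has_derivative fderiv f (t, x)) (at (t, x))"
      using Ck_on_has_fderiv[OF f] mem e by auto
    have "((\<lambda>x. (t, x)) has_derivative (\<lambda>v. (0, v))) (at x)"
      by (intro has_derivative_Pair has_derivative_const has_derivative_ident)
    from has_derivative_compose[OF this fd]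
    have "((\<lambda>x. f (t, x)) has_derivative (\<lambda>v. fderiv f (t, x) (0, v))) (at x)" .
    moreover have "blinfun_apply (?D x t) = (\<lambda>v. fderiv f (t, x) (0, v))"
      by (simp add: fun_eq_iff i)
    ultimately show "((\<lambda>x. f (t, x)) has_derivative ?D x t) (at x within ball z e)"
      by (metis has_derivative_at_withinI)
  next
    fix x assume x: "x \<in> ball z e"
    show "(\<lambda>s. f (s, x)) integrable_on cbox 0 1"
      by (rule integrable_continuous, rule continuous_on_compose2[OF cont])
        (use x e mem in \<open>auto intro!: continuous_intros\<close>)
  qed (use e in auto)
  then have "((\<lambda>x. integral {0..1} (\<lambda>s. f (s, x))) has_derivative integral {0..1} (?D z)) (at z)"
    using e by (simp add: at_within_open[of z "ball z e"])
  moreover have "integral {0..1} (?D z) v = integral {0..1} (\<lambda>s. deriv_along f (s, z) (0, v))" for v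
  proof -
    have "(?D z) integrable_on {0..1}"
      unfolding cbox_interval[symmetric]
      by (rule integrable_continuous, intro continuous_intros continuous_on_compose2[OF
        Ck_on_continuous_fderiv[OF f]])
        (use z mem in auto)
    then have "integral {0..1} (?D z) v = integral {0..1} (\<lambda>s. ?D z s v)"
      by (rule blinfun_apply_integral)
    also have "\<dots> = integral {0..1} (\<lambda>s. deriv_along f (s, z) (0, v))"
      by (rule integral_cong) (use f mem z in \<open>simp add: i fderiv_apply\<close>)
    finally show ?thesis .
  qed
  ultimately show ?thesis
    by (metis (no_types, lifting) has_derivative_eq_rhs ext)
qed

lemma Ck_on_integral:
  fixes f :: "real \<times> 'a::euclidean_space \<Rightarrow> 'b::euclidean_space"
  assumes "open Z" "{0..1} \<times> Z \<subseteq> O'" "Ck_on m O' f"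
  shows "Ck_on m Z (\<lambda>z. integral {0..1} (\<lambda>s. f (s, z)))"
  using assms(3)
proof (induction m arbitrary: f)
  case 0
  have "continuous_on (Z \<times> cbox 0 1) (\<lambda>x. f (prod.swap x))"
    using 0 assms(2) by (auto intro!: continuous_on_compose2[of O' f] continuous_intros simp: prod.swap_def)
  then show ?case
    using integral_continuous_on_param[of Z 0 1 "\<lambda>z s. f (s, z)"] by (simp add: split_beta prod.swap_def)
next
  case (Suc m)
  show ?case
  proof (rule Ck_onI_deriv[OF assms(1) has_derivative_integral_param[OF assms(1,2) Suc.prems]])
    show "Ck_on m Z (\<lambda>z. integral {0..1} (\<lambda>s. deriv_along f (s, z) (0, v)))" for v
      by (rule Suc.IH) (use Suc.prems in simp)
  qed
qed

section \<open>Radial integral equations\<close>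

text \<open>For an idempotent linear map the last condition characterises orthogonal projections. It is used
  in this form because it keeps the segments from \<open>z - P z\<close> to \<open>z\<close> inside every ball around \<open>0\<close>.\<close>

locale orth_projection =
  fixes P :: "'a::euclidean_space \<Rightarrow> 'a"
  assumes linear: "linear P"
    and idem [simp]: "P (P x) = P x"
    and norm_compl: "norm (x - P x) \<le> norm x"
begin

text \<open>The point that divides the segment from \<open>z - P z\<close> to \<open>z\<close> in the ratio \<open>s : 1 - s\<close>. Integrating along
  these segments replaces an ordinary differential equation with parameters by an integral equation
  without a time variable: the value at the end of a segment is expressed by the values at its
  points.\<close>

definition rad :: "real \<Rightarrow> 'a \<Rightarrow> 'a" where
  "rad s z = z - P z + s *\<^sub>R P z"

definition radL :: "real \<Rightarrow> 'a \<Rightarrow>\<^sub>L 'a" where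
  "radL s = id_blinfun - Blinfun P + s *\<^sub>R Blinfun P"

lemma bounded_linear: "bounded_linear P"
  using linear linear_conv_bounded_linear by blast

lemma radL_apply: "blinfun_apply (radL s) z = rad s z"
  by (simp add: radL_def rad_def blinfun.bilinear_simps bounded_linear_Blinfun_apply[OF bounded_linear])

lemma norm_rad_le:
  assumes "s \<in> {0..1}"
  shows "norm (rad s z) \<le> norm z"
proof -
  have "rad s z = (1 - s) *\<^sub>R (z - P z) + s *\<^sub>R z"
    by (simp add: rad_def algebra_simps)
  also have "norm \<dots> \<le> (1 - s) * norm (z - P z) + s * norm z"
    using assms by (intro order_trans[OF norm_triangle_ineq]) auto
  also have "\<dots> \<le> (1 - s) * norm z + s * norm z"
    using assms norm_compl[of z] by (intro add_right_mono mult_left_mono) auto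
  finally show ?thesis by (simp add: algebra_simps)
qed

lemma norm_radL_le: "s \<in> {0..1} \<Longrightarrow> norm (radL s) \<le> 1"
  by (rule norm_blinfun_bound) (auto simp: radL_apply norm_rad_le)

lemma linear_rad: "linear (rad s)"
  unfolding radL_apply[symmetric, abs_def] using blinfun.bounded_linear_right bounded_linear.linear by blast

lemma rad_diff: "rad s (x - y) = rad s x - rad s y"
  by (rule linear_diff[OF linear_rad])

lemma continuous_on_radL [continuous_intros]:
  "continuous_on S g \<Longrightarrow> continuous_on S (\<lambda>x. radL (g x))"
  unfolding radL_def by (intro continuous_intros)

lemma continuous_on_rad [continuous_intros]:
  assumes "continuous_on S g" "continuous_on S h"
  shows "continuous_on S (\<lambda>x. rad (g x) (h x))"
  unfolding radL_apply[symmetric] by (intro continuous_intros assms)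

lemma Ck_on_rad:
  assumes "open S" "Ck_on m S g" "Ck_on m S h"
  shows "Ck_on m S (\<lambda>x. rad (g x) (h x))"
  unfolding rad_def
  by (intro Ck_on_add Ck_on_diff Ck_on_scaleR Ck_on_linear_image[OF _ bounded_linear] assms)

lemma rad_in_cball: "s \<in> {0..1} \<Longrightarrow> z \<in> cball 0 r \<Longrightarrow> rad s z \<in> cball 0 r"
  using norm_rad_le[of s z] by auto

lemma rad_in_ball: "s \<in> {0..1} \<Longrightarrow> z \<in> ball 0 r \<Longrightarrow> rad s z \<in> ball 0 r"
  using norm_rad_le[of s z] by auto

text \<open>The right hand side is a contraction of the space of continuous maps from the closed ball to
  \<open>B\<close>. Extending these maps along the nearest point retraction makes them bounded continuous
  functions on the whole space, to which the contraction principle applies.\<close>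

lemma radial_fixpoint_exists:
  fixes a :: "'a \<Rightarrow> 'g::banach" and f :: "real \<Rightarrow> 'a \<Rightarrow> 'g \<Rightarrow> 'g"
  assumes "r \<ge> 0" "closed B" "b0 \<in> B" "continuous_on (cball 0 r) a"
    and f: "continuous_on ({0..1} \<times> cball 0 r \<times> B) (\<lambda>(s, z, w). f s z w)"
    and into: "\<And>g z. \<lbrakk>continuous_on (cball 0 r) g; g ` cball 0 r \<subseteq> B; z \<in> cball 0 r\<rbrakk> \<Longrightarrow>
      a z + integral {0..1} (\<lambda>s. f s z (g (rad s z))) \<in> B"
    and contr: "\<And>s z w w'. \<lbrakk>s \<in> {0..1}; z \<in> cball 0 r; w \<in> B; w' \<in> B\<rbrakk> \<Longrightarrow>
      norm (f s z w - f s z w') \<le> norm (w - w') / 2"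
  obtains G where "continuous_on (cball 0 r) G" "G ` cball 0 r \<subseteq> B"
    "\<And>z. z \<in> cball 0 r \<Longrightarrow> G z = a z + integral {0..1} (\<lambda>s. f s z (G (rad s z)))"
proof -
  let ?K = "cball (0::'a) r"
  define p where "p = closest_point ?K"
  have p: "p z \<in> ?K" for z
    unfolding p_def by (rule closest_point_in_set) (use assms(1) in auto)
  have pK: "p z = z" if "z \<in> ?K" for z
    unfolding p_def by (rule closest_point_self[OF that])
  have pc: "continuous_on S p" for S
    unfolding p_def by (rule continuous_on_closest_point) (use assms(1) in auto)
  define T where "T g z = a z + integral {0..1} (\<lambda>s. f s z (g (rad s z)))" for g z
  have int_cont: "continuous_on {0..1} (\<lambda>s. f s z (g (rad s z)))"
    if "continuous_on ?K g" "g ` ?K \<subseteq> B" "z \<in> ?K" for g z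
    using rad_in_cball[of _ z r] that
    by (intro continuous_on_compose2[OF f, of "{0..1}" "\<lambda>s. (s, z, g (rad s z))", simplified]
        continuous_intros continuous_on_compose2[OF that(1)]) auto
  have Tc: "continuous_on ?K (T g)" if "continuous_on ?K g" "g ` ?K \<subseteq> B" for g
  proof -
    have "continuous_on (?K \<times> cbox 0 1) (\<lambda>(z, s). f s z (g (rad s z)))"
    proof -
      have "continuous_on (?K \<times> cbox 0 1) (\<lambda>x. (snd x, fst x, g (rad (snd x) (fst x))))"
        using rad_in_cball[of _ _ r]
        by (auto intro!: continuous_intros continuous_on_compose2[OF that(1)])
      moreover have "(\<lambda>x. (snd x, fst x, g (rad (snd x) (fst x)))) ` (?K \<times> cbox 0 1) \<subseteq> {0..1} \<times> ?K \<times> B"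
        using rad_in_cball[of _ _ r] that by (fastforce simp: image_subset_iff)
      ultimately show ?thesis
        using continuous_on_compose2[OF f] by (fastforce simp: split_beta)
    qed
    from integral_continuous_on_param[OF this] show ?thesis
      unfolding T_def using assms(4) by (auto intro!: continuous_intros)
  qed
  define S where "S = PiC UNIV (\<lambda>_::'a. B)"
  define \<Phi> where "\<Phi> g = Bcontfun (\<lambda>z. T (apply_bcontfun g) (p z))" for g :: "'a \<Rightarrow>\<^sub>C 'g"
  have gS: "apply_bcontfun g z \<in> B" if "g \<in> S" for g z
    using that by (auto simp: S_def mem_PiC_iff)
  have \<Phi>: "apply_bcontfun (\<Phi> g) z = T (apply_bcontfun g) (p z)" if "g \<in> S" for g z
  proof -
    have c: "continuous_on ?K (T (apply_bcontfun g))"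
      by (rule Tc) (use gS[OF that] in auto)
    have "bounded (T (apply_bcontfun g) ` ?K)"
      using compact_continuous_image[OF c compact_cball] compact_imp_bounded by blast
    moreover have "range (\<lambda>z. T (apply_bcontfun g) (p z)) \<subseteq> T (apply_bcontfun g) ` ?K"
      using p by auto
    ultimately have "bounded (range (\<lambda>z. T (apply_bcontfun g) (p z)))"
      using bounded_subset by blast
    moreover have "continuous_on UNIV (\<lambda>z. T (apply_bcontfun g) (p z))"
      by (rule continuous_on_compose2[OF c pc]) (use p in auto)
    ultimately show ?thesis
      unfolding \<Phi>_def by (subst Bcontfun_inverse) (auto simp: bcontfun_def)
  qed
  have "\<exists>!g\<in>S. \<Phi> g = g"
  proof (rule Banach_fix[where c="1/2"])
    show "complete S"
      unfolding S_def complete_eq_closed by (rule closed_PiC) (use assms(2) in auto)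
    show "S \<noteq> {}"
    proof -
      have "const_bcontfun b0 \<in> S"
        using assms(3) by (auto simp: S_def mem_PiC_iff const_bcontfun.rep_eq)
      then show ?thesis by blast
    qed
    show "\<Phi> ` S \<subseteq> S"
    proof clarify
      fix g assume g: "g \<in> S"
      have "T (apply_bcontfun g) (p z) \<in> B" for z
        unfolding T_def by (rule into) (use gS[OF g] p in auto)
      then show "\<Phi> g \<in> S" by (auto simp: S_def mem_PiC_iff \<Phi>[OF g])
    qed
    show "dist (\<Phi> g) (\<Phi> h) \<le> 1/2 * dist g h" if g: "g \<in> S" and h: "h \<in> S" for g h
    proof (rule dist_bound)
      fix z
      let ?z = "p z"
      have cg: "continuous_on {0..1} (\<lambda>s. f s ?z (apply_bcontfun g (rad s ?z)))"
        and ch: "continuous_on {0..1} (\<lambda>s. f s ?z (apply_bcontfun h (rad s ?z)))"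
        using gS[OF g] gS[OF h] p by (auto intro!: int_cont)
      have "T (apply_bcontfun g) ?z - T (apply_bcontfun h) ?z
          = integral {0..1} (\<lambda>s. f s ?z (apply_bcontfun g (rad s ?z)) - f s ?z (apply_bcontfun h (rad s ?z)))"
        unfolding T_def using cg ch by (simp add: integral_diff integrable_continuous_real)
      also have "norm \<dots> \<le> 1/2 * dist g h * (1 - 0)"
      proof (rule integral_bound)
        fix s :: real assume s: "s \<in> {0..1}"
        have "norm (f s ?z (apply_bcontfun g (rad s ?z)) - f s ?z (apply_bcontfun h (rad s ?z)))
          \<le> norm (apply_bcontfun g (rad s ?z) - apply_bcontfun h (rad s ?z)) / 2"
          by (rule contr) (use s p gS[OF g] gS[OF h] in auto)
        also have "\<dots> \<le> 1/2 * dist g h"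
          using dist_bounded[of g "rad s ?z" h] by (simp add: dist_norm)
        finally show "norm (f s ?z (apply_bcontfun g (rad s ?z)) - f s ?z (apply_bcontfun h (rad s ?z)))
          \<le> 1/2 * dist g h" .
      qed (use cg ch in \<open>auto intro!: continuous_intros\<close>)
      finally show "dist (apply_bcontfun (\<Phi> g) z) (apply_bcontfun (\<Phi> h) z) \<le> 1/2 * dist g h"
        by (simp add: \<Phi>[OF g] \<Phi>[OF h] dist_norm)
    qed
  qed auto
  then obtain g where g: "g \<in> S" "\<Phi> g = g" by blast
  have eq: "apply_bcontfun g z = T (apply_bcontfun g) z" if "z \<in> ?K" for z
    using \<Phi>[OF g(1), of z] g(2) pK[OF that] by simp
  show thesis
  proof (rule that)
    show "continuous_on ?K (apply_bcontfun g)" "apply_bcontfun g ` ?K \<subseteq> B"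
      using gS[OF g(1)] by auto
  qed (rule eq[unfolded T_def])
qed

end

text \<open>Estimates for fixed points of contractions: every bound that holds up to an additive constant
  holds without it, because the constant may be halved again and again.\<close>

lemma le_by_halving:
  fixes \<phi> \<beta> :: "'p \<Rightarrow> real"
  assumes "\<And>p. p \<in> S \<Longrightarrow> \<phi> p \<le> M" "\<And>p. p \<in> S \<Longrightarrow> 0 \<le> \<beta> p" "M \<ge> 0"
    and step: "\<And>c p. \<lbrakk>c \<ge> 0; \<And>q. q \<in> S \<Longrightarrow> \<phi> q \<le> \<beta> q + c; p \<in> S\<rbrakk> \<Longrightarrow> \<phi> p \<le> \<beta> p + c / 2"
    and "p \<in> S"
  shows "\<phi> p \<le> \<beta> p"
proof (rule ccontr)
  assume "\<not> \<phi> p \<le> \<beta> p"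
  have *: "\<forall>p\<in>S. \<phi> p \<le> \<beta> p + M * (1/2) ^ j" for j :: nat
  proof (induction j)
    case 0
    then show ?case using assms(1,2) by fastforce
  next
    case (Suc j)
    then show ?case using step[of "M * (1/2) ^ j"] assms(3) by fastforce
  qed
  obtain j :: nat where j: "(1/2) ^ j < (\<phi> p - \<beta> p) / (M + 1)"
    using real_arch_pow_inv[of "(\<phi> p - \<beta> p) / (M + 1)" "1/2"] \<open>\<not> \<phi> p \<le> \<beta> p\<close> assms(3) by auto
  have "M * (1/2) ^ j \<le> (M + 1) * (1/2) ^ j" by (simp add: algebra_simps)
  also have "\<dots> < \<phi> p - \<beta> p" using j assms(3) by (simp add: field_simps)
  finally have "M * (1/2) ^ j < \<phi> p - \<beta> p" .
  moreover have "\<phi> p \<le> \<beta> p + M * (1/2) ^ j" using *[of j] assms(5) by blast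
  ultimately show False by linarith
qed

lemma norm_deriv_le_lipschitz:
  fixes g :: "'a::real_normed_vector \<Rightarrow> 'b::real_normed_vector"
  assumes g: "(g has_derivative g') (at x)" and "open S" "x \<in> S"
    and lip: "\<And>y. y \<in> S \<Longrightarrow> norm (g y - g x) \<le> L * norm (y - x)"
  shows "norm (g' v) \<le> L * norm v"
proof (cases "v = 0")
  case True
  then show ?thesis using has_derivative_bounded_linear[OF g] by (simp add: linear_simps)
next
  case False
  interpret g': bounded_linear g' using has_derivative_bounded_linear[OF g] .
  show ?thesis
  proof (rule field_le_epsilon)
    fix e :: real assume "e > 0"
    then have e': "e / norm v > 0" using False by simp
    then obtain d where d: "d > 0" "\<And>y. norm (y - x) < d \<Longrightarrow> norm (g y - g x - g' (y - x))
      \<le> e / norm v * norm (y - x)"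
      using g unfolding has_derivative_at_alt by blast
    obtain d' where d': "d' > 0" "ball x d' \<subseteq> S" using assms(2,3) openE by blast
    define t where "t = min d d' / (2 * norm v)"
    have t: "t > 0" "norm (t *\<^sub>R v) < d" "norm (t *\<^sub>R v) < d'"
      using d(1) d'(1) False by (auto simp: t_def field_simps)
    have "x + t *\<^sub>R v \<in> S" using d' t by (auto simp: dist_norm subset_iff)
    then have "norm (g (x + t *\<^sub>R v) - g x) \<le> L * (t * norm v)"
      using lip[of "x + t *\<^sub>R v"] t by simp
    moreover have "norm (g (x + t *\<^sub>R v) - g x - t *\<^sub>R g' v) \<le> e / norm v * (t * norm v)"
      using d(2)[of "x + t *\<^sub>R v"] t by (simp add: g'.scaleR)
    moreover have "norm (t *\<^sub>R g' v) \<le> norm (g (x + t *\<^sub>R v) - g x) + norm (g (x + t *\<^sub>R v) - g x - t *\<^sub>R g' v)"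
      using norm_triangle_ineq4[of "g (x + t *\<^sub>R v) - g x" "g (x + t *\<^sub>R v) - g x - t *\<^sub>R g' v"] by simp
    ultimately have "t * norm (g' v) \<le> L * (t * norm v) + e * t"
      using t False by simp
    then have "t * norm (g' v) \<le> t * (L * norm v + e)" by (simp add: algebra_simps)
    then show "norm (g' v) \<le> L * norm v + e" using t by simp
  qed
qed

context orth_projection begin

text \<open>Candidate derivative: differentiate the equation formally and solve the resulting linear
  equation for a continuous \<open>U\<close>. The remainder of \<open>G\<close> with respect to \<open>U\<close> satisfies an estimate to which
  the halving principle applies.\<close>

proposition radial_fixpoint_differentiable:
  fixes a G :: "'a \<Rightarrow> 'b::euclidean_space" and f :: "real \<times> 'a \<times> 'b \<Rightarrow> 'b"
  assumes O': "open O'" "{0..1} \<times> ball 0 r \<times> B \<subseteq> O'" and B: "open B" "convex B"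
    and f: "Ck_on (Suc 0) O' f" and a: "Ck_on (Suc 0) (ball 0 r) a"
    and G: "continuous_on (ball 0 r) G" "G ` ball 0 r \<subseteq> B"
    and eq: "\<And>z. z \<in> ball 0 r \<Longrightarrow> G z = a z + integral {0..1} (\<lambda>s. f (s, z, G (rad s z)))"
    and lip: "\<And>s z w w'. \<lbrakk>s \<in> {0..1}; z \<in> ball 0 r; w \<in> B; w' \<in> B\<rbrakk> \<Longrightarrow>
      norm (f (s, z, w) - f (s, z, w')) \<le> norm (w - w') / 2"
    and z0: "z0 \<in> ball 0 r"
  shows "G differentiable (at z0)"
    and "deriv_along G z0 v = deriv_along a z0 v + integral {0..1} (\<lambda>s.
      deriv_along f (s, z0, G (rad s z0)) (0, v, deriv_along G (rad s z0) (rad s v)))"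
    and "isCont (\<lambda>z. deriv_along G z v) z0"
proof -
  define iz where "iz = Blinfun (\<lambda>v::'a. (0::real, v, 0::'b))"
  define iw where "iw = Blinfun (\<lambda>w::'b. (0::real, 0::'a, w))"
  have iz: "blinfun_apply iz v = (0, v, 0)" for v
    unfolding iz_def by (subst bounded_linear_Blinfun_apply) (auto intro!: bounded_linear_intros)
  have iw: "blinfun_apply iw w = (0, 0, w)" for w
    unfolding iw_def by (subst bounded_linear_Blinfun_apply) (auto intro!: bounded_linear_intros)
  have F1c: "continuous_on O' (fderiv f)" by (rule Ck_on_continuous_fderiv[OF f])
  have fd: "(f has_derivative fderiv f p) (at p)" if "p \<in> O'" for p
    by (rule Ck_on_has_fderiv[OF f that])
  have fz: "((\<lambda>z. f (s, z, w)) has_derivative (fderiv f (s, z, w) o\<^sub>L iz)) (at z)"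
    if "(s, z, w) \<in> O'" for s z w
  proof -
    have "((\<lambda>z. (s, z, w)) has_derivative (\<lambda>v. (0, v, 0))) (at z)"
      by (intro has_derivative_Pair has_derivative_const has_derivative_ident)
    from has_derivative_compose[OF this fd[OF that]] show ?thesis
      by (rule has_derivative_eq_rhs) (simp add: fun_eq_iff iz)
  qed
  have fw: "((\<lambda>w. f (s, z, w)) has_derivative (fderiv f (s, z, w) o\<^sub>L iw)) (at w)"
    if "(s, z, w) \<in> O'" for s z w
  proof -
    have "((\<lambda>w. (s, z, w)) has_derivative (\<lambda>v. (0, 0, v))) (at w)"
      by (intro has_derivative_Pair has_derivative_const has_derivative_ident)
    from has_derivative_compose[OF this fd[OF that]] show ?thesis
      by (rule has_derivative_eq_rhs) (simp add: fun_eq_iff iw)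
  qed
  have niz: "norm iz \<le> 1" by (rule norm_blinfun_bound) (auto simp: iz norm_Pair)
  have nfw: "norm (fderiv f (s, z, w) o\<^sub>L iw) \<le> 1/2" if "s \<in> {0..1}" "z \<in> ball 0 r" "w \<in> B" for s z w
  proof (rule norm_blinfun_bound)
    fix u :: 'b
    show "norm ((fderiv f (s, z, w) o\<^sub>L iw) u) \<le> 1/2 * norm u"
      by (rule norm_deriv_le_lipschitz[OF fw B(1) that(3)]) (use that lip O'(2) in auto)
  qed auto
  \<comment> \<open>a closed ball around which all data are still defined, for uniform continuity\<close>
  define r' where "r' = (norm z0 + r) / 2"
  have r': "norm z0 < r'" "r' < r" "r' \<ge> 0" using z0 by (auto simp: r'_def intro: add_nonneg_nonneg
    order.strict_implies_order[OF le_less_trans[OF norm_ge_zero]])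
  let ?K = "cball (0::'a) r'"
  have Kr: "z \<in> ball 0 r" if "z \<in> ?K" for z using that r' by auto
  have radK: "rad s z \<in> ?K" if "s \<in> {0..1}" "z \<in> ?K" for s z by (rule rad_in_cball[OF that])
  have GB: "G z \<in> B" if "z \<in> ?K" for z using G(2) Kr[OF that] by blast
  have GcK: "continuous_on ?K G" by (rule continuous_on_subset[OF G(1)]) (use Kr in auto)
  define pt where "pt s z = (s, z, G (rad s z))" for s z
  have ptO: "pt s z \<in> O'" if "s \<in> {0..1}" "z \<in> ?K" for s z
    using O'(2) that Kr GB radK unfolding pt_def by blast
  have pt_cont: "continuous_on ({0..1} \<times> ?K) (\<lambda>x. pt (fst x) (snd x))"
    unfolding pt_def using radK by (auto intro!: continuous_intros continuous_on_compose2[OF GcK])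
  have F1pt: "continuous_on ({0..1} \<times> ?K) (\<lambda>x. fderiv f (pt (fst x) (snd x)))"
    by (rule continuous_on_compose2[OF F1c pt_cont]) (use ptO in auto)
  define \<Psi> where "\<Psi> s z U = (fderiv f (pt s z) o\<^sub>L iz) + ((fderiv f (pt s z) o\<^sub>L iw) o\<^sub>L (U o\<^sub>L radL s))"
    for s z and U :: "'a \<Rightarrow>\<^sub>L 'b"
  obtain U where U: "continuous_on ?K U"
    "\<And>z. z \<in> ?K \<Longrightarrow> U z = fderiv a z + integral {0..1} (\<lambda>s. \<Psi> s z (U (rad s z)))"
  proof (rule radial_fixpoint_exists[of r' UNIV undefined "fderiv a" \<Psi>])
    show "continuous_on ?K (fderiv a)"
      by (rule continuous_on_subset[OF Ck_on_continuous_fderiv[OF a]]) (use Kr in auto)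
    show "continuous_on ({0..1} \<times> ?K \<times> UNIV) (\<lambda>(s, z, w). \<Psi> s z w)"
    proof -
      have "continuous_on ({0..1} \<times> ?K \<times> UNIV) (\<lambda>x. fderiv f (pt (fst x) (fst (snd x))))"
        by (rule continuous_on_compose2[OF F1pt, of _ "\<lambda>x. (fst x, fst (snd x))", simplified])
          (auto intro!: continuous_intros)
      then show ?thesis unfolding \<Psi>_def split_beta by (intro continuous_intros)
    qed
    fix s :: real and z and w w' :: "'a \<Rightarrow>\<^sub>L 'b" assume s: "s \<in> {0..1}" and z: "z \<in> ?K"
    have "\<Psi> s z w - \<Psi> s z w' = (fderiv f (pt s z) o\<^sub>L iw) o\<^sub>L ((w - w') o\<^sub>L radL s)"
      by (intro blinfun_eqI) (simp add: \<Psi>_def blinfun.bilinear_simps)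
    also have "norm \<dots> \<le> norm (fderiv f (pt s z) o\<^sub>L iw) * (norm (w - w') * norm (radL s))"
      by (intro order_trans[OF norm_blinfun_compose] mult_left_mono norm_blinfun_compose) auto
    also have "\<dots> \<le> 1/2 * (norm (w - w') * 1)"
      using nfw[OF s Kr[OF z] GB[OF radK[OF s z]]] norm_radL_le[OF s]
      by (intro mult_mono) (auto simp: pt_def)
    finally show "norm (\<Psi> s z w - \<Psi> s z w') \<le> norm (w - w') / 2" by simp
  qed (use r' in auto)
  \<comment> \<open>the mean value estimates for \<open>f\<close> need a compact convex set that contains the graph\<close>
  define B' where "B' = convex hull (G ` ?K)"
  have B': "compact B'" "convex B'" "B' \<subseteq> B" "\<And>z. z \<in> ?K \<Longrightarrow> G z \<in> B'"
    unfolding B'_def using GB B(2)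
    by (auto intro!: compact_convex_hull compact_continuous_image[OF GcK] hull_minimal hull_inc simp:
      subset_hull)
  define S where "S = {0..1::real} \<times> ?K \<times> B'"
  have S: "compact S" "convex S" "S \<subseteq> O'"
    unfolding S_def using B' O'(2) Kr by (auto intro!: compact_Times convex_Times)
  have F1S: "continuous_on S (fderiv f)" using F1c S(3) continuous_on_subset by blast
  obtain C1 where C1: "C1 \<ge> 0" "\<And>p. p \<in> S \<Longrightarrow> norm (fderiv f p) \<le> C1"
    using compact_imp_bounded[OF compact_continuous_image[OF F1S S(1)]]
    unfolding bounded_pos by (metis image_eqI less_imp_le)
  have acK: "continuous_on ?K (fderiv a)"
    by (rule continuous_on_subset[OF Ck_on_continuous_fderiv[OF a]]) (use Kr in auto)
  obtain C2 where C2: "C2 \<ge> 0" "\<And>z. z \<in> ?K \<Longrightarrow> norm (fderiv a z) \<le> C2"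
    using compact_imp_bounded[OF compact_continuous_image[OF acK compact_cball]]
    unfolding bounded_pos by (metis image_eqI less_imp_le)
  have ad: "(a has_derivative fderiv a z) (at z)" if "z \<in> ?K" for z
    by (rule Ck_on_has_fderiv[OF a Kr[OF that]])
  have ptS: "pt s z \<in> S" if "s \<in> {0..1}" "z \<in> ?K" for s z
    using that radK B'(4) by (auto simp: pt_def S_def)
  have int1: "continuous_on {0..1} (\<lambda>s. f (pt s z))" if "z \<in> ?K" for z
  proof (rule continuous_on_compose2[OF Ck_on_continuous[OF f]])
    show "continuous_on {0..1} (\<lambda>s. pt s z)"
      by (rule continuous_on_compose2[OF pt_cont, of _ "\<lambda>s. (s, z)", simplified])
        (use that in \<open>auto intro!: continuous_intros\<close>)
  qed (use ptO that in auto)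
  have eqK: "G z = a z + integral {0..1} (\<lambda>s. f (pt s z))" if "z \<in> ?K" for z
    using eq[OF Kr[OF that]] by (simp add: pt_def)
  have Gdiff: "G z' - G z = (a z' - a z) + integral {0..1} (\<lambda>s. f (pt s z') - f (pt s z))"
    if "z \<in> ?K" "z' \<in> ?K" for z z'
    using int1[OF that(1)] int1[OF that(2)]
    by (simp add: eqK[OF that(1)] eqK[OF that(2)] integral_diff integrable_continuous_real)
  \<comment> \<open>The remainder of \<open>f\<close> along the graph of \<open>G\<close> is of the order of the increment of \<open>G\<close>, so a Lipschitz
     bound for \<open>G\<close> is needed before differentiability.\<close>
  define L where "L = 2 * (C1 + C2)"
  have L: "L \<ge> 0" using C1 C2 by (simp add: L_def)
  have flip: "norm (f (s, z', w') - f (s, z, w)) \<le> C1 * norm (z' - z) + norm (w' - w) / 2"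
    if "s \<in> {0..1}" "z \<in> ?K" "z' \<in> ?K" "w \<in> B'" "w' \<in> B'" for s z z' w w'
  proof -
    have "norm (f (s, z', w) - f (s, z, w)) \<le> C1 * norm (z' - z)"
    proof (rule differentiable_bound[of ?K _ "\<lambda>z. fderiv f (s, z, w) o\<^sub>L iz"])
      fix x assume x: "x \<in> ?K"
      then have xS: "(s, x, w) \<in> S" using that by (auto simp: S_def)
      show "((\<lambda>z. f (s, z, w)) has_derivative (fderiv f (s, x, w) o\<^sub>L iz)) (at x within ?K)"
        by (rule has_derivative_at_withinI[OF fz]) (use xS S in auto)
      have "norm (fderiv f (s, x, w) o\<^sub>L iz) \<le> C1 * 1"
        using C1 xS niz by (intro order_trans[OF norm_blinfun_compose] mult_mono) auto
      then show "onorm (fderiv f (s, x, w) o\<^sub>L iz) \<le> C1" by (simp add: norm_blinfun.rep_eq)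
    qed (use that in auto)
    moreover have "norm (f (s, z', w') - f (s, z', w)) \<le> norm (w' - w) / 2"
      by (rule lip) (use that Kr B' in auto)
    ultimately show ?thesis
      using norm_triangle_ineq[of "f (s, z', w') - f (s, z', w)" "f (s, z', w) - f (s, z, w)"] by simp
  qed
  have alip: "norm (a z' - a z) \<le> C2 * norm (z' - z)" if "z \<in> ?K" "z' \<in> ?K" for z z'
    by (rule differentiable_bound[of ?K _ "\<lambda>z. fderiv a z"])
      (use that ad C2 in \<open>auto intro: has_derivative_at_withinI simp: norm_blinfun.rep_eq[symmetric]\<close>)
  obtain M0 where M0: "\<And>z. z \<in> ?K \<Longrightarrow> norm (G z) \<le> M0"
    using compact_imp_bounded[OF compact_continuous_image[OF GcK compact_cball]]
    unfolding bounded_iff by blast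
  have "M0 \<ge> 0" using M0[of 0] r' norm_ge_zero order_trans by (metis centre_in_cball)
  have Glip: "norm (G (snd q) - G (fst q)) \<le> L * norm (snd q - fst q)" if "q \<in> ?K \<times> ?K" for q
  proof (rule le_by_halving[of "?K \<times> ?K" _ "2 * M0"])
    fix q assume "q \<in> ?K \<times> ?K"
    then show "norm (G (snd q) - G (fst q)) \<le> 2 * M0"
      using M0 norm_triangle_ineq4[of "G (snd q)" "G (fst q)"]
      by (smt (verit) mem_Sigma_iff prod.collapse)
    show "0 \<le> L * norm (snd q - fst q)" using L by simp
  next
    fix c q assume c: "c \<ge> 0" and q: "q \<in> ?K \<times> ?K"
      and H: "\<And>q. q \<in> ?K \<times> ?K \<Longrightarrow> norm (G (snd q) - G (fst q)) \<le> L * norm (snd q - fst q) + c"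
    obtain z z' where zz: "q = (z, z')" "z \<in> ?K" "z' \<in> ?K" using q by auto
    have "norm (integral {0..1} (\<lambda>s. f (pt s z') - f (pt s z)))
      \<le> (C1 * norm (z' - z) + (L * norm (z' - z) + c) / 2) * (1 - 0)"
    proof (rule integral_bound)
      fix s :: real assume s: "s \<in> {0..1}"
      have "norm (f (pt s z') - f (pt s z)) \<le> C1 * norm (z' - z) + norm (G (rad s z') - G (rad s z)) / 2"
        unfolding pt_def by (rule flip) (use s zz radK B' in auto)
      also have "norm (G (rad s z') - G (rad s z)) \<le> L * norm (rad s z' - rad s z) + c"
        using H[of "(rad s z, rad s z')"] radK[OF s] zz by simp
      also have "L * norm (rad s z' - rad s z) \<le> L * norm (z' - z)"
        using norm_rad_le[OF s, of "z' - z"] L by (intro mult_left_mono) (auto simp: rad_diff)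
      finally show "norm (f (pt s z') - f (pt s z)) \<le> C1 * norm (z' - z) + (L * norm (z' - z) + c) / 2"
        by simp
    qed (use int1 zz in \<open>auto intro!: continuous_intros\<close>)
    then have "norm (G z' - G z) \<le> C2 * norm (z' - z) + (C1 * norm (z' - z) + (L * norm (z' - z) + c) / 2)"
      unfolding Gdiff[OF zz(2,3)] using alip[OF zz(2,3)] by (intro order_trans[OF norm_triangle_ineq]) simp
    also have "\<dots> = L * norm (z' - z) + c / 2" by (simp add: L_def algebra_simps)
    finally show "norm (G (snd q) - G (fst q)) \<le> L * norm (snd q - fst q) + c / 2" using zz by simp
  qed (use that \<open>M0 \<ge> 0\<close> in auto)
  have \<Psi>int: "continuous_on {0..1} (\<lambda>s. \<Psi> s z (U (rad s z)))" if z: "z \<in> ?K" for z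
  proof -
    have "continuous_on {0..1} (\<lambda>s. fderiv f (pt s z))"
      by (rule continuous_on_compose2[OF F1pt, of _ "\<lambda>s. (s, z)", simplified])
        (use z in \<open>auto intro!: continuous_intros\<close>)
    then show ?thesis
      unfolding \<Psi>_def using radK z
      by (intro continuous_intros) (auto intro!: continuous_intros continuous_on_compose2[OF U(1)])
  qed
  have \<Psi>app: "\<Psi> s z W v = fderiv f (pt s z) (0, v, W (rad s v))" for s z W v
    by (simp add: \<Psi>_def iz iw blinfun.add_left blinfun_apply_blinfun_compose radL_apply
      blinfun.add_right[symmetric])
  have Uapp: "U z v = fderiv a z v + integral {0..1} (\<lambda>s. fderiv f (pt s z) (0, v, U (rad s z) (rad s v)))"
    if z: "z \<in> ?K" for z v
  proof -
    show ?thesis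
      unfolding U(2)[OF z] using blinfun_apply_integral[OF integrable_continuous_real[OF \<Psi>int[OF z]]]
      by (simp add: blinfun.add_left \<Psi>app)
  qed
  obtain M1 where M1: "\<And>z. z \<in> ?K \<Longrightarrow> norm (U z) \<le> M1"
    using compact_imp_bounded[OF compact_continuous_image[OF U(1) compact_cball]]
    unfolding bounded_iff by blast
  have "M1 \<ge> 0" using M1[of 0] r' norm_ge_zero order_trans by (metis centre_in_cball)
  \<comment> \<open>The estimate is uniform in the base point because halving compares the remainder at a pair of
     points with the remainders at their radial images.\<close>
  have rem: "\<exists>d>0. \<forall>z\<in>?K. \<forall>z'\<in>?K. norm (z' - z) < d \<longrightarrow> norm (G z' - G z - U z (z' - z)) \<le> e * norm (z' - z)"
    if "e > 0" for e
  proof -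
    define e1 where "e1 = e / 2 / (2 + L)"
    have e1: "e1 > 0" using that L by (simp add: e1_def)
    have "uniformly_continuous_on S (fderiv f)" "uniformly_continuous_on ?K (fderiv a)"
      using compact_uniformly_continuous F1S S(1) acK compact_cball by blast+
    then obtain d1 d2 where d: "d1 > 0" "d2 > 0"
      "\<And>p p'. \<lbrakk>p \<in> S; p' \<in> S; dist p' p < d1\<rbrakk> \<Longrightarrow> dist (fderiv f p') (fderiv f p) < e1"
      "\<And>p p'. \<lbrakk>p \<in> ?K; p' \<in> ?K; dist p' p < d2\<rbrakk> \<Longrightarrow> dist (fderiv a p') (fderiv a p) < e1"
      unfolding uniformly_continuous_on_def using e1 by metis
    define d' where "d' = min d2 (d1 / (1 + L))"
    have d': "d' > 0" "d' \<le> d2" using d(1,2) L by (auto simp: d'_def)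
    have "d' * (1 + L) \<le> d1 / (1 + L) * (1 + L)"
      by (rule mult_right_mono) (use L in \<open>auto simp: d'_def\<close>)
    then have d'3: "d' * (1 + L) \<le> d1" using L by simp
    define T where "T = {q \<in> ?K \<times> ?K. norm (snd q - fst q) < d'}"
    have "norm (G (snd q) - G (fst q) - U (fst q) (snd q - fst q)) \<le> e * norm (snd q - fst q)" if "q \<in> T" for q
    proof (rule le_by_halving[of T _ "2 * M0 + M1 * d'"])
      fix q assume q: "q \<in> T"
      then obtain z z' where zz: "q = (z, z')" "z \<in> ?K" "z' \<in> ?K" "norm (z' - z) < d'" by (auto simp: T_def)
      have "norm (U z (z' - z)) \<le> M1 * d'"
        using M1 zz \<open>M1 \<ge> 0\<close> by (intro order_trans[OF norm_blinfun] mult_mono) auto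
      then have "norm (G z' - G z - U z (z' - z)) \<le> 2 * M0 + M1 * d'"
        using norm_triangle_ineq4[of "G z' - G z" "U z (z' - z)"] norm_triangle_ineq4[of "G z'"
          "G z"] M0[OF zz(2)] M0[OF zz(3)]
        by linarith
      then show "norm (G (snd q) - G (fst q) - U (fst q) (snd q - fst q)) \<le> 2 * M0 + M1 * d'" using zz by simp
      show "0 \<le> e * norm (snd q - fst q)" using \<open>e > 0\<close> by simp
    next
      fix c q assume c: "c \<ge> 0" and q: "q \<in> T"
        and H: "\<And>q. q \<in> T \<Longrightarrow> norm (G (snd q) - G (fst q) - U (fst q) (snd q - fst q))
          \<le> e * norm (snd q - fst q) + c"
      obtain z z' where zz: "q = (z, z')" "z \<in> ?K" "z' \<in> ?K" "norm (z' - z) < d'" using q by (auto simp: T_def)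
      have seg: "z + t *\<^sub>R (z' - z) \<in> ?K" "norm (t *\<^sub>R (z' - z)) < d'" if "t \<in> {0..1}" for t
      proof -
        show "z + t *\<^sub>R (z' - z) \<in> ?K"
          using convexD_alt[OF convex_cball zz(2,3), of t] that by (simp add: algebra_simps)
        have "norm (t *\<^sub>R (z' - z)) \<le> 1 * norm (z' - z)"
          unfolding norm_scaleR using that by (intro mult_right_mono) auto
        then show "norm (t *\<^sub>R (z' - z)) < d'" using zz(4) by simp
      qed
      have A: "norm (a z' - a z - fderiv a z (z' - z)) \<le> norm (z' - z) * e1"
      proof (rule differentiable_bound_linearization[where S="{x \<in> ?K. norm (x - z) < d'}"
        and f'="\<lambda>x. fderiv a x"])
        fix x assume x: "x \<in> {x \<in> ?K. norm (x - z) < d'}"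
        show "(a has_derivative fderiv a x) (at x within {x \<in> ?K. norm (x - z) < d'})"
          using ad x has_derivative_at_withinI by blast
        have "dist (fderiv a x) (fderiv a z) < e1"
          by (rule d(4)) (use x zz d' in \<open>auto simp: dist_norm\<close>)
        then show "onorm (blinfun_apply (fderiv a x) - blinfun_apply (fderiv a z)) \<le> e1"
          by (simp add: dist_norm norm_blinfun.rep_eq fun_diff_def minus_blinfun.rep_eq)
      qed (use seg zz d' in auto)
      have I: "norm (f (pt s z') - f (pt s z) - fderiv f (pt s z) (0, z' - z, U (rad s z) (rad s (z' - z))))
          \<le> (1 + L) * norm (z' - z) * e1 + (e * norm (z' - z) + c) / 2" if s: "s \<in> {0..1}" for s
      proof -
        let ?w = "G (rad s z)" and ?w' = "G (rad s z')"
        have nrad: "norm (rad s z' - rad s z) \<le> norm (z' - z)"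
          using norm_rad_le[OF s, of "z' - z"] by (simp add: rad_diff)
        have w: "norm (?w' - ?w) \<le> L * norm (z' - z)"
          using Glip[of "(rad s z, rad s z')"] radK[OF s] zz mult_left_mono[OF nrad L] by auto
        have npd: "norm (pt s z' - pt s z) \<le> (1 + L) * norm (z' - z)"
        proof -
          have "norm (pt s z' - pt s z) \<le> norm (z' - z) + norm (?w' - ?w)"
            using norm_Pair_le[of "z' - z" "?w' - ?w"] by (simp add: pt_def norm_Pair)
          then show ?thesis using w by (simp add: algebra_simps)
        qed
        let ?S = "{p \<in> S. norm (p - pt s z) < d1}"
        have np1: "norm (pt s z' - pt s z) < d1"
        proof -
          have "(1 + L) * norm (z' - z) < (1 + L) * d'" using zz(4) L by (intro mult_strict_left_mono) auto
          then show ?thesis using npd d'3 by (simp add: algebra_simps)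
        qed
        have "norm (f (pt s z') - f (pt s z) - fderiv f (pt s z) (pt s z' - pt s z))
          \<le> norm (pt s z' - pt s z) * e1"
        proof (rule differentiable_bound_linearization[where S="?S" and f'="\<lambda>x. fderiv f x"])
          fix t :: real assume t: "t \<in> {0..1}"
          have "pt s z + t *\<^sub>R (pt s z' - pt s z) \<in> S"
            using convexD_alt[OF S(2) ptS[OF s zz(2)] ptS[OF s zz(3)], of t] t by (simp add: algebra_simps)
          moreover have "norm (t *\<^sub>R (pt s z' - pt s z)) \<le> 1 * norm (pt s z' - pt s z)"
            unfolding norm_scaleR using t by (intro mult_right_mono) auto
          ultimately show "pt s z + t *\<^sub>R (pt s z' - pt s z) \<in> ?S" using np1 by simp
        next
          fix x assume x: "x \<in> ?S"
          then show "(f has_derivative fderiv f x) (at x within ?S)"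
            using fd S(3) has_derivative_at_withinI by blast
          have "dist (fderiv f x) (fderiv f (pt s z)) < e1"
            by (rule d(3)) (use x ptS[OF s zz(2)] in \<open>auto simp: dist_norm\<close>)
          then show "onorm (blinfun_apply (fderiv f x) - blinfun_apply (fderiv f (pt s z))) \<le> e1"
            by (simp add: dist_norm norm_blinfun.rep_eq fun_diff_def minus_blinfun.rep_eq)
        qed (use ptS[OF s zz(2)] d(1) in auto)
        also have "norm (pt s z' - pt s z) * e1 \<le> (1 + L) * norm (z' - z) * e1"
          using npd e1 by simp
        finally have 1: "norm (f (pt s z') - f (pt s z) - fderiv f (pt s z) (pt s z' - pt s z))
          \<le> (1 + L) * norm (z' - z) * e1" .
        let ?R = "?w' - ?w - U (rad s z) (rad s (z' - z))"
        have "norm ((fderiv f (pt s z) o\<^sub>L iw) ?R) \<le> 1/2 * norm ?R"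
          using nfw[OF s Kr[OF zz(2)] GB[OF radK[OF s zz(2)]]]
          by (intro order_trans[OF norm_blinfun] mult_right_mono) (auto simp: pt_def)
        moreover have "norm ?R \<le> e * norm (z' - z) + c"
        proof -
          have "norm ?R \<le> e * norm (rad s z' - rad s z) + c"
            using H[of "(rad s z, rad s z')"] radK[OF s] zz nrad by (simp add: T_def rad_diff)
          then show ?thesis using nrad \<open>e > 0\<close> by (smt (verit) mult_left_mono)
        qed
        ultimately have 2: "norm ((fderiv f (pt s z) o\<^sub>L iw) ?R) \<le> (e * norm (z' - z) + c) / 2" by simp
        have "pt s z' - pt s z = (0, z' - z, U (rad s z) (rad s (z' - z))) + (0, 0, ?R)"
          by (simp add: pt_def)
        then have "fderiv f (pt s z) (pt s z' - pt s z)
          = fderiv f (pt s z) (0, z' - z, U (rad s z) (rad s (z' - z))) + (fderiv f (pt s z) o\<^sub>L iw) ?R"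
          by (simp add: blinfun.add_right[symmetric] iw)
        then have "f (pt s z') - f (pt s z) - fderiv f (pt s z) (0, z' - z, U (rad s z) (rad s (z' - z)))
          = (f (pt s z') - f (pt s z) - fderiv f (pt s z) (pt s z' - pt s z)) + (fderiv f (pt s z) o\<^sub>L iw)
            ?R" by simp
        then show ?thesis using norm_triangle_mono[OF 1 2] by (simp only:)
      qed
      have cI: "continuous_on {0..1} (\<lambda>s. fderiv f (pt s z) (0, z' - z, U (rad s z) (rad s (z' - z))))"
      proof -
        have "continuous_on {0..1} (\<lambda>s. \<Psi> s z (U (rad s z)) (z' - z))"
          using \<Psi>int[OF zz(2)] by (intro continuous_intros)
        then show ?thesis by (simp only: \<Psi>app)
      qed
      have "G z' - G z - U z (z' - z) = (a z' - a z - fderiv a z (z' - z)) +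
         integral {0..1} (\<lambda>s. f (pt s z') - f (pt s z) - fderiv f (pt s z) (0, z' - z, U (rad s z) (rad s
           (z' - z))))"
        unfolding Gdiff[OF zz(2,3)] Uapp[OF zz(2)] using int1[OF zz(2)] int1[OF zz(3)] cI
        by (subst integral_diff) (auto intro!: integrable_continuous_real continuous_intros)
      also have "norm \<dots> \<le> norm (z' - z) * e1 + ((1 + L) * norm (z' - z) * e1 + (e * norm (z' - z) + c) / 2)
        * (1 - 0)"
        by (intro norm_triangle_mono A integral_bound)
          (use I int1[OF zz(2)] int1[OF zz(3)] cI in \<open>auto intro!: continuous_intros\<close>)
      also have "\<dots> = norm (z' - z) * (e1 * (2 + L)) + (e * norm (z' - z) + c) / 2"
        by (simp add: algebra_simps)
      also have "e1 * (2 + L) = e / 2" using L unfolding e1_def by (subst nonzero_eq_divide_eq[symmetric]) auto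
      also have "norm (z' - z) * (e / 2) + (e * norm (z' - z) + c) / 2 = e * norm (z' - z) + c / 2"
        by (simp add: field_simps)
      finally show "norm (G (snd q) - G (fst q) - U (fst q) (snd q - fst q)) \<le> e * norm (snd q - fst q) + c / 2"
        using zz by simp
    qed (use that \<open>M0 \<ge> 0\<close> \<open>M1 \<ge> 0\<close> d' in auto)
    then show ?thesis using d'(1) by (intro exI[of _ d']) (auto simp: T_def)
  qed
  have GU: "(G has_derivative U z) (at z)" if z: "norm z < r'" for z
    unfolding has_derivative_at_alt
  proof (intro conjI allI impI)
    fix e :: real assume "e > 0"
    then obtain d where d: "d > 0" "\<forall>z\<in>?K. \<forall>z'\<in>?K. norm (z' - z) < d \<longrightarrow> norm (G z' - G z - U z (z' - z))
      \<le> e * norm (z' - z)"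
      using rem by blast
    have "norm (G y - G z - U z (y - z)) \<le> e * norm (y - z)" if y: "norm (y - z) < min d (r' - norm z)" for y
    proof -
      have "norm y \<le> norm z + norm (y - z)" by (metis add.commute diff_add_cancel norm_triangle_ineq)
      then have "y \<in> ?K" "z \<in> ?K" using z y by auto
      then show ?thesis using d(2) y by simp
    qed
    then show "\<exists>d>0. \<forall>y. norm (y - z) < d \<longrightarrow> norm (G y - G z - U z (y - z)) \<le> e * norm (y - z)"
      using d(1) z by (intro exI[of _ "min d (r' - norm z)"]) auto
  qed (rule blinfun.bounded_linear_right)
  show "G differentiable (at z0)" using GU r'(1) differentiable_def by blast
  have "continuous_on (ball 0 r') (\<lambda>z. deriv_along G z v)"
  proof (rule continuous_on_eq)
    show "continuous_on (ball 0 r') (\<lambda>z. U z v)"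
      by (intro continuous_intros continuous_on_subset[OF U(1)]) auto
  qed (auto simp: deriv_along_eq[OF GU])
  then show "isCont (\<lambda>z. deriv_along G z v) z0"
    using r'(1) by (simp add: continuous_on_eq_continuous_at)
  have rs: "norm (rad s z0) < r'" if "s \<in> {0..1}" for s using norm_rad_le[OF that, of z0] r' by linarith
  have "z0 \<in> ?K" using r' by auto
  have "deriv_along G z0 v = U z0 v" by (rule deriv_along_eq[OF GU[OF r'(1)]])
  also have "\<dots> = deriv_along a z0 v + integral {0..1} (\<lambda>s. fderiv f (pt s z0) (0, v, U (rad s z0) (rad s v)))"
    unfolding Uapp[OF \<open>z0 \<in> ?K\<close>] by (simp add: deriv_along_eq[OF ad[OF \<open>z0 \<in> ?K\<close>]])
  also have "integral {0..1} (\<lambda>s. fderiv f (pt s z0) (0, v, U (rad s z0) (rad s v)))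
    = integral {0..1} (\<lambda>s. deriv_along f (s, z0, G (rad s z0)) (0, v, deriv_along G (rad s z0) (rad s v)))"
    by (rule integral_cong)
      (simp add: deriv_along_eq[OF fd[OF ptO[OF _ \<open>z0 \<in> ?K\<close>]], symmetric, unfolded pt_def]
        deriv_along_eq[OF GU[OF rs]] pt_def)
  finally show "deriv_along G z0 v = deriv_along a z0 v + integral {0..1} (\<lambda>s.
      deriv_along f (s, z0, G (rad s z0)) (0, v, deriv_along G (rad s z0) (rad s v)))" .
qed

text \<open>Along a direction \<open>v\<close> on which every \<open>rad s\<close> acts as a scalar, the derivative of a solution solves an
  equation of the same shape and with values in the same space, whose data are only once less
  differentiable. Hence one induction suffices.\<close>

theorem radial_fixpoint_Ck:
  fixes a G :: "'a \<Rightarrow> 'b::euclidean_space" and f :: "real \<times> 'a \<times> 'b \<Rightarrow> 'b"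
  assumes "open O'" "{0..1} \<times> ball 0 r \<times> B \<subseteq> O'" "open B" "convex B"
    and "Ck_on k O' f" "Ck_on k (ball 0 r) a"
    and "continuous_on (ball 0 r) G" "G ` ball 0 r \<subseteq> B"
    and "\<And>z. z \<in> ball 0 r \<Longrightarrow> G z = a z + integral {0..1} (\<lambda>s. f (s, z, G (rad s z)))"
    and "\<And>s z w w'. \<lbrakk>s \<in> {0..1}; z \<in> ball 0 r; w \<in> B; w' \<in> B\<rbrakk> \<Longrightarrow>
      norm (f (s, z, w) - f (s, z, w')) \<le> norm (w - w') / 2"
  shows "Ck_on k (ball 0 r) G"
  using assms
proof (induction k arbitrary: O' B f a G)
  case 0
  then show ?case by simp
next
  case (Suc k O' B f a G)
  note O' = Suc.prems(1,2) and B = Suc.prems(3,4) and f = Suc.prems(5) and a = Suc.prems(6)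
    and G = Suc.prems(7,8) and eq = Suc.prems(9) and lip = Suc.prems(10)
  let ?Z = "ball (0::'a) r"
  have Gk: "Ck_on k ?Z G"
    by (rule Suc.IH[OF O' B Ck_on_SucD[OF f] Ck_on_SucD[OF a] G eq lip])
  have f1: "Ck_on (Suc 0) O' f" and a1: "Ck_on (Suc 0) ?Z a"
    by (rule Ck_on_le[OF f] Ck_on_le[OF a], simp)+
  have D1: "G differentiable (at z)" if "z \<in> ?Z" for z
    by (rule radial_fixpoint_differentiable(1)[OF O' B f1 a1 G eq lip that])
  have D2: "deriv_along G z v = deriv_along a z v + integral {0..1} (\<lambda>s.
      deriv_along f (s, z, G (rad s z)) (0, v, deriv_along G (rad s z) (rad s v)))" if "z \<in> ?Z" for z v
    by (rule radial_fixpoint_differentiable(2)[OF O' B f1 a1 G eq lip that])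
  have D3: "isCont (\<lambda>z. deriv_along G z v) z" if "z \<in> ?Z" for z v
    by (rule radial_fixpoint_differentiable(3)[OF O' B f1 a1 G eq lip that])
  have GB: "G z \<in> B" if "z \<in> ?Z" for z using G(2) that by blast
  have Glin: "linear (deriv_along G z)" if "z \<in> ?Z" for z
    using has_derivative_deriv_along[OF D1[OF that]] has_derivative_linear by blast
  have flin: "linear (deriv_along f p)" if "p \<in> O'" for p
    using Ck_on_has_derivative[OF f that] has_derivative_linear by blast
  define O1 where "O1 = (\<lambda>q :: real \<times> 'a \<times> 'b. rad (fst q) (fst (snd q))) -` ?Z"
  have "open O1" unfolding O1_def
    by (rule open_vimage) (auto intro!: continuous_intros)
  define g where "g q = (fst q, fst (snd q), G (rad (fst q) (fst (snd q))))" for q :: "real \<times> 'a \<times> 'b"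
  have O1: "rad (fst q) (fst (snd q)) \<in> ?Z" if "q \<in> O1" for q using that by (simp add: O1_def)
  have fst_lin: "bounded_linear (fst :: real \<times> 'a \<times> 'b \<Rightarrow> real)"
    "bounded_linear (\<lambda>q :: real \<times> 'a \<times> 'b. fst (snd q))"
    "bounded_linear (\<lambda>q :: real \<times> 'a \<times> 'b. snd (snd q))"
    by (auto intro!: bounded_linear_intros)
  have gk: "Ck_on k O1 g"
    unfolding g_def
    by (intro Ck_on_Pair Ck_on_bounded_linear fst_lin \<open>open O1\<close>
        Ck_on_compose[OF _ open_ball _ Gk, where f="\<lambda>q. rad (fst q) (fst (snd q))"] Ck_on_rad)
      (use O1 in auto)
  define O2 where "O2 = O1 \<inter> g -` O'"
  have "open O2" unfolding O2_def
    using continuous_open_preimage[OF Ck_on_continuous[OF gk] \<open>open O1\<close> O'(1)] .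
  have O2: "{0..1} \<times> ?Z \<times> UNIV \<subseteq> O2"
  proof clarify
    fix s :: real and z and w :: 'b assume *: "s \<in> {0..1}" "z \<in> ?Z"
    then have "rad s z \<in> ?Z" "(s, z, G (rad s z)) \<in> O'" using O'(2) GB rad_in_ball by blast+
    then show "(s, z, w) \<in> O2" by (simp add: O2_def O1_def g_def)
  qed
  have gk2: "Ck_on k O2 g" by (rule Ck_on_subset[OF gk]) (auto simp: O2_def)
  have eigen: "Ck_on k ?Z (\<lambda>z. deriv_along G z v)"
    if \<sigma>: "\<And>s. rad s v = \<sigma> s *\<^sub>R v" "\<And>m S. Ck_on m S \<sigma>" "\<And>s. s \<in> {0..1} \<Longrightarrow> \<bar>\<sigma> s\<bar> \<le> 1" for v and \<sigma> ::
      "real \<Rightarrow> real"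
  proof (rule Suc.IH[OF \<open>open O2\<close> O2 open_UNIV convex_UNIV])
    let ?f = "\<lambda>q. deriv_along f (g q) (0, v, \<sigma> (fst q) *\<^sub>R snd (snd q))"
    show "Ck_on k O2 ?f"
    proof (rule Ck_on_linear_apply[where A="\<lambda>q. deriv_along f (g q)", OF \<open>open O2\<close>])
      show "linear (deriv_along f (g q))" if "q \<in> O2" for q by (rule flin) (use that in \<open>auto simp: O2_def\<close>)
      show "Ck_on k O2 (\<lambda>q. deriv_along f (g q) w)" for w
      proof (rule Ck_on_compose[OF \<open>open O2\<close> O'(1) gk2, where g="\<lambda>p. deriv_along f p w"])
        show "Ck_on k O' (\<lambda>p. deriv_along f p w)" using f unfolding Ck_on.simps by blast
      qed (auto simp: O2_def)
      show "Ck_on k O2 (\<lambda>q. (0, v, \<sigma> (fst q) *\<^sub>R snd (snd q)))"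
        by (intro Ck_on_Pair Ck_on_const Ck_on_scaleR \<open>open O2\<close> Ck_on_bounded_linear[OF fst_lin(3)]
            Ck_on_compose[OF _ open_UNIV Ck_on_bounded_linear[OF fst_lin(1)] \<sigma>(2)]) auto
    qed
    show "Ck_on k ?Z (\<lambda>z. deriv_along a z v)" using a by simp
    show "deriv_along G z v = deriv_along a z v + integral {0..1} (\<lambda>s. ?f (s, z, deriv_along G (rad s z) v))"
      if z: "z \<in> ?Z" for z
    proof -
      have "deriv_along G (rad s z) (rad s v) = \<sigma> s *\<^sub>R deriv_along G (rad s z) v" if "s \<in> {0..1}" for s
        using linear_scale[OF Glin[OF rad_in_ball[OF that z]]] by (simp add: \<sigma>(1))
      then show ?thesis
        unfolding D2[OF z, of v] by (auto simp: g_def intro!: integral_cong)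
    qed
    show "norm (?f (s, z, w) - ?f (s, z, w')) \<le> norm (w - w') / 2"
      if s: "s \<in> {0..1}" and z: "z \<in> ?Z" for s z w w'
    proof -
      let ?p = "(s, z, G (rad s z))"
      have p: "?p \<in> O'" "G (rad s z) \<in> B" using O'(2) s z GB[OF rad_in_ball[OF s z]] by auto
      have "((\<lambda>w. f (s, z, w)) has_derivative (\<lambda>u. deriv_along f ?p (0, 0, u))) (at (G (rad s z)))"
      proof -
        have "((\<lambda>w. (s, z, w)) has_derivative (\<lambda>u. (0, 0, u))) (at (G (rad s z)))"
          by (intro has_derivative_Pair has_derivative_const has_derivative_ident)
        from has_derivative_compose[OF this Ck_on_has_derivative[OF f p(1)]] show ?thesis .
      qed
      then have "norm (deriv_along f ?p (0, 0, \<sigma> s *\<^sub>R (w - w'))) \<le> 1/2 * norm (\<sigma> s *\<^sub>R (w - w'))"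
        by (rule norm_deriv_le_lipschitz[OF _ B(1) p(2)]) (use lip s z p in auto)
      also have "\<dots> \<le> norm (w - w') / 2"
        using mult_right_mono[OF \<sigma>(3)[OF s] norm_ge_zero[of "w - w'"]] by simp
      also have "deriv_along f ?p (0, 0, \<sigma> s *\<^sub>R (w - w')) = ?f (s, z, w) - ?f (s, z, w')"
        by (simp add: g_def linear_diff[OF flin[OF p(1)], symmetric] scaleR_diff_right)
      finally show ?thesis .
    qed
    show "continuous_on ?Z (\<lambda>z. deriv_along G z v)"
      by (rule continuous_at_imp_continuous_on) (use D3 in blast)
  qed auto
  have "Ck_on k ?Z (\<lambda>z. deriv_along G z v)" for v
  proof -
    have "Ck_on k ?Z (\<lambda>z. deriv_along G z (v - P v) + deriv_along G z (P v))"
    proof (rule Ck_on_add[OF open_ball])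
      show "Ck_on k ?Z (\<lambda>z. deriv_along G z (v - P v))"
        by (rule eigen[where \<sigma>="\<lambda>_. 1"]) (auto simp: rad_def linear_diff[OF linear] Ck_on_const)
      show "Ck_on k ?Z (\<lambda>z. deriv_along G z (P v))"
        by (rule eigen[where \<sigma>="\<lambda>s. s"])
          (auto simp: rad_def bounded_linear_ident intro: Ck_on_bounded_linear)
    qed
    then show ?thesis
      by (rule Ck_on_cong[OF open_ball, rotated]) (simp add: linear_add[OF Glin, symmetric])
  qed
  then show ?case using D1 by simp
qed

end

section \<open>The smooth inverse function theorem\<close>

lemma smooth_on_Ck: "smooth_on S f \<Longrightarrow> Ck_on m S f"
  by (simp add: smooth_on_def)

lemma smooth_onI: "(\<And>m. Ck_on m S f) \<Longrightarrow> smooth_on S f"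
  by (simp add: smooth_on_def)

lemma smooth_on_has_derivative:
  "smooth_on S f \<Longrightarrow> x \<in> S \<Longrightarrow> (f has_derivative deriv_along f x) (at x)"
  using Ck_on_has_derivative smooth_on_Ck by blast

lemma smooth_on_linear_deriv: "smooth_on S f \<Longrightarrow> x \<in> S \<Longrightarrow> linear (deriv_along f x)"
  using smooth_on_has_derivative has_derivative_linear by blast

lemma smooth_on_deriv_along: "smooth_on S f \<Longrightarrow> smooth_on S (\<lambda>x. deriv_along f x v)"
  using smooth_on_def Ck_on.simps(2) by blast

lemma smooth_on_subset: "smooth_on S f \<Longrightarrow> T \<subseteq> S \<Longrightarrow> smooth_on T f"
  by (auto simp: smooth_on_def intro: Ck_on_subset)

lemma smooth_on_compose:
  "open S \<Longrightarrow> open T \<Longrightarrow> smooth_on S f \<Longrightarrow> smooth_on T g \<Longrightarrow> f ` S \<subseteq> T \<Longrightarrow> smooth_on S (\<lambda>x. g (f x))"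
  unfolding smooth_on_def using Ck_on_compose by blast

lemma lipschitz_near:
  fixes f :: "'a::euclidean_space \<Rightarrow> 'b::euclidean_space"
  assumes f: "smooth_on S f" and "open S" "z0 \<in> S" and e: "onorm (deriv_along f z0) < e"
  obtains r where "r > 0" "ball z0 r \<subseteq> S"
    "\<And>x y. \<lbrakk>x \<in> ball z0 r; y \<in> ball z0 r\<rbrakk> \<Longrightarrow> norm (f x - f y) \<le> e * norm (x - y)"
proof -
  have f1: "Ck_on (Suc 0) S f" using f smooth_on_Ck by blast
  have "isCont (\<lambda>x. norm (fderiv f x)) z0"
    using Ck_on_continuous_fderiv[OF f1] assms(2,3) by (intro continuous_intros) (simp add:
      continuous_on_eq_continuous_at)
  moreover have "norm (fderiv f z0) < e"
    using e fderiv_apply[OF Ck_on_differentiable[OF f1 assms(3)]] by (simp add: norm_blinfun.rep_eq)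
  ultimately have "\<forall>\<^sub>F x in at z0. norm (fderiv f x) < e"
    unfolding isCont_def by (rule order_tendstoD(2))
  then obtain d where d: "d > 0" "\<And>x. x \<noteq> z0 \<Longrightarrow> dist x z0 < d \<Longrightarrow> norm (fderiv f x) < e"
    unfolding eventually_at by auto
  obtain d' where d': "d' > 0" "ball z0 d' \<subseteq> S" using assms(2,3) openE by blast
  define r where "r = min d d'"
  have r: "r > 0" "ball z0 r \<subseteq> S" using d(1) d' by (auto simp: r_def)
  have n: "norm (fderiv f x) \<le> e" if "x \<in> ball z0 r" for x
    using d(2)[of x] that \<open>norm (fderiv f z0) < e\<close> by (cases "x = z0") (auto simp: r_def dist_commute)
  have "norm (f x - f y) \<le> e * norm (x - y)" if "x \<in> ball z0 r" "y \<in> ball z0 r" for x y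
  proof (rule differentiable_bound[where S="ball z0 r" and f'="\<lambda>x. fderiv f x"])
    fix x assume x: "x \<in> ball z0 r"
    show "(f has_derivative fderiv f x) (at x within ball z0 r)"
      using Ck_on_has_fderiv[OF f1] x r(2) has_derivative_at_withinI by blast
    show "onorm (fderiv f x) \<le> e" using n[OF x] by (simp add: norm_blinfun.rep_eq)
  qed (use that in auto)
  then show thesis using r that by blast
qed

lemma orth_projection_0: "orth_projection (\<lambda>_. 0)"
  by unfold_locales (auto intro: linear_zero)

lemma rad_0 [simp]: "orth_projection.rad (\<lambda>_. 0) s z = z"
  by (simp add: orth_projection.rad_def[OF orth_projection_0])

text \<open>With the projection \<open>0\<close> the radial integral equation loses its integral and reads
  \<open>G z = z - R (G z)\<close>, which says that \<open>G\<close> inverts \<open>w \<mapsto> w + R w\<close>.\<close>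

lemma smooth_inverse_near_identity:
  fixes h :: "'a::euclidean_space \<Rightarrow> 'a"
  assumes h: "smooth_on S h" and "open S" "0 \<in> S" "h 0 = 0" and D: "\<And>v. deriv_along h 0 v = v"
  obtains r d g where "r > 0" "d > 0" "ball 0 r \<subseteq> S" "smooth_on (ball 0 d) g"
    "\<And>y. y \<in> ball 0 d \<Longrightarrow> g y \<in> ball 0 r \<and> h (g y) = y"
    "\<And>x. x \<in> ball 0 r \<Longrightarrow> h x \<in> ball 0 d \<Longrightarrow> g (h x) = x"
proof -
  define R where "R w = h w - w" for w
  have idl: "Ck_on m T (\<lambda>w::'a. w)" for m T by (rule Ck_on_bounded_linear) (rule bounded_linear_ident)
  have R: "smooth_on S R"
    unfolding R_def by (intro smooth_onI Ck_on_diff assms(2) smooth_on_Ck[OF h] idl)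
  have "(R has_derivative (\<lambda>v. 0)) (at 0)"
    unfolding R_def using has_derivative_diff[OF smooth_on_has_derivative[OF h assms(3)] has_derivative_ident]
    by (simp add: D)
  then have R0: "deriv_along R 0 = (\<lambda>v. 0)" by (rule frechet_derivative_at[symmetric])
  have "onorm (deriv_along R 0) < 1/2" unfolding R0 by (simp add: onorm_zero)
  then obtain r where r: "r > 0" "ball 0 r \<subseteq> S"
    "\<And>x y. \<lbrakk>x \<in> ball 0 r; y \<in> ball 0 r\<rbrakk> \<Longrightarrow> norm (R x - R y) \<le> 1/2 * norm (x - y)"
    using lipschitz_near[OF R assms(2,3)] by metis
  have Rn: "norm (R w) \<le> 1/2 * norm w" if "w \<in> ball 0 r" for w
    using r(3)[OF that, of 0] r(1) by (simp add: R_def assms(4))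
  have Rc: "continuous_on (ball 0 r) R"
    using Ck_on_continuous[OF smooth_on_Ck[OF R]] r(2) continuous_on_subset by blast
  obtain g where g: "continuous_on (cball 0 (r/4)) g" "g ` cball 0 (r/4) \<subseteq> cball 0 (r/2)"
    "\<And>z. z \<in> cball 0 (r/4) \<Longrightarrow> g z = z + integral {0..1::real} (\<lambda>s. - R (g (orth_projection.rad (\<lambda>_. 0) s z)))"
  proof (rule orth_projection.radial_fixpoint_exists[OF orth_projection_0, of "r/4" "cball 0 (r/2)" 0
    "\<lambda>z. z" "\<lambda>s z w. - R w"])
    show "continuous_on ({0..1} \<times> cball 0 (r/4) \<times> cball 0 (r/2)) (\<lambda>(s::real, z::'a, w). - R w)"
      unfolding split_beta using r(1)
      by (intro continuous_intros continuous_on_compose2[OF Rc]) auto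
    fix k :: "'a \<Rightarrow> 'a" and z :: 'a assume k: "k ` cball 0 (r/4) \<subseteq> cball 0 (r/2)" and z: "z \<in> cball 0 (r/4)"
    have kz: "k z \<in> cball 0 (r/2)" using k z by blast
    then have "norm (R (k z)) \<le> r/4" using Rn[of "k z"] r(1) by auto
    then have "norm (z - R (k z)) \<le> r/2" using z norm_triangle_ineq4[of z "R (k z)"] by auto
    then show "z + integral {0..1::real} (\<lambda>s. - R (k (orth_projection.rad (\<lambda>_. 0) s z))) \<in> cball 0 (r/2)" by
      simp
  next
    fix w w' :: 'a assume "w \<in> cball 0 (r/2)" "w' \<in> cball 0 (r/2)"
    then have "w \<in> ball 0 r" "w' \<in> ball 0 r" using r(1) by auto
    from r(3)[OF this] show "norm (- R w - - R w') \<le> norm (w - w') / 2"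
      by (simp add: norm_minus_commute)
  next
    fix G assume "continuous_on (cball 0 (r/4)) G" "G ` cball 0 (r/4) \<subseteq> cball 0 (r/2)"
      "\<And>z. z \<in> cball 0 (r/4) \<Longrightarrow> G z = z + integral {0..1::real} (\<lambda>s. - R (G (orth_projection.rad (\<lambda>_. 0) s z)))"
    then show thesis by (rule that)
  next
    show "0 \<le> r/4" "0 \<in> cball (0::'a) (r/2)" using r(1) by auto
  qed (rule closed_cball continuous_on_id)+
  have gS: "smooth_on (ball 0 (r/4)) g"
  proof (rule smooth_onI)
    fix m
    show "Ck_on m (ball 0 (r/4)) g"
    proof (rule orth_projection.radial_fixpoint_Ck[OF orth_projection_0, of "UNIV \<times> UNIV \<times> ball 0 r" "r/4"
      "ball 0 r" m "\<lambda>q. - R (snd (snd q))"])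
      show "Ck_on m (UNIV \<times> UNIV \<times> ball 0 r) (\<lambda>q :: real \<times> 'a \<times> 'a. - R (snd (snd q)))"
        using r(2) by (intro Ck_on_uminus Ck_on_compose[OF _ assms(2) _ smooth_on_Ck[OF R]] open_Times)
          (auto intro!: Ck_on_bounded_linear bounded_linear_intros)
      show "continuous_on (ball 0 (r/4)) g" using g(1) continuous_on_subset ball_subset_cball by blast
      show "g ` ball 0 (r/4) \<subseteq> ball 0 r"
      proof -
        have "g ` ball 0 (r/4) \<subseteq> cball 0 (r/2)" using g(2) ball_subset_cball by blast
        also have "\<dots> \<subseteq> ball 0 r" using r(1) by auto
        finally show ?thesis .
      qed
      fix s :: real and z w w' :: 'a assume "w \<in> ball 0 r" "w' \<in> ball 0 r"
      from r(3)[OF this] show "norm (- R (snd (snd (s, z, w))) - - R (snd (snd (s, z, w'))))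
        \<le> norm (w - w') / 2"
        by (simp add: norm_minus_commute)
    next
      fix z :: 'a assume "z \<in> ball 0 (r/4)"
      then show "g z = z + integral {0..1} (\<lambda>s. - R (snd (snd (s, z, g (orth_projection.rad (\<lambda>_. 0) s z)))))"
        unfolding snd_conv by (intro g(3)) auto
    qed (use r idl in \<open>auto intro!: open_Times\<close>)
  qed
  have gr: "g y \<in> ball 0 r \<and> h (g y) = y" if "y \<in> ball 0 (r/4)" for y
  proof -
    have y: "y \<in> cball 0 (r/4)" using that by auto
    then have "g y \<in> cball 0 (r/2)" using g(2) by blast
    moreover have "g y - y = integral {0..1::real} (\<lambda>s. - R (g y))"
      using g(3)[OF y] unfolding rad_0 diff_eq_eq add.commute[of y] .
    then have "h (g y) = y" by (simp add: R_def)
    ultimately show ?thesis using r(1) by auto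
  qed
  have inj: "x = y" if "x \<in> ball 0 r" "y \<in> ball 0 r" "h x = h y" for x y
  proof -
    have "R x - R y = y - x" using that by (simp add: R_def)
    then have "norm (x - y) \<le> 1/2 * norm (x - y)" using r(3)[OF that(1,2)] by (simp add: norm_minus_commute)
    then show ?thesis by simp
  qed
  show thesis
    by (rule that[of r "r/4" g]) (use r gS gr inj in auto)
qed

theorem smooth_inverse_function:
  fixes f :: "'a::euclidean_space \<Rightarrow> 'b::euclidean_space"
  assumes f: "smooth_on S f" and S: "open S" "z0 \<in> S"
    and L: "linear L" "\<And>v. L (deriv_along f z0 v) = v" "\<And>w. deriv_along f z0 (L w) = w"
  obtains U g where "open U" "z0 \<in> U" "U \<subseteq> S" "open (f ` U)" "smooth_on (f ` U) g" "\<And>x. x \<in> U \<Longrightarrow> g (f x) = x"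
proof -
  define S0 where "S0 = (\<lambda>z. z0 + z) -` S"
  define h where "h z = L (f (z0 + z) - f z0)" for z
  have S0: "open S0" "0 \<in> S0" unfolding S0_def
    using S by (auto intro!: open_vimage continuous_intros)
  have bL: "bounded_linear L" using L(1) linear_conv_bounded_linear by blast
  have tr: "Ck_on m T (\<lambda>z. c + z)" if "open T" for m T and c :: "'c::euclidean_space"
    using that by (intro Ck_on_add Ck_on_const Ck_on_bounded_linear bounded_linear_ident)
  have h: "smooth_on S0 h"
    unfolding h_def
    by (intro smooth_onI Ck_on_linear_image[OF S0(1) bL] Ck_on_diff S0(1) Ck_on_const
        Ck_on_compose[OF S0(1) S(1) tr smooth_on_Ck[OF f]]) (auto simp: S0_def)
  have "(f has_derivative deriv_along f z0) (at (z0 + 0))" using smooth_on_has_derivative[OF f S(2)] by simp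
  have "((\<lambda>z. z0 + z) has_derivative (\<lambda>v. v)) (at 0)" by (auto intro!: derivative_eq_intros)
  from has_derivative_compose[OF this \<open>(f has_derivative _) _\<close>]
  have "((\<lambda>z. f (z0 + z) - f z0) has_derivative (\<lambda>v. deriv_along f z0 v - 0)) (at 0)"
    by (rule has_derivative_diff) (rule has_derivative_const)
  from bounded_linear.has_derivative[OF bL this]
  have "(h has_derivative (\<lambda>v. v)) (at 0)" unfolding h_def by (simp add: L(2))
  then have Dh: "deriv_along h 0 v = v" for v by (rule deriv_along_eq)
  obtain r d g where r: "r > 0" "d > 0" "ball 0 r \<subseteq> S0" and g: "smooth_on (ball 0 d) g"
    "\<And>y. y \<in> ball 0 d \<Longrightarrow> g y \<in> ball 0 r \<and> h (g y) = y"
    "\<And>x. x \<in> ball 0 r \<Longrightarrow> h x \<in> ball 0 d \<Longrightarrow> g (h x) = x"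
    using smooth_inverse_near_identity[OF h S0 _ Dh] L(1) by (auto simp: h_def linear_0)
  define T where "T = (\<lambda>y. L (y - f z0)) -` ball 0 d"
  define k where "k y = z0 + g (L (y - f z0))" for y
  define U where "U = {x \<in> ball z0 r. f x \<in> T}"
  have T: "open T" unfolding T_def
    by (intro open_vimage continuous_intros bounded_linear.continuous_on[OF bL]) auto
  have US: "ball z0 r \<subseteq> S"
  proof
    fix x assume "x \<in> ball z0 r"
    then have "x - z0 \<in> S0" using r(3) by (auto simp: dist_norm norm_minus_commute subset_iff)
    then show "x \<in> S" by (simp add: S0_def)
  qed
  have kf: "k (f x) = x" if "x \<in> U" for x
  proof -
    have "x - z0 \<in> ball 0 r" "h (x - z0) \<in> ball 0 d"
      using that by (auto simp: U_def T_def h_def dist_norm norm_minus_commute)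
    from g(3)[OF this] show ?thesis by (simp add: k_def h_def)
  qed
  have fk: "k y \<in> U \<and> f (k y) = y" if "y \<in> T" for y
  proof -
    let ?w = "L (y - f z0)"
    have w: "?w \<in> ball 0 d" using that by (simp add: T_def)
    have "L (f (k y) - f z0) = L (y - f z0)" using g(2)[OF w] by (simp add: h_def k_def)
    then have "f (k y) - f z0 = y - f z0" using L(3) by metis
    then have "f (k y) = y" by simp
    moreover have "k y \<in> ball z0 r" using g(2)[OF w] by (simp add: k_def dist_norm)
    ultimately show ?thesis using that by (simp add: U_def)
  qed
  have fU: "f ` U = T" using fk by (force simp: U_def)
  show thesis
  proof (rule that[of U k])
    have "continuous_on (ball z0 r) f"
      using Ck_on_continuous[OF smooth_on_Ck[OF f]] US continuous_on_subset by blast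
    moreover have "U = ball z0 r \<inter> f -` T" by (auto simp: U_def)
    ultimately show "open U" using continuous_open_preimage[OF _ open_ball T] by metis
    show "z0 \<in> U" using r(1,2) by (simp add: U_def T_def linear_0[OF L(1)])
    show "smooth_on (f ` U) k"
      unfolding fU k_def
      by (intro smooth_onI Ck_on_add T Ck_on_const Ck_on_compose[OF T open_ball _ smooth_on_Ck[OF g(1)]]
          Ck_on_linear_image[OF T bL] Ck_on_diff Ck_on_bounded_linear bounded_linear_ident) (auto simp: T_def)
    show "open (f ` U)" unfolding fU by (rule T)
    show "U \<subseteq> S" using US by (auto simp: U_def)
  qed (rule kf)
qed

section \<open>Straightening a distribution\<close>

context orth_projection begin

lemma norm_P_le: "norm (P z) \<le> 2 * norm z"
  using norm_compl[of z] norm_triangle_ineq4[of z "z - P z"] by simp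

lemma rad_has_vector_derivative: "((\<lambda>s. rad s z) has_vector_derivative P z) (at s within S)"
  unfolding rad_def by (auto intro!: derivative_eq_intros)

lemma P_rad: "P (rad s z) = s *\<^sub>R P z"
  by (simp add: rad_def linear_add[OF linear] linear_diff[OF linear] linear_scale[OF linear])

text \<open>The plane field is given by the graphs of \<open>F z\<close> over the range of \<open>P\<close>. The ray from \<open>z - P z\<close> to \<open>z\<close>
  is lifted to a path tangent to the plane field, and \<open>G z\<close> is the end point of the lift. For the
  direction \<open>u = P z\<close> of the ray the claim on the derivative is built into the equation for \<open>G\<close>; in the
  other directions the integrability condition says that the error solves a homogeneous linear
  equation of contraction type.\<close>

theorem frobenius_graph:
  fixes F :: "'a \<Rightarrow> 'a \<Rightarrow> 'a"
  assumes "\<rho> > 0" and Flin: "\<And>z. z \<in> ball 0 \<rho> \<Longrightarrow> linear (F z)"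
    and FS: "\<And>u. smooth_on (ball 0 \<rho>) (\<lambda>z. F z u)"
    and F0: "\<And>u. F 0 u = 0"
    and integrable: "\<And>z u v. \<lbrakk>z \<in> ball 0 \<rho>; P u = u; P v = v\<rbrakk> \<Longrightarrow>
      deriv_along (\<lambda>z. F z u) z (v + F z v) = deriv_along (\<lambda>z. F z v) z (u + F z u)"
  obtains d G where "d > 0" "smooth_on (ball 0 d) G" "G ` ball 0 d \<subseteq> ball 0 \<rho>" "G 0 = 0"
    "\<And>v. deriv_along G 0 v = v"
    "\<And>z u. \<lbrakk>z \<in> ball 0 d; P u = u\<rbrakk> \<Longrightarrow> deriv_along G z u = u + F (G z) u"
proof -
  note bP = bounded_linear
  have F1: "Ck_on (Suc 0) (ball 0 \<rho>) (\<lambda>z. F z u)" for u using FS smooth_on_Ck by blast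
  \<comment> \<open>Since \<open>F 0 = 0\<close>, a Lipschitz constant in \<open>z\<close> also bounds \<open>F\<close> itself.\<close>
  have "\<exists>C\<ge>0. \<forall>z\<in>ball 0 (\<rho>/2). \<forall>w\<in>ball 0 (\<rho>/2). norm (F z b - F w b) \<le> C * norm (z - w)" for b
  proof -
    have sub: "cball 0 (\<rho>/2) \<subseteq> ball (0::'a) \<rho>" using \<open>\<rho> > 0\<close> by auto
    have "continuous_on (cball 0 (\<rho>/2)) (fderiv (\<lambda>z. F z b))"
      using Ck_on_continuous_fderiv[OF F1] sub continuous_on_subset by blast
    from compact_imp_bounded[OF compact_continuous_image[OF this compact_cball]]
    obtain C where C: "C > 0" "\<And>z. z \<in> cball 0 (\<rho>/2) \<Longrightarrow> norm (fderiv (\<lambda>z. F z b) z) \<le> C"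
      unfolding bounded_pos by (metis image_eqI)
    have "norm (F z b - F w b) \<le> C * norm (z - w)" if "z \<in> ball 0 (\<rho>/2)" "w \<in> ball 0 (\<rho>/2)" for z w
    proof (rule differentiable_bound[where S="ball 0 (\<rho>/2)" and f'="\<lambda>x. fderiv (\<lambda>z. F z b) x"])
      fix x :: 'a assume x: "x \<in> ball 0 (\<rho>/2)"
      then have x': "x \<in> cball 0 (\<rho>/2)" "x \<in> ball 0 \<rho>" using sub ball_subset_cball by blast+
      show "((\<lambda>z. F z b) has_derivative fderiv (\<lambda>z. F z b) x) (at x within ball 0 (\<rho>/2))"
        using Ck_on_has_fderiv[OF F1 x'(2)] has_derivative_at_withinI by blast
      show "onorm (fderiv (\<lambda>z. F z b) x) \<le> C" using C(2)[OF x'(1)] by (simp add: norm_blinfun.rep_eq)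
    qed (use that in auto)
    then show ?thesis using C(1) by (intro exI[of _ C]) auto
  qed
  then obtain Cb where Cb: "\<And>b. Cb b \<ge> 0"
    "\<And>b z w. \<lbrakk>z \<in> ball 0 (\<rho>/2); w \<in> ball 0 (\<rho>/2)\<rbrakk> \<Longrightarrow> norm (F z b - F w b) \<le> Cb b * norm (z - w)"
    by metis
  define C where "C = (\<Sum>b\<in>Basis. Cb b)"
  have C: "C \<ge> 0" using Cb(1) by (simp add: C_def sum_nonneg)
  let ?B = "ball (0::'a) (\<rho>/2)"
  have B\<rho>: "z \<in> ball 0 \<rho>" if "z \<in> ?B" for z
    using that \<open>\<rho> > 0\<close> by (metis dist_0_norm field_sum_of_halves less_add_same_cancel1 half_gt_zero mem_ball
      order.strict_trans)
  have Flip: "norm (F z u - F w u) \<le> C * norm u * norm (z - w)" if zw: "z \<in> ?B" "w \<in> ?B" for z w u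
  proof -
    have exp: "F y u = (\<Sum>b\<in>Basis. (u \<bullet> b) *\<^sub>R F y b)" if "y \<in> ?B" for y
      using linear_sum[OF Flin[OF B\<rho>[OF that]], of "\<lambda>b. (u \<bullet> b) *\<^sub>R b" Basis]
      by (simp add: linear_scale[OF Flin[OF B\<rho>[OF that]]] euclidean_representation)
    have "F z u - F w u = (\<Sum>b\<in>Basis. (u \<bullet> b) *\<^sub>R (F z b - F w b))"
      by (simp add: exp[OF zw(1)] exp[OF zw(2)] sum_subtractf scaleR_diff_right)
    also have "norm \<dots> \<le> (\<Sum>b\<in>Basis. norm u * (Cb b * norm (z - w)))"
      by (rule sum_norm_le) (auto intro!: mult_mono Cb zw Basis_le_norm)
    finally show ?thesis by (simp add: C_def sum_distrib_left sum_distrib_right mult_ac)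
  qed
  have Fbound: "norm (F z u) \<le> C * norm u * norm z" if "z \<in> ?B" for z u
    using Flip[OF that, of 0 u] \<open>\<rho> > 0\<close> by (simp add: F0)
  \<comment> \<open>The first bound keeps the values of \<open>G\<close> in the ball of radius \<open>\<rho>/4\<close>, the second one makes the
     equation a contraction.\<close>
  define d where "d = min (\<rho>/8) (1 / (4 * (C + 1)))"
  have d: "d > 0" "d \<le> \<rho>/8" "d \<le> 1 / (4 * (C + 1))" using \<open>\<rho> > 0\<close> C by (auto simp: d_def)
  have Cd: "C * norm (P z) \<le> 1/2" if "norm z \<le> d" for z
  proof -
    have "C * norm (P z) \<le> (C + 1) * (2 * d)"
      using C norm_P_le[of z] that by (intro mult_mono) auto
    also have "\<dots> \<le> (C + 1) * (2 * (1 / (4 * (C + 1))))" using C d(3) by (intro mult_left_mono) auto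
    also have "\<dots> = 1/2" using C by (simp add: field_simps)
    finally show ?thesis .
  qed
  let ?f = "\<lambda>q :: real \<times> 'a \<times> 'a. F (snd (snd q)) (P (fst (snd q)))"
  have fst_lin: "bounded_linear (\<lambda>q :: real \<times> 'a \<times> 'a. fst (snd q))"
    "bounded_linear (\<lambda>q :: real \<times> 'a \<times> 'a. snd (snd q))"
    by (auto intro!: bounded_linear_intros)
  have oO: "open (UNIV \<times> UNIV \<times> ball 0 \<rho> :: (real \<times> 'a \<times> 'a) set)" by (intro open_Times) auto
  have fS: "Ck_on m (UNIV \<times> UNIV \<times> ball 0 \<rho>) ?f" for m
  proof (rule Ck_on_linear_apply[OF oO, where A="\<lambda>q. F (snd (snd q))"])
    show "Ck_on m (UNIV \<times> UNIV \<times> ball 0 \<rho>) (\<lambda>q :: real \<times> 'a \<times> 'a. F (snd (snd q)) w)" for w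
      by (rule Ck_on_compose[OF oO open_ball Ck_on_bounded_linear[OF fst_lin(2)] smooth_on_Ck[OF FS]]) auto
    show "Ck_on m (UNIV \<times> UNIV \<times> ball 0 \<rho>) (\<lambda>q :: real \<times> 'a \<times> 'a. P (fst (snd q)))"
      by (intro Ck_on_linear_image[OF oO bP] Ck_on_bounded_linear fst_lin)
  qed (use Flin in auto)
  have fcont: "continuous_on (UNIV \<times> UNIV \<times> ball 0 \<rho>) ?f" using Ck_on_continuous[OF fS[of 0]] .
  have contr: "norm (F w (P z) - F w' (P z)) \<le> norm (w - w') / 2" if "w \<in> ?B" "w' \<in> ?B" "norm z \<le> d" for z w w'
    using Flip[OF that(1,2), of "P z"] mult_right_mono[OF Cd[OF that(3)] norm_ge_zero[of "w - w'"]] by simp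
  obtain G where G: "continuous_on (cball 0 d) G" "G ` cball 0 d \<subseteq> cball 0 (\<rho>/4)"
    "\<And>z. z \<in> cball 0 d \<Longrightarrow> G z = z + integral {0..1::real} (\<lambda>s. F (G (rad s z)) (P z))"
  proof (rule radial_fixpoint_exists[of d "cball 0 (\<rho>/4)" 0 "\<lambda>z. z" "\<lambda>s z w. F w (P z)"])
    show "continuous_on ({0..1} \<times> cball 0 d \<times> cball 0 (\<rho>/4)) (\<lambda>(s::real, z::'a, w). F w (P z))"
      unfolding split_beta by (rule continuous_on_subset[OF fcont]) (use \<open>\<rho> > 0\<close> in auto)
    fix k :: "'a \<Rightarrow> 'a" and z :: 'a assume k: "continuous_on (cball 0 d) k" "k ` cball 0 d \<subseteq> cball 0 (\<rho>/4)"
      and z: "z \<in> cball 0 d"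
    have kr: "k (rad s z) \<in> cball 0 (\<rho>/4)" if "s \<in> {0..1}" for s using k(2) rad_in_cball[OF that z] by blast
    have "norm (integral {0..1::real} (\<lambda>s. F (k (rad s z)) (P z))) \<le> \<rho>/8 * (1 - 0)"
    proof (rule integral_bound)
      show "continuous_on {0..1::real} (\<lambda>s. F (k (rad s z)) (P z))"
        using rad_in_cball[OF _ z] kr \<open>\<rho> > 0\<close>
        by (intro continuous_on_compose2[OF fcont, of _ "\<lambda>s. (s, z, k (rad s z))", simplified]
            continuous_intros continuous_on_compose2[OF k(1)]) fastforce+
      fix s :: real assume s: "s \<in> {0..1}"
      have "k (rad s z) \<in> ?B" using kr[OF s] \<open>\<rho> > 0\<close> by auto
      then have "norm (F (k (rad s z)) (P z)) \<le> C * norm (P z) * norm (k (rad s z))" by (rule Fbound)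
      also have "\<dots> \<le> 1/2 * (\<rho>/4)" using Cd[of z] z kr[OF s] by (intro mult_mono) auto
      finally show "norm (F (k (rad s z)) (P z)) \<le> \<rho>/8" by simp
    qed simp
    then show "z + integral {0..1::real} (\<lambda>s. F (k (rad s z)) (P z)) \<in> cball 0 (\<rho>/4)"
      using z d(2) norm_triangle_ineq[of z "integral {0..1::real} (\<lambda>s. F (k (rad s z)) (P z))"] by simp
  next
    fix z w w' :: 'a assume "w \<in> cball 0 (\<rho>/4)" "w' \<in> cball 0 (\<rho>/4)" "z \<in> cball 0 d"
    then show "norm (F w (P z) - F w' (P z)) \<le> norm (w - w') / 2"
      using \<open>\<rho> > 0\<close> by (intro contr) auto
  next
    fix G assume "continuous_on (cball 0 d) G" "G ` cball 0 d \<subseteq> cball 0 (\<rho>/4)"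
      "\<And>z. z \<in> cball 0 d \<Longrightarrow> G z = z + integral {0..1::real} (\<lambda>s. F (G (rad s z)) (P z))"
    then show thesis by (rule that)
  next
    show "0 \<le> d" "0 \<in> cball (0::'a) (\<rho>/4)" using d(1) \<open>\<rho> > 0\<close> by auto
  qed (rule closed_cball continuous_on_id)+
  let ?Z = "ball (0::'a) d"
  have GcZ: "continuous_on ?Z G" using G(1) continuous_on_subset ball_subset_cball by blast
  have GB: "G z \<in> ?B" if "z \<in> ?Z" for z
  proof -
    have "G z \<in> cball 0 (\<rho>/4)" using G(2) that ball_subset_cball by blast
    then show ?thesis using \<open>\<rho> > 0\<close> by auto
  qed
  have Geq: "G z = z + integral {0..1::real} (\<lambda>s. ?f (s, z, G (rad s z)))" if "z \<in> ?Z" for z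
    using G(3)[of z] that by simp
  have idl: "Ck_on m T (\<lambda>w::'a. w)" for m T by (rule Ck_on_bounded_linear) (rule bounded_linear_ident)
  have sub: "{0..1} \<times> ?Z \<times> ?B \<subseteq> UNIV \<times> UNIV \<times> ball 0 \<rho>" using B\<rho> by blast
  have GBi: "G ` ?Z \<subseteq> ?B" using GB by blast
  have clip: "norm (?f (s, z, w) - ?f (s, z, w')) \<le> norm (w - w') / 2" if "z \<in> ?Z" "w \<in> ?B" "w' \<in> ?B"
    for s z w w'
    using contr[OF that(2,3)] that(1) by simp
  have GS: "smooth_on ?Z G"
    by (rule smooth_onI, rule radial_fixpoint_Ck[OF oO sub open_ball convex_ball fS idl GcZ GBi Geq clip])
  have fD: "deriv_along ?f (s, z, w) (0, v, y) = F w (P v) + deriv_along (\<lambda>w. F w (P z)) w y"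
    if w: "w \<in> ball 0 \<rho>" for s z w v y
  proof -
    have "((\<lambda>q. P (fst (snd q))) has_derivative (\<lambda>h. P (fst (snd h)))) (at (s, z, w))"
      by (rule bounded_linear.has_derivative[OF bP bounded_linear_imp_has_derivative[OF fst_lin(1)]])
    from linear_apply_has_derivative[OF open_ball Flin F1 _ bounded_linear_imp_has_derivative[OF fst_lin(2)]
      this] w
    have "(?f has_derivative (\<lambda>h. deriv_along (\<lambda>w. F w (P z)) w (snd (snd h)) + F w (P (fst (snd h))))) (at
      (s, z, w))"
      by simp
    from deriv_along_eq[OF this] show ?thesis by simp
  qed
  have DG: "deriv_along G z v = v + integral {0..1} (\<lambda>s. F (G (rad s z)) (P v)
      + deriv_along (\<lambda>w. F w (P z)) (G (rad s z)) (deriv_along G (rad s z) (rad s v)))" if z: "z \<in> ?Z" for z v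
  proof -
    have "deriv_along G z v = deriv_along (\<lambda>z. z) z v + integral {0..1} (\<lambda>s.
      deriv_along ?f (s, z, G (rad s z)) (0, v, deriv_along G (rad s z) (rad s v)))"
      by (rule radial_fixpoint_differentiable(2)[OF oO sub open_ball convex_ball fS idl GcZ GBi Geq clip z])
    also have "deriv_along (\<lambda>z. z) z v = v" by (rule deriv_along_eq) (rule has_derivative_ident)
    also have "integral {0..1} (\<lambda>s. deriv_along ?f (s, z, G (rad s z)) (0, v, deriv_along G (rad s z) (rad s
      v)))
      = integral {0..1} (\<lambda>s. F (G (rad s z)) (P v)
      + deriv_along (\<lambda>w. F w (P z)) (G (rad s z)) (deriv_along G (rad s z) (rad s v)))"
      by (rule integral_cong, rule fD, rule B\<rho>, rule GB) (use rad_in_ball[OF _ z] in blast)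
    finally show ?thesis .
  qed
  have P0: "P 0 = 0" by (rule linear_0[OF linear])
  have "G 0 = 0"
  proof -
    have "F (G (rad s 0)) (P 0) = 0" if "s \<in> {0..1}" for s
      using linear_0[OF Flin[OF B\<rho>[OF GB]]] rad_in_ball[OF that, of 0 d] d(1) by (simp add: P0)
    then have "integral {0..1::real} (\<lambda>s. F (G (rad s 0)) (P 0)) = integral {0..1::real} (\<lambda>s. 0 :: 'a)"
      by (intro integral_cong) auto
    then show ?thesis using Geq[of 0] d(1) by simp
  qed
  have rad0: "rad s 0 = 0" for s by (rule linear_0[OF linear_rad])
  have DG0: "deriv_along G 0 v = v" for v
  proof -
    have "((\<lambda>w. 0) has_derivative (\<lambda>v. 0)) (at (0::'a))" by (rule has_derivative_const)
    from has_derivative_transform_within_open[OF this open_ball[of 0 \<rho>], of "\<lambda>w. F w (P 0)"]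
    have "((\<lambda>w. F w (P 0)) has_derivative (\<lambda>v. 0)) (at 0)"
      using \<open>\<rho> > 0\<close> linear_0[OF Flin] by (simp add: P0)
    then have "deriv_along (\<lambda>w. F w (P 0)) 0 y = 0" for y by (rule deriv_along_eq)
    then show ?thesis using DG[of 0 v] d(1) by (simp add: rad0 \<open>G 0 = 0\<close> F0)
  qed
  have DGlin: "linear (deriv_along G z)" if "z \<in> ?Z" for z by (rule smooth_on_linear_deriv[OF GS that])
  have DFlin: "linear (deriv_along (\<lambda>w. F w u) (G z))" if "z \<in> ?Z" for z u
    by (rule smooth_on_linear_deriv[OF FS B\<rho>[OF GB[OF that]]])
  have DGcont: "continuous_on ?Z (\<lambda>z. deriv_along G z v)" for v
    using Ck_on_continuous[OF smooth_on_Ck[OF smooth_on_deriv_along[OF GS]]] .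
  have DFc: "continuous_on {0..1} (\<lambda>s. deriv_along (\<lambda>w. F w u) (G (rad s z)) (deriv_along G (rad s z) v))"
    if z: "z \<in> ?Z" for z u v
  proof -
    have "continuous_on ?Z (\<lambda>y. deriv_along (\<lambda>w. F w u) (G y) (deriv_along G y v))"
      using Ck_on_linear_apply[of ?Z "\<lambda>y. deriv_along (\<lambda>w. F w u) (G y)" 0 "\<lambda>y. deriv_along G y v"] DFlin
        Ck_on_compose[OF open_ball open_ball smooth_on_Ck[OF GS] smooth_on_Ck[OF smooth_on_deriv_along[OF
          FS[of u]]], of 0]
        GB B\<rho> DGcont by (auto simp: image_subset_iff)
    then show ?thesis
      by (rule continuous_on_compose2[of _ _ _ "\<lambda>s. rad s z"]) (use rad_in_ball[OF _ z] in \<open>auto intro!: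
        continuous_intros\<close>)
  qed
  have Fc: "continuous_on {0..1} (\<lambda>s. F (G (rad s z)) u)" if z: "z \<in> ?Z" for z u
  proof -
    have "continuous_on (ball 0 \<rho>) (\<lambda>z. F z u)" using Ck_on_continuous[OF smooth_on_Ck[OF FS]] .
    then show ?thesis
      by (rule continuous_on_compose2[of _ _ _ "\<lambda>s. G (rad s z)"], intro continuous_on_compose2[OF GcZ]
        continuous_intros)
        (use rad_in_ball[OF _ z] GB B\<rho> in auto)
  qed
  define err where "err u z = deriv_along G z u - u - F (G z) u" for u z
  have err: "err u z = integral {0..1} (\<lambda>s. s *\<^sub>R (deriv_along (\<lambda>w. F w (P z)) (G (rad s z)) (deriv_along G
    (rad s z) u)
      - deriv_along (\<lambda>w. F w u) (G (rad s z)) (deriv_along G (rad s z) (P z))))"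
    if z: "z \<in> ?Z" and u: "P u = u" for u z
  proof -
    have rz: "rad s z \<in> ?Z" if "s \<in> {0..1}" for s by (rule rad_in_ball[OF that z])
    have rsu: "rad s u = s *\<^sub>R u" for s by (simp add: rad_def u)
    have "((\<lambda>s. s *\<^sub>R F (G (rad s z)) u) has_vector_derivative
       (s *\<^sub>R deriv_along (\<lambda>w. F w u) (G (rad s z)) (deriv_along G (rad s z) (P z)) + 1 *\<^sub>R F (G (rad s z))
         u)) (at s within {0..1})"
      if s: "s \<in> {0..1}" for s
    proof (rule has_vector_derivative_scaleR)
      have "((\<lambda>s. G (rad s z)) has_vector_derivative deriv_along G (rad s z) (P z)) (at s within {0..1})"
        using vector_derivative_diff_chain_within[OF rad_has_vector_derivative has_derivative_at_withinI[OF
          smooth_on_has_derivative[OF GS rz[OF s]]]]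
        by (simp add: o_def)
      from vector_derivative_diff_chain_within[OF this has_derivative_at_withinI[OF
        smooth_on_has_derivative[OF FS B\<rho>[OF GB[OF rz[OF s]]]]]]
      show "((\<lambda>s. F (G (rad s z)) u) has_vector_derivative deriv_along (\<lambda>w. F w u) (G (rad s z))
        (deriv_along G (rad s z) (P z))) (at s within {0..1})"
        by (simp add: o_def)
    qed (auto intro!: derivative_eq_intros)
    from fundamental_theorem_of_calculus[OF _ this]
    have "integral {0..1} (\<lambda>s. s *\<^sub>R deriv_along (\<lambda>w. F w u) (G (rad s z)) (deriv_along G (rad s z) (P z)) +
      F (G (rad s z)) u)
      = F (G (rad 1 z)) u" by (auto intro: integral_unique)
    also have "rad 1 z = z" by (simp add: rad_def)
    finally have 1: "F (G z) u = integral {0..1} (\<lambda>s. s *\<^sub>R deriv_along (\<lambda>w. F w u) (G (rad s z))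
      (deriv_along G (rad s z) (P z)) + F (G (rad s z)) u)" by simp
    have 2: "deriv_along G z u = u + integral {0..1} (\<lambda>s. F (G (rad s z)) u
      + s *\<^sub>R deriv_along (\<lambda>w. F w (P z)) (G (rad s z)) (deriv_along G (rad s z) u))"
      unfolding DG[OF z] u rsu
      by (intro arg_cong[of _ _ "\<lambda>x. u + x"] integral_cong)
        (simp add: linear_scale[OF DGlin[OF rz]] linear_scale[OF DFlin[OF rz]])
    have "err u z = integral {0..1} (\<lambda>s. (F (G (rad s z)) u
      + s *\<^sub>R deriv_along (\<lambda>w. F w (P z)) (G (rad s z)) (deriv_along G (rad s z) u))
      - (s *\<^sub>R deriv_along (\<lambda>w. F w u) (G (rad s z)) (deriv_along G (rad s z) (P z)) + F (G (rad s z)) u))"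
      unfolding err_def 2
      by (subst 1, subst integral_diff)
        (auto intro!: integrable_continuous_real continuous_intros DFc[OF z] Fc[OF z])
    then show ?thesis by (simp add: algebra_simps)
  qed
  \<comment> \<open>for \<open>u = P z\<close> the two terms of the integrand cancel\<close>
  have radial: "deriv_along G z (P z) = P z + F (G z) (P z)" if "z \<in> ?Z" for z
    using err[OF that, of "P z"] by (simp add: err_def diff_diff_eq)
  have err0: "err u z = 0" if z: "z \<in> ?Z" and u: "P u = u" for u z
  proof -
    let ?K = "cball (0::'a) (norm z)"
    have KZ: "?K \<subseteq> ?Z" using z by auto
    have "continuous_on ?Z (\<lambda>z. F (G z) u)"
      by (rule continuous_on_compose2[OF Ck_on_continuous[OF smooth_on_Ck[OF FS]] GcZ]) (use GB B\<rho> in blast)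
    then have "continuous_on ?K (err u)"
      unfolding err_def by (intro continuous_intros continuous_on_subset[OF DGcont KZ]) (rule
        continuous_on_subset[OF _ KZ])
    from compact_imp_bounded[OF compact_continuous_image[OF this compact_cball]]
    obtain M where M: "M > 0" "\<And>y. y \<in> ?K \<Longrightarrow> norm (err u y) \<le> M"
      unfolding bounded_pos by (metis image_eqI)
    have "norm (err u z) \<le> 0"
    proof (rule le_by_halving[of ?K "\<lambda>y. norm (err u y)" M "\<lambda>_. 0"])
      fix c y assume c: "c \<ge> 0" "\<And>q. q \<in> ?K \<Longrightarrow> norm (err u q) \<le> 0 + c" and y: "y \<in> ?K"
      then have yZ: "y \<in> ?Z" using KZ by blast
      have ry: "rad s y \<in> ?Z" "rad s y \<in> ?K" if "s \<in> {0..1}" for s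
        using rad_in_ball[OF that yZ] rad_in_cball[OF that y] by auto
      let ?i = "\<lambda>s. s *\<^sub>R (deriv_along (\<lambda>w. F w (P y)) (G (rad s y)) (deriv_along G (rad s y) u)
      - deriv_along (\<lambda>w. F w u) (G (rad s y)) (deriv_along G (rad s y) (P y)))"
      have i: "?i s = s *\<^sub>R deriv_along (\<lambda>w. F w (P y)) (G (rad s y)) (err u (rad s y))" if s: "s \<in> {0..1}"
        for s
      proof -
        let ?g = "G (rad s y)"
        note lF = DFlin[OF ry(1)[OF s]]
        have "s *\<^sub>R deriv_along G (rad s y) (P y) = s *\<^sub>R (P y + F ?g (P y))"
          using radial[OF ry(1)[OF s]]
          by (simp add: P_rad linear_scale[OF DGlin[OF ry(1)[OF s]]] linear_scale[OF Flin[OF B\<rho>[OF GB[OF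
            ry(1)[OF s]]]]] scaleR_add_right)
        then have "s *\<^sub>R deriv_along (\<lambda>w. F w u) ?g (deriv_along G (rad s y) (P y))
          = s *\<^sub>R deriv_along (\<lambda>w. F w u) ?g (P y + F ?g (P y))"
          by (metis linear_scale[OF lF])
        also have "\<dots> = s *\<^sub>R deriv_along (\<lambda>w. F w (P y)) ?g (u + F ?g u)"
          using integrable[OF B\<rho>[OF GB[OF ry(1)[OF s]]] u, of "P y"] by simp
        finally have e: "s *\<^sub>R deriv_along (\<lambda>w. F w u) ?g (deriv_along G (rad s y) (P y))
          = s *\<^sub>R deriv_along (\<lambda>w. F w (P y)) ?g (u + F ?g u)" .
        show ?thesis
          unfolding scaleR_diff_right e err_def
          by (simp add: scaleR_diff_right scaleR_add_right linear_diff[OF lF] linear_add[OF lF])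
      qed
      have "norm (integral {0..1} ?i) \<le> c / 2 * (1 - 0)"
      proof (rule integral_bound)
        show "continuous_on {0..1} ?i" by (intro continuous_intros DFc[OF yZ])
        fix s :: real assume s: "s \<in> {0..1}"
        let ?e = "err u (rad s y)"
        have "norm (deriv_along (\<lambda>w. F w (P y)) (G (rad s y)) ?e) \<le> 1/2 * norm ?e"
          by (rule norm_deriv_le_lipschitz[OF smooth_on_has_derivative[OF FS B\<rho>[OF GB[OF ry(1)[OF s]]]]
            open_ball GB[OF ry(1)[OF s]]])
            (use contr[OF _ GB[OF ry(1)[OF s]], of _ y] yZ in auto)
        also have "\<dots> \<le> c / 2" using c(2)[OF ry(2)[OF s]] by simp
        finally have *: "norm (deriv_along (\<lambda>w. F w (P y)) (G (rad s y)) ?e) \<le> c / 2" .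
        have "norm (?i s) \<le> 1 * norm (deriv_along (\<lambda>w. F w (P y)) (G (rad s y)) ?e)"
          unfolding i[OF s] norm_scaleR using s by (intro mult_right_mono) auto
        with * show "norm (?i s) \<le> c / 2" by simp
      qed simp
      then show "norm (err u y) \<le> 0 + c / 2" using err[OF yZ u] by simp
    qed (use M in auto)
    then show ?thesis by simp
  qed
  have DGu: "deriv_along G z u = u + F (G z) u" if "z \<in> ?Z" "P u = u" for z u
    using err0[OF that] by (simp add: err_def diff_diff_eq)
  show thesis
    by (rule that[OF d(1) GS _ \<open>G 0 = 0\<close> DG0 DGu]) (use GB B\<rho> in auto)
qed

end

section \<open>Plane fields as graphs\<close>

text \<open>Two applications of the mean value theorem, first in the direction \<open>a\<close> and then in the direction
  \<open>b\<close>. The left hand side of the equation is symmetric in \<open>a\<close> and \<open>b\<close>, which is why second derivatives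
  are symmetric.\<close>

lemma smooth_on_mixed_difference:
  fixes f :: "'a::euclidean_space \<Rightarrow> real"
  assumes f: "smooth_on S f" and r: "ball z r \<subseteq> S" and h: "h > 0" "h * (norm a + norm b) < r"
  obtains \<xi> where "\<xi> \<in> ball z r"
    "f (z + h *\<^sub>R a + h *\<^sub>R b) - f (z + h *\<^sub>R a) - f (z + h *\<^sub>R b) + f z
      = h * h * deriv_along (\<lambda>x. deriv_along f x a) \<xi> b"
proof -
  let ?fa = "\<lambda>x. deriv_along f x a"
  have in_ball: "z + t *\<^sub>R a + s *\<^sub>R b \<in> ball z r" if "0 \<le> t" "t \<le> h" "0 \<le> s" "s \<le> h" for t s
  proof -
    have "norm (t *\<^sub>R a + s *\<^sub>R b) \<le> h * norm a + h * norm b"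
      using that by (intro order_trans[OF norm_triangle_ineq]) (auto intro!: add_mono mult_right_mono)
    then have "norm (t *\<^sub>R a + s *\<^sub>R b) < r" using h(2) by (simp add: algebra_simps)
    then show ?thesis unfolding mem_ball by (subst dist_commute) (simp add: dist_norm add.assoc)
  qed
  have line: "((\<lambda>t. g (c + t *\<^sub>R v)) has_real_derivative deriv_along g (c + t *\<^sub>R v) v) (at t)"
    if "smooth_on S g" "c + t *\<^sub>R v \<in> S" for g :: "'a \<Rightarrow> real" and c v t
  proof -
    have "((\<lambda>t. c + t *\<^sub>R v) has_derivative (\<lambda>d. d *\<^sub>R v)) (at t)" by (auto intro!: derivative_eq_intros)
    from has_derivative_compose[OF this smooth_on_has_derivative[OF that]]
    have "((\<lambda>t. g (c + t *\<^sub>R v)) has_derivative (\<lambda>d. deriv_along g (c + t *\<^sub>R v) (d *\<^sub>R v))) (at t)" .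
    then show ?thesis
      unfolding has_field_derivative_def
      by (rule has_derivative_eq_rhs) (simp add: fun_eq_iff linear_scale[OF smooth_on_linear_deriv[OF that]])
  qed
  have fS: "smooth_on S ?fa" by (rule smooth_on_deriv_along[OF f])
  have "\<exists>t>0. t < h \<and> (f ((z + h *\<^sub>R b) + h *\<^sub>R a) - f (z + h *\<^sub>R a)) - (f ((z + h *\<^sub>R b) + 0 *\<^sub>R a) - f (z
    + 0 *\<^sub>R a))
    = (h - 0) * (?fa ((z + h *\<^sub>R b) + t *\<^sub>R a) - ?fa (z + t *\<^sub>R a))"
  proof (rule MVT2[OF h(1)])
    fix t assume "0 \<le> t" "t \<le> h"
    then have "z + h *\<^sub>R b + t *\<^sub>R a \<in> S" "z + t *\<^sub>R a \<in> S"
      using in_ball[of t h] in_ball[of t 0] h(1) r by (auto simp: add_ac)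
    then show "((\<lambda>t. f ((z + h *\<^sub>R b) + t *\<^sub>R a) - f (z + t *\<^sub>R a)) has_real_derivative
      (?fa ((z + h *\<^sub>R b) + t *\<^sub>R a) - ?fa (z + t *\<^sub>R a))) (at t)"
      by (intro DERIV_diff line[OF f])
  qed
  then obtain t where t: "0 < t" "t < h" and 1: "f (z + h *\<^sub>R a + h *\<^sub>R b) - f (z + h *\<^sub>R a) - f (z + h *\<^sub>R
    b) + f z
    = h * (?fa (z + t *\<^sub>R a + h *\<^sub>R b) - ?fa (z + t *\<^sub>R a))"
    by (auto simp: add_ac)
  have "\<exists>s>0. s < h \<and> ?fa (z + t *\<^sub>R a + h *\<^sub>R b) - ?fa (z + t *\<^sub>R a + 0 *\<^sub>R b)
    = (h - 0) * deriv_along ?fa (z + t *\<^sub>R a + s *\<^sub>R b) b"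
  proof (rule MVT2[OF h(1)])
    fix s assume "0 \<le> s" "s \<le> h"
    then show "((\<lambda>s. ?fa (z + t *\<^sub>R a + s *\<^sub>R b)) has_real_derivative deriv_along ?fa (z + t *\<^sub>R a + s *\<^sub>R
      b) b) (at s)"
      using in_ball[of t s] t r by (intro line[OF fS]) auto
  qed
  then obtain s where s: "0 < s" "s < h" and 2: "?fa (z + t *\<^sub>R a + h *\<^sub>R b) - ?fa (z + t *\<^sub>R a)
    = h * deriv_along ?fa (z + t *\<^sub>R a + s *\<^sub>R b) b" by auto
  show thesis
    by (rule that[of "z + t *\<^sub>R a + s *\<^sub>R b"]) (use in_ball[of t s] t s 1 2 in auto)
qed

lemma deriv_along_component:
  assumes "f differentiable (at x)"
  shows "deriv_along (\<lambda>x. f x \<bullet> c) x v = deriv_along f x v \<bullet> c"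
  by (rule deriv_along_eq[OF bounded_linear.has_derivative[OF bounded_linear_inner_left
    has_derivative_deriv_along[OF assms]]])

lemma smooth_on_symmetric_second_derivative:
  fixes f :: "'a::euclidean_space \<Rightarrow> 'b::euclidean_space"
  assumes f: "smooth_on S f" and S: "open S" "z \<in> S"
  shows "deriv_along (\<lambda>x. deriv_along f x a) z b = deriv_along (\<lambda>x. deriv_along f x b) z a"
proof -
  have real: "deriv_along (\<lambda>x. deriv_along g x a) z b = deriv_along (\<lambda>x. deriv_along g x b) z a"
    if g: "smooth_on S g" for g :: "'a \<Rightarrow> real"
  proof -
    define u where "u x = deriv_along (\<lambda>x. deriv_along g x a) x b" for x
    define w where "w x = deriv_along (\<lambda>x. deriv_along g x b) x a" for x
    have "isCont u z" "isCont w z"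
      using Ck_on_continuous[OF smooth_on_Ck[OF smooth_on_deriv_along[OF smooth_on_deriv_along[OF g]]]] S
      unfolding u_def w_def by (auto simp: continuous_on_eq_continuous_at)
    have "\<bar>u z - w z\<bar> \<le> e" if "e > 0" for e
    proof -
      have "e/2 > 0" using that by simp
      with \<open>isCont u z\<close> \<open>isCont w z\<close> obtain d1 d2 where d: "d1 > 0" "d2 > 0"
        "\<And>x. dist x z < d1 \<Longrightarrow> dist (u x) (u z) < e/2" "\<And>x. dist x z < d2 \<Longrightarrow> dist (w x) (w z) < e/2"
        unfolding continuous_at_eps_delta by metis
      obtain d3 where d3: "d3 > 0" "ball z d3 \<subseteq> S" using S openE by blast
      define r where "r = min d1 (min d2 d3)"
      have r: "r > 0" "ball z r \<subseteq> S" using d d3 by (auto simp: r_def)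
      define h where "h = r / (2 * (norm a + norm b + 1))"
      have n: "norm a + norm b + 1 > 0" by (simp add: add_nonneg_pos)
      have h: "h > 0" using r n by (simp add: h_def)
      have "h * (norm a + norm b) < h * (norm a + norm b + 1)" using h by simp
      also have "\<dots> = r / 2" using n unfolding h_def by (simp add: field_simps)
      finally have h2: "h * (norm a + norm b) < r" using r by simp
      obtain \<xi> where \<xi>: "\<xi> \<in> ball z r" "g (z + h *\<^sub>R a + h *\<^sub>R b) - g (z + h *\<^sub>R a) - g (z + h *\<^sub>R b) + g z
        = h * h * u \<xi>"
        using smooth_on_mixed_difference[OF g r(2) h h2] unfolding u_def by blast
      obtain \<zeta> where \<zeta>: "\<zeta> \<in> ball z r" "g (z + h *\<^sub>R b + h *\<^sub>R a) - g (z + h *\<^sub>R b) - g (z + h *\<^sub>R a) + g z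
        = h * h * w \<zeta>"
        using smooth_on_mixed_difference[OF g r(2) h, of b a] h2 unfolding w_def by (metis add.commute)
      have "h * h * u \<xi> = h * h * w \<zeta>" unfolding \<xi>(2)[symmetric] \<zeta>(2)[symmetric] by (simp add: add_ac)
      then have "u \<xi> = w \<zeta>" using h by simp
      moreover have "\<bar>u \<xi> - u z\<bar> < e/2" "\<bar>w \<zeta> - w z\<bar> < e/2"
        using d(3)[of \<xi>] d(4)[of \<zeta>] \<xi>(1) \<zeta>(1) by (auto simp: r_def dist_commute dist_real_def)
      ultimately show ?thesis by linarith
    qed
    then have "\<bar>u z - w z\<bar> \<le> 0" using field_le_epsilon[of "\<bar>u z - w z\<bar>" 0] by simp
    then show ?thesis by (simp add: u_def w_def)
  qed
  show ?thesis
  proof (rule euclidean_eqI)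
    fix c :: 'b assume "c \<in> Basis"
    have fc: "smooth_on S (\<lambda>x. f x \<bullet> c)" by (intro smooth_onI Ck_on_inner_left S smooth_on_Ck[OF f])
    have dif: "f differentiable (at x)" "(\<lambda>x. deriv_along f x v) differentiable (at x)" if "x \<in> S" for x v
      using smooth_on_has_derivative[OF f that] smooth_on_has_derivative[OF smooth_on_deriv_along[OF f] that]
      by (auto simp: differentiable_def)
    have *: "deriv_along (\<lambda>x. deriv_along (\<lambda>x. f x \<bullet> c) x v) z w
      = deriv_along (\<lambda>x. deriv_along f x v) z w \<bullet> c" for v w
    proof -
      have "deriv_along (\<lambda>x. deriv_along (\<lambda>x. f x \<bullet> c) x v) z = deriv_along (\<lambda>x. deriv_along f x v \<bullet> c) z"
        by (rule frechet_derivative_transform_within_open[OF _ S])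
          (use smooth_on_has_derivative[OF smooth_on_deriv_along[OF fc] S(2)] dif(1) in \<open>auto simp:
            differentiable_def deriv_along_component\<close>)
      then show ?thesis by (simp add: deriv_along_component[OF dif(2)[OF S(2)]])
    qed
    show "deriv_along (\<lambda>x. deriv_along f x a) z b \<bullet> c = deriv_along (\<lambda>x. deriv_along f x b) z a \<bullet> c"
      using real[OF fc] by (simp add: *)
  qed
qed

text \<open>\<open>M z\<close> is close to the identity near \<open>0\<close>, and \<open>N z w\<close> is the fixed point of the contraction
  \<open>y \<mapsto> w + (y - M z y)\<close>.\<close>

lemma smooth_linear_inverse:
  fixes M :: "'a::euclidean_space \<Rightarrow> 'a \<Rightarrow> 'a"
  assumes S: "open S" "0 \<in> S" and lin: "\<And>z. z \<in> S \<Longrightarrow> linear (M z)"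
    and smooth: "\<And>w. smooth_on S (\<lambda>z. M z w)" and M0: "\<And>w. M 0 w = w"
  obtains r N where "r > 0" "ball 0 r \<subseteq> S" "\<And>z. z \<in> ball 0 r \<Longrightarrow> linear (N z)"
    "\<And>z w. z \<in> ball 0 r \<Longrightarrow> M z (N z w) = w" "\<And>z w. z \<in> ball 0 r \<Longrightarrow> N z (M z w) = w"
    "\<And>w. smooth_on (ball 0 r) (\<lambda>z. N z w)"
proof -
  have bl: "bounded_linear (M z)" if "z \<in> S" for z using lin[OF that] linear_conv_bounded_linear by blast
  have MS: "blinfun_apply (Blinfun (M z)) = M z" if "z \<in> S" for z
    by (rule bounded_linear_Blinfun_apply[OF bl[OF that]])
  have "continuous_on S (\<lambda>z. Blinfun (M z))"
  proof (rule continuous_on_blinfun_componentwise)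
    fix b :: 'a
    have "continuous_on S (\<lambda>z. M z b)" using Ck_on_continuous[OF smooth_on_Ck[OF smooth]] .
    then show "continuous_on S (\<lambda>z. blinfun_apply (Blinfun (M z)) b)" by (rule continuous_on_eq) (simp add: MS)
  qed
  then have "isCont (\<lambda>z. norm (Blinfun (M z) - id_blinfun)) 0"
    using S by (intro continuous_intros) (simp add: continuous_on_eq_continuous_at)
  moreover have "Blinfun (M 0) = id_blinfun" by (rule blinfun_eqI) (simp add: MS S M0)
  ultimately obtain d where d: "d > 0" "\<And>z. dist z 0 < d \<Longrightarrow> norm (Blinfun (M z) - id_blinfun) < 1/2"
    unfolding continuous_at_eps_delta by (auto simp: dist_real_def dest!: spec[of _ "1/2"])
  obtain d' where d': "d' > 0" "ball 0 d' \<subseteq> S" using S openE by blast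
  define r where "r = min d d'"
  have r: "r > 0" "ball 0 r \<subseteq> S" using d d' by (auto simp: r_def)
  have near: "norm (w - M z w) \<le> 1/2 * norm w" if "z \<in> ball 0 r" for z w
  proof -
    have "norm ((Blinfun (M z) - id_blinfun) w) \<le> 1/2 * norm w"
      using d(2)[of z] that by (intro order_trans[OF norm_blinfun] mult_right_mono) (auto simp: r_def dist_norm)
    then show ?thesis using that r(2) by (simp add: blinfun.diff_left MS subset_iff norm_minus_commute)
  qed
  have "\<exists>N. linear N \<and> (\<forall>w. N (M z w) = w) \<and> (\<forall>w. M z (N w) = w)" if z: "z \<in> ball 0 r" for z
  proof -
    have "M z w = 0 \<Longrightarrow> w = 0" for w using near[OF z, of w] by simp
    then have "inj (M z)" using linear_injective_0[OF lin] z r(2) by blast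
    then show ?thesis using linear_injective_isomorphism lin z r(2) by blast
  qed
  then obtain N where N: "\<And>z. z \<in> ball 0 r \<Longrightarrow> linear (N z)" "\<And>z w. z \<in> ball 0 r \<Longrightarrow> N z (M z w) = w"
    "\<And>z w. z \<in> ball 0 r \<Longrightarrow> M z (N z w) = w" by metis
  have N2: "norm (N z w) \<le> 2 * norm w" if "z \<in> ball 0 r" for z w
    using near[OF that, of "N z w"] norm_triangle_ineq4[of "N z w - w" "- w"] by (simp add: N(3)[OF that])
  have Ncont: "continuous_on (ball 0 r) (\<lambda>z. N z w)" for w
  proof -
    have "((\<lambda>z. N z w) \<longlongrightarrow> N y w) (at y within ball 0 r)" if y: "y \<in> ball 0 r" for y
    proof (rule Lim_transform[where g="\<lambda>_. N y w"])
      have "continuous_on (ball 0 r) (\<lambda>z. M z (N y w))"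
        using Ck_on_continuous[OF smooth_on_Ck[OF smooth]] r(2) continuous_on_subset by blast
      then have "((\<lambda>z. M z (N y w)) \<longlongrightarrow> M y (N y w)) (at y within ball 0 r)"
        using y by (simp add: continuous_on_def)
      then have "((\<lambda>z. 2 * norm (M z (N y w) - w)) \<longlongrightarrow> 2 * norm (w - w)) (at y within ball 0 r)"
        unfolding N(3)[OF y] by (intro tendsto_intros)
      then have t: "((\<lambda>z. 2 * norm (M z (N y w) - w)) \<longlongrightarrow> 0) (at y within ball 0 r)" by simp
      show "((\<lambda>z. N z w - N y w) \<longlongrightarrow> 0) (at y within ball 0 r)"
      proof (rule Lim_null_comparison[OF _ t])
        have "norm (N y w - N z w) \<le> 2 * norm (M z (N y w) - w)" if z: "z \<in> ball 0 r" for z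
          using N2[OF z, of "M z (N y w) - w"] by (simp add: linear_diff[OF N(1)[OF z]] N(2)[OF z])
        then show "\<forall>\<^sub>F z in at y within ball 0 r. norm (N z w - N y w) \<le> 2 * norm (M z (N y w) - w)"
          by (auto simp: eventually_at_filter norm_minus_commute)
      qed
    qed simp
    then show ?thesis by (simp add: continuous_on_def)
  qed
  have "smooth_on (ball 0 r) (\<lambda>z. N z w)" for w
  proof (rule smooth_onI)
    fix m
    let ?f = "\<lambda>q :: real \<times> 'a \<times> 'a. snd (snd q) - M (fst (snd q)) (snd (snd q))"
    have o: "open (UNIV \<times> ball 0 r \<times> UNIV :: (real \<times> 'a \<times> 'a) set)" by (intro open_Times) auto
    have l: "bounded_linear (\<lambda>q :: real \<times> 'a \<times> 'a. fst (snd q))"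
      "bounded_linear (\<lambda>q :: real \<times> 'a \<times> 'a. snd (snd q))"
      by (auto intro!: bounded_linear_intros)
    show "Ck_on m (ball 0 r) (\<lambda>z. N z w)"
    proof (rule orth_projection.radial_fixpoint_Ck[OF orth_projection_0, of
      "UNIV \<times> ball 0 r \<times> UNIV" r UNIV m ?f "\<lambda>_. w"])
      show "Ck_on m (UNIV \<times> ball 0 r \<times> UNIV) ?f"
      proof (rule Ck_on_diff[OF o Ck_on_bounded_linear[OF l(2)] Ck_on_linear_apply[OF o, where A="\<lambda>q. M (fst
        (snd q))"]])
        show "Ck_on m (UNIV \<times> ball 0 r \<times> UNIV) (\<lambda>q :: real \<times> 'a \<times> 'a. snd (snd q))"
          by (rule Ck_on_bounded_linear[OF l(2)])
        show "Ck_on m (UNIV \<times> ball 0 r \<times> UNIV) (\<lambda>q :: real \<times> 'a \<times> 'a. M (fst (snd q)) v)" for v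
          by (rule Ck_on_compose[OF o S(1) Ck_on_bounded_linear[OF l(1)] smooth_on_Ck[OF smooth]]) (use r(2)
            in auto)
      qed (use lin r(2) in auto)
      show "N z w = w + integral {0..1} (\<lambda>s. ?f (s, z, N (orth_projection.rad (\<lambda>_. 0) s z) w))" if
        "z \<in> ball 0 r" for z
        by (simp add: N(3)[OF that])
      fix s :: real and z u u' :: 'a assume z: "z \<in> ball 0 r"
      then have "linear (M z)" using lin r(2) by blast
      then show "norm (?f (s, z, u) - ?f (s, z, u')) \<le> norm (u - u') / 2"
        using near[OF z, of "u - u'"] by (simp add: linear_diff algebra_simps)
    qed (use o Ncont in \<open>auto intro: Ck_on_const\<close>)
  qed
  then show thesis using that[of r N] r N by blast
qed

text \<open>The planes are spanned by the frames \<open>B z\<close>. Near \<open>0\<close> the projection \<open>P\<close> restricts to an isomorphism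
  from the plane at \<open>z\<close> onto \<open>range P\<close>; \<open>M z\<close> extends this isomorphism, read in the frame, by the
  identity on the complement, so that its inverse recovers the frame coordinates from the projection.\<close>

lemma (in orth_projection) smooth_frame_graph:
  fixes B :: "'a \<Rightarrow> 'a \<Rightarrow> 'a"
  assumes S: "open S" "0 \<in> S" and lin: "\<And>z. z \<in> S \<Longrightarrow> linear (B z)"
    and smooth: "\<And>w. smooth_on S (\<lambda>z. B z w)" and B0: "\<And>w. B 0 w = w"
  obtains r F where "r > 0" "ball 0 r \<subseteq> S" "\<And>z. z \<in> ball 0 r \<Longrightarrow> linear (F z)"
    "\<And>u. smooth_on (ball 0 r) (\<lambda>z. F z u)" "\<And>u. F 0 u = 0"
    "\<And>z u. z \<in> ball 0 r \<Longrightarrow> P (F z u) = 0"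
    "\<And>z v. z \<in> ball 0 r \<Longrightarrow> v \<in> B z ` range P \<longleftrightarrow> v = P v + F z (P v)"
proof -
  note bP = bounded_linear
  define M where "M z w = w - P w + P (B z (P w))" for z w
  have idl: "Ck_on m T (\<lambda>w::'a. w)" for m T by (rule Ck_on_bounded_linear) (rule bounded_linear_ident)
  have Mlin: "linear (M z)" if "z \<in> S" for z
    unfolding M_def using linear lin[OF that]
    by (simp add: linear_iff algebra_simps)
  have MS: "smooth_on S (\<lambda>z. M z w)" for w
    unfolding M_def
    by (intro smooth_onI Ck_on_add Ck_on_const S(1) Ck_on_linear_image[OF S(1) bP] smooth_on_Ck[OF smooth])
  have M0: "M 0 w = w" for w by (simp add: M_def B0)
  obtain r N where r: "r > 0" "ball 0 r \<subseteq> S" and N: "\<And>z. z \<in> ball 0 r \<Longrightarrow> linear (N z)"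
    "\<And>z w. z \<in> ball 0 r \<Longrightarrow> M z (N z w) = w" "\<And>z w. z \<in> ball 0 r \<Longrightarrow> N z (M z w) = w"
    "\<And>w. smooth_on (ball 0 r) (\<lambda>z. N z w)"
    by (rule smooth_linear_inverse[OF S Mlin MS M0]) blast+
  define F where "F z u = B z (N z (P u)) - P (B z (N z (P u)))" for z u
  have PN: "P (N z (P u)) = N z (P u)" "P (B z (N z (P u))) = P u" if z: "z \<in> ball 0 r" for z u
  proof -
    let ?c = "N z (P u)"
    have e: "?c - P ?c + P (B z (P ?c)) = P u" using N(2)[OF z, of "P u"] by (simp add: M_def)
    then have "P (?c - P ?c + P (B z (P ?c))) = P (P u)" by (rule arg_cong)
    then have e2: "P (B z (P ?c)) = P u" by (simp add: linear_add[OF linear] linear_diff[OF linear])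
    then show "P ?c = ?c" using e by simp
    then show "P (B z ?c) = P u" using e2 by simp
  qed
  have Blin: "linear (B z)" if "z \<in> ball 0 r" for z using lin r(2) that by blast
  show thesis
  proof (rule that[of r F])
    show "linear (F z)" if "z \<in> ball 0 r" for z
      unfolding F_def using linear Blin[OF that] N(1)[OF that] by (simp add: linear_iff algebra_simps)
    show "smooth_on (ball 0 r) (\<lambda>z. F z u)" for u
    proof -
      have "Ck_on m (ball 0 r) (\<lambda>z. B z (N z (P u)))" for m
        by (rule Ck_on_linear_apply[where A=B, OF open_ball Blin Ck_on_subset[OF smooth_on_Ck[OF smooth] r(2)]
            smooth_on_Ck[OF N(4)]])
      then show ?thesis unfolding F_def
        by (intro smooth_onI Ck_on_diff open_ball Ck_on_linear_image[OF open_ball bP])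
    qed
    show "P (F z u) = 0" for z u by (simp add: F_def linear_diff[OF linear])
    show "F 0 u = 0" for u
      using PN[of 0 u] r(1) by (simp add: F_def B0)
    show "v \<in> B z ` range P \<longleftrightarrow> v = P v + F z (P v)" if z: "z \<in> ball 0 r" for z v
    proof
      assume "v \<in> B z ` range P"
      then obtain c where c: "v = B z c" "P c = c" by auto
      then have "M z c = P v" by (simp add: M_def)
      then have "N z (P v) = c" using N(3)[OF z, of c] by simp
      then show "v = P v + F z (P v)" by (simp add: F_def c(1)[symmetric])
    next
      assume "v = P v + F z (P v)"
      then have "v = B z (N z (P v))" using PN(2)[OF z, of v] by (simp add: F_def)
      moreover have "N z (P v) \<in> range P" using PN(1)[OF z, of v] by (metis rangeI)
      ultimately show "v \<in> B z ` range P" by blast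
    qed
  qed (use r in auto)
qed

section \<open>A Poincare lemma relative to a foliation\<close>

definition closed_two_form :: "'a::euclidean_space set \<Rightarrow> ('a \<Rightarrow> 'a \<Rightarrow> 'a \<Rightarrow> real) \<Rightarrow> bool" where
  "closed_two_form Z \<Omega> \<longleftrightarrow>
     (\<forall>z\<in>Z. bilinear (\<Omega> z) \<and> (\<forall>a b. \<Omega> z a b = - \<Omega> z b a)) \<and>
     (\<forall>a b. smooth_on Z (\<lambda>z. \<Omega> z a b)) \<and>
     (\<forall>z\<in>Z. \<forall>a b c. deriv_along (\<lambda>z. \<Omega> z b c) z a - deriv_along (\<lambda>z. \<Omega> z a c) z b
        + deriv_along (\<lambda>z. \<Omega> z a b) z c = 0)"

lemma closed_two_formD:
  assumes "closed_two_form Z \<Omega>"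
  shows "z \<in> Z \<Longrightarrow> linear (\<Omega> z a)" "z \<in> Z \<Longrightarrow> linear (\<lambda>a. \<Omega> z a b)"
    "z \<in> Z \<Longrightarrow> \<Omega> z a b = - \<Omega> z b a" "smooth_on Z (\<lambda>z. \<Omega> z a b)"
    "z \<in> Z \<Longrightarrow> deriv_along (\<lambda>z. \<Omega> z b c) z a - deriv_along (\<lambda>z. \<Omega> z a c) z b
        + deriv_along (\<lambda>z. \<Omega> z a b) z c = 0"
  using assms unfolding closed_two_form_def bilinear_def by blast+

lemma Ck_on_form:
  assumes "open Z" "closed_two_form Z \<Omega>"
  shows "Ck_on m (Z \<times> UNIV \<times> UNIV) (\<lambda>(x, u, v). \<Omega> x u v)"
proof -
  note \<Omega> = closed_two_formD[OF assms(2)]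
  have o: "open (Z \<times> UNIV \<times> UNIV :: ('a \<times> 'a \<times> 'a) set)" using assms(1) by (intro open_Times) auto
  have l: "bounded_linear (fst :: 'a \<times> 'a \<times> 'a \<Rightarrow> 'a)" "bounded_linear (\<lambda>q :: 'a \<times> 'a \<times> 'a. fst (snd q))"
    "bounded_linear (\<lambda>q :: 'a \<times> 'a \<times> 'a. snd (snd q))"
    by (auto intro!: bounded_linear_intros)
  have base: "Ck_on m (Z \<times> UNIV \<times> UNIV) (\<lambda>q :: 'a \<times> 'a \<times> 'a. \<Omega> (fst q) u v)" for u v
    by (rule Ck_on_compose[OF o assms(1) Ck_on_bounded_linear[OF l(1)] smooth_on_Ck[OF \<Omega>(4)]]) auto
  have base2: "Ck_on m (Z \<times> UNIV \<times> UNIV) (\<lambda>q :: 'a \<times> 'a \<times> 'a. \<Omega> (fst q) u (snd (snd q)))" for u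
    by (rule Ck_on_linear_apply[OF o, where A="\<lambda>q. \<Omega> (fst q) u", OF _ base Ck_on_bounded_linear[OF l(3)]])
      (use \<Omega>(1) in auto)
  have "Ck_on m (Z \<times> UNIV \<times> UNIV) (\<lambda>q :: 'a \<times> 'a \<times> 'a. \<Omega> (fst q) (fst (snd q)) (snd (snd q)))"
    by (rule Ck_on_linear_apply[OF o, where A="\<lambda>q u. \<Omega> (fst q) u (snd (snd q))", OF _ base2
      Ck_on_bounded_linear[OF l(2)]])
      (use \<Omega>(2) in auto)
  then show ?thesis by (simp only: case_prod_unfold)
qed

text \<open>The product rule for a form evaluated along a moving point on moving vectors: \<open>\<Omega>\<close> is linear in
  each vector, so two applications of \<open>linear_apply_has_derivative\<close> suffice.\<close>

lemma form_compose_has_derivative: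
  assumes "open Z" "closed_two_form Z \<Omega>" "x t \<in> Z"
    and x: "(x has_derivative x') (at t)" and u: "(u has_derivative u') (at t)" and v:
      "(v has_derivative v') (at t)"
  shows "((\<lambda>t. \<Omega> (x t) (u t) (v t)) has_derivative
    (\<lambda>h. deriv_along (\<lambda>z. \<Omega> z (u t) (v t)) (x t) (x' h) + \<Omega> (x t) (u' h) (v t) + \<Omega> (x t) (u t) (v' h))) (at t)"
proof -
  note \<Omega> = closed_two_formD[OF assms(2)]
  let ?A = "\<lambda>q u. \<Omega> (fst q) u (snd q)"
  have o: "open (Z \<times> UNIV :: ('a \<times> 'a) set)" using assms(1) by (intro open_Times) auto
  have l: "bounded_linear (fst :: 'a \<times> 'a \<Rightarrow> 'a)" "bounded_linear (snd :: 'a \<times> 'a \<Rightarrow> 'a)"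
    by (auto intro!: bounded_linear_intros)
  have "Ck_on (Suc 0) (Z \<times> UNIV) (\<lambda>q :: 'a \<times> 'a. (\<lambda>(x, u, v). \<Omega> x u v) (fst q, w, snd q))" for w
  proof (rule Ck_on_compose[OF o open_Times[OF assms(1) open_Times[OF open_UNIV open_UNIV]] _ Ck_on_form[OF
    assms(1,2)]])
    show "Ck_on (Suc 0) (Z \<times> UNIV) (\<lambda>q :: 'a \<times> 'a. (fst q, w, snd q))"
      by (intro Ck_on_Pair o Ck_on_bounded_linear l Ck_on_const)
  qed auto
  then have sm: "Ck_on (Suc 0) (Z \<times> UNIV) (\<lambda>q. ?A q w)" for w by simp
  have "((\<lambda>q. \<Omega> (fst q) (u t) (snd q)) has_derivative
    (\<lambda>h. deriv_along (\<lambda>z. \<Omega> z (u t) (v t)) (x t) (fst h) + \<Omega> (x t) (u t) (snd h))) (at (x t, v t))"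
    using linear_apply_has_derivative[of Z "\<lambda>z. \<Omega> z (u t)" fst "(x t, v t)" fst snd snd,
      OF assms(1) \<Omega>(1) smooth_on_Ck[OF \<Omega>(4)] _ l[THEN bounded_linear_imp_has_derivative]] assms(3) by simp
  from deriv_along_eq[OF this]
  have D: "deriv_along (\<lambda>q. ?A q (u t)) (x t, v t) (x' h, v' h)
    = deriv_along (\<lambda>z. \<Omega> z (u t) (v t)) (x t) (x' h) + \<Omega> (x t) (u t) (v' h)" for h by simp
  have "((\<lambda>t. ?A (x t, v t) (u t)) has_derivative
    (\<lambda>h. deriv_along (\<lambda>q. ?A q (u t)) (x t, v t) (x' h, v' h) + ?A (x t, v t) (u' h))) (at t)"
    by (rule linear_apply_has_derivative[OF o _ sm _ has_derivative_Pair[OF x v] u]) (use \<Omega>(2) assms(3) in auto)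
  then show ?thesis unfolding D by (simp add: add_ac)
qed

text \<open>The linear homotopy from the complementary projection to the identity. By closedness the
  integrand of the exterior derivative of the homotopy primitive is the \<open>s\<close>-derivative of the pulled
  back form.\<close>

lemma (in orth_projection) homotopy_primitive:
  fixes \<Omega> :: "'a \<Rightarrow> 'a \<Rightarrow> 'a \<Rightarrow> real"
  defines "\<theta> z b \<equiv> integral {0..1} (\<lambda>s. \<Omega> (rad s z) (P z) (rad s b))"
  assumes \<Omega>: "closed_two_form (ball 0 r) \<Omega>"
  shows "smooth_on (ball 0 r) (\<lambda>z. \<theta> z b)"
    and "z \<in> ball 0 r \<Longrightarrow> linear (\<theta> z)"
    and "z \<in> ball 0 r \<Longrightarrow> deriv_along (\<lambda>z. \<theta> z b) z a - deriv_along (\<lambda>z. \<theta> z a) z b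
      = \<Omega> z a b - \<Omega> (z - P z) (a - P a) (b - P b)"
proof -
  let ?Z = "ball (0::'a) r"
  note \<Omega>' = closed_two_formD[OF \<Omega>]
  note bP = bounded_linear
  define O1 where "O1 = (\<lambda>q :: real \<times> 'a. rad (fst q) (snd q)) -` ?Z"
  have o: "open O1" unfolding O1_def by (rule open_vimage) (auto intro!: continuous_intros)
  have sub: "{0..1} \<times> ?Z \<subseteq> O1" using rad_in_ball[of _ _ r] by (auto simp: O1_def)
  define f where "f b = (\<lambda>q :: real \<times> 'a. \<Omega> (rad (fst q) (snd q)) (P (snd q)) (rad (fst q) b))" for b
  have l: "bounded_linear (fst :: real \<times> 'a \<Rightarrow> real)" "bounded_linear (snd :: real \<times> 'a \<Rightarrow> 'a)"
    by (auto intro!: bounded_linear_intros)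
  have oZ: "open (?Z \<times> UNIV \<times> UNIV :: ('a \<times> 'a \<times> 'a) set)" by (intro open_Times) auto
  have fS: "Ck_on m O1 (f b)" for m b
  proof -
    have g: "Ck_on m O1 (\<lambda>q. (rad (fst q) (snd q), P (snd q), rad (fst q) b))"
      by (intro Ck_on_Pair o Ck_on_rad Ck_on_linear_image[OF o bP] Ck_on_bounded_linear l Ck_on_const)
    have "Ck_on m O1 (\<lambda>q. (\<lambda>(x, u, v). \<Omega> x u v) (rad (fst q) (snd q), P (snd q), rad (fst q) b))"
      by (rule Ck_on_compose[OF o oZ g Ck_on_form[OF open_ball \<Omega>]]) (auto simp: O1_def)
    then show ?thesis by (simp add: f_def)
  qed
  have \<theta>: "\<theta> z b = integral {0..1} (\<lambda>s. f b (s, z))" for z b by (simp add: \<theta>_def f_def)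
  show sm: "smooth_on ?Z (\<lambda>z. \<theta> z b)" for b
    unfolding \<theta> by (intro smooth_onI Ck_on_integral[OF open_ball sub] fS)
  have fc: "continuous_on {0..1} (\<lambda>s. f b (s, z))" if "z \<in> ?Z" for b z
    by (rule continuous_on_compose2[OF Ck_on_continuous[OF fS[of 0]]])
      (use sub that in \<open>auto intro!: continuous_intros\<close>)
  show "linear (\<theta> z)" if z: "z \<in> ?Z"
  proof (rule linearI)
    have rz: "rad s z \<in> ?Z" if "s \<in> {0..1}" for s by (rule rad_in_ball[OF that z])
    show "\<theta> z (b + c) = \<theta> z b + \<theta> z c" for b c
    proof -
      have "integral {0..1} (\<lambda>s. f (b + c) (s, z)) = integral {0..1} (\<lambda>s. f b (s, z) + f c (s, z))"
        by (rule integral_cong) (simp add: f_def linear_add[OF linear_rad] linear_add[OF \<Omega>'(1)[OF rz]])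
      then show ?thesis unfolding \<theta>
        using fc[OF z] by (simp add: integral_add integrable_continuous_real)
    qed
    show "\<theta> z (c *\<^sub>R b) = c *\<^sub>R \<theta> z b" for b c
    proof -
      have "integral {0..1} (\<lambda>s. f (c *\<^sub>R b) (s, z)) = integral {0..1} (\<lambda>s. c *\<^sub>R f b (s, z))"
        by (rule integral_cong) (simp add: f_def linear_scale[OF linear_rad] linear_scale[OF \<Omega>'(1)[OF rz]])
      then show ?thesis unfolding \<theta> by simp
    qed
  qed
  show "deriv_along (\<lambda>z. \<theta> z b) z a - deriv_along (\<lambda>z. \<theta> z a) z b
      = \<Omega> z a b - \<Omega> (z - P z) (a - P a) (b - P b)" if z: "z \<in> ?Z"
  proof -
    have rz: "rad s z \<in> ?Z" if "s \<in> {0..1}" for s by (rule rad_in_ball[OF that z])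
    have D\<theta>: "deriv_along (\<lambda>z. \<theta> z b) z a = integral {0..1} (\<lambda>s. deriv_along (f b) (s, z) (0, a))" for a b
      unfolding \<theta> by (rule deriv_along_eq[OF has_derivative_integral_param[OF open_ball sub fS z]])
    have Df: "deriv_along (f b) (s, z) (0, a) = deriv_along (\<lambda>z. \<Omega> z (P z0) (rad s b)) (rad s z) (rad s a)
      + \<Omega> (rad s z) (P a) (rad s b)" if s: "s \<in> {0..1}" and z0: "z0 = z" for s a b z0
    proof -
      have fd: "(f b has_derivative deriv_along (f b) (s, z)) (at (s, z))"
        using Ck_on_has_derivative[OF fS[of "Suc 0"]] sub s z by blast
      have "((\<lambda>z. (s, z)) has_derivative (\<lambda>h. (0, h))) (at z)"
        by (intro has_derivative_Pair has_derivative_const has_derivative_ident)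
      from has_derivative_compose[OF this fd]
      have 1: "((\<lambda>z. \<Omega> (rad s z) (P z) (rad s b)) has_derivative (\<lambda>h. deriv_along (f b) (s, z) (0, h))) (at z)"
        by (simp add: f_def)
      have "bounded_linear (rad s)" using linear_rad linear_conv_bounded_linear by blast
      from form_compose_has_derivative[OF open_ball \<Omega> rz[OF s] bounded_linear_imp_has_derivative[OF this]
          bounded_linear_imp_has_derivative[OF bP] has_derivative_const]
      have 2: "((\<lambda>z. \<Omega> (rad s z) (P z) (rad s b)) has_derivative (\<lambda>h. deriv_along (\<lambda>y. \<Omega> y (P z) (rad s b))
        (rad s z) (rad s h)
        + \<Omega> (rad s z) (P h) (rad s b) + \<Omega> (rad s z) (P z) 0)) (at z)" .
      have "\<Omega> (rad s z) (P z) 0 = 0" by (rule linear_0[OF \<Omega>'(1)[OF rz[OF s]]])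
      then show ?thesis using fun_cong[OF has_derivative_unique[OF 1 2], of a] z0 by simp
    qed
    have Dfc: "continuous_on {0..1} (\<lambda>s. deriv_along (f b) (s, z) (0, a))" for a b
    proof (rule continuous_on_compose2[where g="\<lambda>q. deriv_along (f b) q (0, a)" and f="\<lambda>s. (s, z)"])
      have "Ck_on 0 O1 (\<lambda>q. deriv_along (f b) q (0, a))" using fS[of "Suc 0" b] unfolding Ck_on.simps by blast
      then show "continuous_on O1 (\<lambda>q. deriv_along (f b) q (0, a))" by simp
    qed (use sub z in \<open>auto intro!: continuous_intros\<close>)
    let ?g = "\<lambda>s. \<Omega> (rad s z) (rad s a) (rad s b)"
    have "(?g has_vector_derivative (deriv_along (f b) (s, z) (0, a) - deriv_along (f a) (s, z) (0, b))) (at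
      s within {0..1})"
      if s: "s \<in> {0..1}" for s
    proof -
      have rd: "((\<lambda>s. rad s y) has_derivative (\<lambda>h. h *\<^sub>R P y)) (at s)" for y
        using rad_has_vector_derivative by (simp add: has_vector_derivative_def)
      from form_compose_has_derivative[OF open_ball \<Omega> rz[OF s] rd rd rd]
      have g: "(?g has_derivative (\<lambda>h. deriv_along (\<lambda>y. \<Omega> y (rad s a) (rad s b)) (rad s z) (h *\<^sub>R P z)
        + \<Omega> (rad s z) (h *\<^sub>R P a) (rad s b) + \<Omega> (rad s z) (rad s a) (h *\<^sub>R P b))) (at s)" .
      have cl: "deriv_along (\<lambda>y. \<Omega> y (rad s a) (rad s b)) (rad s z) (P z)
        = deriv_along (\<lambda>y. \<Omega> y (P z) (rad s b)) (rad s z) (rad s a)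
        - deriv_along (\<lambda>y. \<Omega> y (P z) (rad s a)) (rad s z) (rad s b)"
        using \<Omega>'(5)[OF rz[OF s], of "rad s a" "rad s b" "P z"] by simp
      have "deriv_along (\<lambda>y. \<Omega> y (rad s a) (rad s b)) (rad s z) (h *\<^sub>R P z)
        + \<Omega> (rad s z) (h *\<^sub>R P a) (rad s b) + \<Omega> (rad s z) (rad s a) (h *\<^sub>R P b)
        = h *\<^sub>R (deriv_along (f b) (s, z) (0, a) - deriv_along (f a) (s, z) (0, b))" for h
      proof -
        have "\<Omega> (rad s z) (rad s a) (P b) = - \<Omega> (rad s z) (P b) (rad s a)" by (rule \<Omega>'(3)[OF rz[OF s]])
        then show ?thesis
          unfolding Df[OF s refl] linear_scale[OF smooth_on_linear_deriv[OF \<Omega>'(4) rz[OF s]]]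
            linear_scale[OF \<Omega>'(1)[OF rz[OF s]]] linear_scale[OF \<Omega>'(2)[OF rz[OF s]]] cl
          by (simp add: algebra_simps)
      qed
      then have "(?g has_vector_derivative (deriv_along (f b) (s, z) (0, a) - deriv_along (f a) (s, z) (0,
        b))) (at s)"
        using g by (simp add: has_vector_derivative_def)
      then show ?thesis by (rule has_vector_derivative_at_within)
    qed
    from fundamental_theorem_of_calculus[OF _ this]
    have "integral {0..1} (\<lambda>s. deriv_along (f b) (s, z) (0, a) - deriv_along (f a) (s, z) (0, b)) = ?g 1 - ?g 0"
      by (auto intro: integral_unique)
    moreover have "?g 1 = \<Omega> z a b" "?g 0 = \<Omega> (z - P z) (a - P a) (b - P b)" by (simp_all add: rad_def)
    ultimately show ?thesis
      unfolding D\<theta> using Dfc by (simp add: integral_diff integrable_continuous_real)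
  qed
qed

lemma orth_projection_id: "orth_projection (\<lambda>z. z)"
  by unfold_locales (auto intro: linear_id[unfolded id_def])

lemma (in orth_projection) compl_in_ball: "z \<in> ball 0 r \<Longrightarrow> z - P z \<in> ball 0 r"
  using norm_compl[of z] by auto

text \<open>The homotopy contracts the leaves of \<open>range P\<close> first and then the transversal \<open>range (id - P)\<close>; both
  primitives vanish on the leaves.\<close>

theorem (in orth_projection) relative_poincare:
  fixes \<Omega> :: "'a \<Rightarrow> 'a \<Rightarrow> 'a \<Rightarrow> real"
  assumes \<Omega>: "closed_two_form (ball 0 r) \<Omega>"
    and iso: "\<And>z u v. \<lbrakk>z \<in> ball 0 r; P u = u; P v = v\<rbrakk> \<Longrightarrow> \<Omega> z u v = 0"
  obtains \<theta> where "\<And>b. smooth_on (ball 0 r) (\<lambda>z. \<theta> z b)" "\<And>z. z \<in> ball 0 r \<Longrightarrow> linear (\<theta> z)"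
    "\<And>z u. \<lbrakk>z \<in> ball 0 r; P u = u\<rbrakk> \<Longrightarrow> \<theta> z u = 0"
    "\<And>z a b. z \<in> ball 0 r \<Longrightarrow> deriv_along (\<lambda>z. \<theta> z b) z a - deriv_along (\<lambda>z. \<theta> z a) z b = \<Omega> z a b"
proof -
  let ?Z = "ball (0::'a) r"
  note \<Omega>' = closed_two_formD[OF \<Omega>]
  define \<Omega>0 where "\<Omega>0 z a b = \<Omega> (z - P z) (a - P a) (b - P b)" for z a b
  have bQ: "bounded_linear (\<lambda>z. z - P z)" using bounded_linear
    by (intro bounded_linear_sub bounded_linear_ident)
  have \<Omega>0: "closed_two_form ?Z \<Omega>0"
    unfolding closed_two_form_def
  proof (intro conjI ballI allI)
    fix z assume z: "z \<in> ?Z"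
    note Qz = compl_in_ball[OF z]
    have lQ: "linear (\<lambda>z. z - P z)" using bQ by (rule bounded_linear.linear)
    show "bilinear (\<Omega>0 z)"
      unfolding bilinear_def \<Omega>0_def
      using linear_compose[OF lQ \<Omega>'(1)[OF Qz]] linear_compose[OF lQ \<Omega>'(2)[OF Qz]] by (auto simp: o_def)
    show "\<Omega>0 z a b = - \<Omega>0 z b a" for a b unfolding \<Omega>0_def by (rule \<Omega>'(3)[OF Qz])
    have D: "deriv_along (\<lambda>z. \<Omega>0 z b c) z a = deriv_along (\<lambda>z. \<Omega> z (b - P b) (c - P c)) (z - P z) (a - P a)"
      for a b c
      unfolding \<Omega>0_def
      by (rule deriv_along_eq[OF has_derivative_compose[OF bounded_linear_imp_has_derivative[OF bQ]
              smooth_on_has_derivative[OF \<Omega>'(4) Qz]]])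
    show "deriv_along (\<lambda>z. \<Omega>0 z b c) z a - deriv_along (\<lambda>z. \<Omega>0 z a c) z b + deriv_along (\<lambda>z. \<Omega>0 z a b) z c
      = 0" for a b c
      unfolding D by (rule \<Omega>'(5)[OF Qz])
  next
    show "smooth_on ?Z (\<lambda>z. \<Omega>0 z a b)" for a b
      unfolding \<Omega>0_def
      by (rule smooth_on_compose[OF open_ball open_ball smooth_onI[OF Ck_on_bounded_linear[OF bQ]] \<Omega>'(4)])
        (use compl_in_ball in blast)
  qed
  define \<theta>1 where "\<theta>1 z b = integral {0..1} (\<lambda>s. \<Omega> (rad s z) (P z) (rad s b))" for z b
  define \<theta>2 where "\<theta>2 z b = integral {0..1} (\<lambda>s. \<Omega>0 (orth_projection.rad (\<lambda>z. z) s z) z (orth_projection.rad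
    (\<lambda>z. z) s b))" for z b
  note h1 = homotopy_primitive[OF \<Omega>, folded \<theta>1_def]
  note h2 = orth_projection.homotopy_primitive[OF orth_projection_id \<Omega>0, folded \<theta>2_def]
  have P0: "P 0 = 0" by (rule linear_0[OF linear])
  show thesis
  proof (rule that[of "\<lambda>z b. \<theta>1 z b + \<theta>2 z b"])
    show "smooth_on ?Z (\<lambda>z. \<theta>1 z b + \<theta>2 z b)" for b
      by (intro smooth_onI Ck_on_add open_ball smooth_on_Ck[OF h1(1)] smooth_on_Ck[OF h2(1)])
    show "linear (\<lambda>b. \<theta>1 z b + \<theta>2 z b)" if "z \<in> ?Z" for z
      by (rule linear_compose_add[OF h1(2)[OF that] h2(2)[OF that]])
    fix z assume z: "z \<in> ?Z"
    show "\<theta>1 z u + \<theta>2 z u = 0" if u: "P u = u" for u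
    proof -
      have "\<theta>1 z u = integral {0..1::real} (\<lambda>s. 0)"
        unfolding \<theta>1_def using rad_in_ball[OF _ z]
        by (intro integral_cong iso) (auto simp: P_rad u rad_def linear_scale[OF linear])
      moreover have "\<theta>2 z u = integral {0..1::real} (\<lambda>s. 0)"
        unfolding \<theta>2_def
      proof (rule integral_cong)
        fix s :: real assume s: "s \<in> {0..1}"
        let ?z = "s *\<^sub>R z"
        have "?z \<in> ?Z" using orth_projection.rad_in_ball[OF orth_projection_id s z]
          by (simp add: orth_projection.rad_def[OF orth_projection_id])
        then have "linear (\<Omega> (?z - P ?z) (z - P z))" by (intro \<Omega>'(1) compl_in_ball)
        then show "\<Omega>0 (orth_projection.rad (\<lambda>z. z) s z) z (orth_projection.rad (\<lambda>z. z) s u) = 0"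
          by (simp add: \<Omega>0_def orth_projection.rad_def[OF orth_projection_id] linear_scale[OF linear] u
            linear_0)
      qed
      ultimately show ?thesis by simp
    qed
    have sum: "deriv_along (\<lambda>z. \<theta>1 z b + \<theta>2 z b) z a = deriv_along (\<lambda>z. \<theta>1 z b) z a + deriv_along (\<lambda>z. \<theta>2 z
      b) z a" for a b
      by (rule deriv_along_eq[OF has_derivative_add[OF smooth_on_has_derivative[OF h1(1) z]
        smooth_on_has_derivative[OF h2(1) z]]])
    show "deriv_along (\<lambda>z. \<theta>1 z b + \<theta>2 z b) z a - deriv_along (\<lambda>z. \<theta>1 z a + \<theta>2 z a) z b = \<Omega> z a b" for a b
    proof -
      have "r > 0" using z norm_ge_zero by (metis dist_0_norm le_less_trans mem_ball)
      then have "\<Omega> 0 0 0 = 0" using linear_0[OF \<Omega>'(1)[of 0]] by simp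
      then show ?thesis
        unfolding sum using h1(3)[OF z, of b a] h2(3)[OF z, of b a] by (simp add: \<Omega>0_def P0)
    qed
  qed
qed

section \<open>Charts and tangent vectors\<close>

context
  fixes X :: "'a topology" and c :: "('a, 'e::euclidean_space) chart"
  assumes c: "chart_on X c"
begin

lemma chart_dom_subset: "fst c \<subseteq> topspace X"
  using c openin_subset by (auto simp: chart_on_def)

lemma chart_inj_on: "inj_on (snd c) (fst c)"
  using c chart_dom_subset homeomorphic_imp_injective_map[of "subtopology X (fst c)" _ "snd c"]
  by (auto simp: chart_on_def topspace_subtopology Int_absorb1)

lemma chart_inv_eq: "y \<in> fst c \<Longrightarrow> chart_inv c (snd c y) = y"
  unfolding chart_inv_def by (rule inv_into_f_f[OF chart_inj_on])

lemma chart_inv_in: "z \<in> snd c ` fst c \<Longrightarrow> chart_inv c z \<in> fst c"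
  unfolding chart_inv_def by (rule inv_into_into)

lemma chart_eq_inv: "z \<in> snd c ` fst c \<Longrightarrow> snd c (chart_inv c z) = z"
  unfolding chart_inv_def by (rule f_inv_into_f)

lemma open_chart_image:
  assumes "openin X W"
  shows "open (snd c ` (fst c \<inter> W))"
proof -
  have h: "homeomorphic_map (subtopology X (fst c)) (top_of_set (snd c ` fst c)) (snd c)"
    and o: "open (snd c ` fst c)" using c by (auto simp: chart_on_def)
  have "openin (subtopology X (fst c)) (fst c \<inter> W)"
    using assms by (auto simp: openin_subtopology)
  then have "openin (top_of_set (snd c ` fst c)) (snd c ` (fst c \<inter> W))"
    using homeomorphic_map_openness_eq[OF h] by blast
  then show ?thesis using o openin_open_eq by blast
qed

lemma openin_chart_preimage:
  assumes "open S"
  shows "openin X {y \<in> fst c. snd c y \<in> S}"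
proof -
  have h: "homeomorphic_map (subtopology X (fst c)) (top_of_set (snd c ` fst c)) (snd c)"
    and o: "openin X (fst c)" using c by (auto simp: chart_on_def)
  let ?W = "{y \<in> fst c. snd c y \<in> S}"
  have "snd c ` ?W = snd c ` fst c \<inter> S" by auto
  then have "openin (top_of_set (snd c ` fst c)) (snd c ` ?W)"
    using assms by (auto simp: openin_open)
  then have "openin (subtopology X (fst c)) ?W"
    using homeomorphic_map_openness[OF h, of ?W] chart_dom_subset by (auto simp: topspace_subtopology)
  then show ?thesis using o by (simp add: openin_open_subtopology)
qed

end

definition recoordinate :: "('a, 'e) chart \<Rightarrow> 'e set \<Rightarrow> ('e \<Rightarrow> 'f) \<Rightarrow> ('a, 'f) chart" where
  "recoordinate c S f = ({y \<in> fst c. snd c y \<in> S}, f \<circ> snd c)"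

lemma recoordinate_image:
  "S \<subseteq> snd c ` fst c \<Longrightarrow> snd (recoordinate c S f) ` fst (recoordinate c S f) = f ` S"
  by (force simp: recoordinate_def)

lemma chart_on_recoordinate:
  assumes c: "chart_on X c" and S: "open S" "S \<subseteq> snd c ` fst c"
    and f: "smooth_on S f" "open (f ` S)" and g: "smooth_on (f ` S) g" "\<And>z. z \<in> S \<Longrightarrow> g (f z) = z"
  shows "chart_on X (recoordinate c S f)"
  unfolding chart_on_def
proof (intro conjI)
  let ?W = "{y \<in> fst c. snd c y \<in> S}"
  show "openin X (fst (recoordinate c S f))"
    unfolding recoordinate_def fst_conv by (rule openin_chart_preimage[OF c S(1)])
  have im: "snd (recoordinate c S f) ` fst (recoordinate c S f) = f ` S" by (rule recoordinate_image[OF S(2)])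
  show "open (snd (recoordinate c S f) ` fst (recoordinate c S f))" unfolding im by (rule f(2))
  have h: "homeomorphic_map (subtopology X (fst c)) (top_of_set (snd c ` fst c)) (snd c)"
    using c by (auto simp: chart_on_def)
  have "homeomorphic_map (subtopology (subtopology X (fst c)) ?W) (subtopology (top_of_set (snd c ` fst c))
    S) (snd c)"
    by (rule homeomorphic_map_subtopologies[OF h])
      (use chart_dom_subset[OF c] in \<open>auto simp: topspace_subtopology\<close>)
  moreover have "subtopology (subtopology X (fst c)) ?W = subtopology X ?W"
    by (simp add: subtopology_subtopology Int_absorb1 Collect_conj_eq)
  moreover have "subtopology (top_of_set (snd c ` fst c)) S = top_of_set S"
    using S(2) by (simp add: subtopology_subtopology Int_absorb1)
  ultimately have 1: "homeomorphic_map (subtopology X ?W) (top_of_set S) (snd c)" by simp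
  have "homeomorphic_maps (top_of_set S) (top_of_set (f ` S)) f g"
    unfolding homeomorphic_maps_def
    using Ck_on_continuous[OF smooth_on_Ck[OF f(1)]] Ck_on_continuous[OF smooth_on_Ck[OF g(1)]] g(2) by auto
  then have 2: "homeomorphic_map (top_of_set S) (top_of_set (f ` S)) f"
    using homeomorphic_map_maps by blast
  show "homeomorphic_map (subtopology X (fst (recoordinate c S f)))
     (top_of_set (snd (recoordinate c S f) ` fst (recoordinate c S f))) (snd (recoordinate c S f))"
    unfolding im unfolding recoordinate_def fst_conv snd_conv by (rule homeomorphic_map_compose[OF 1 2])
qed

lemma chart_inv_recoordinate:
  assumes c: "chart_on X c" and S: "S \<subseteq> snd c ` fst c" and g: "\<And>z. z \<in> S \<Longrightarrow> g (f z) = z" and "z \<in> S"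
  shows "chart_inv (recoordinate c S f) (f z) = chart_inv c z"
proof -
  let ?d = "recoordinate c S f"
  have y: "chart_inv c z \<in> fst ?d" "snd ?d (chart_inv c z) = f z"
    using chart_inv_in[OF c] chart_eq_inv[OF c] S assms(4) by (auto simp: recoordinate_def)
  have "inj_on (snd ?d) (fst ?d)"
  proof (rule inj_onI)
    fix y y' assume "y \<in> fst ?d" "y' \<in> fst ?d" "snd ?d y = snd ?d y'"
    then have "snd c y = snd c y'" "y \<in> fst c" "y' \<in> fst c" using g by (auto simp: recoordinate_def) metis
    then show "y = y'" using chart_inj_on[OF c] by (auto dest: inj_onD)
  qed
  then show ?thesis unfolding chart_inv_def[of ?d] using y inv_into_f_f by metis
qed

lemma smooth_on_cong:
  "open S \<Longrightarrow> (\<And>x. x \<in> S \<Longrightarrow> f x = g x) \<Longrightarrow> smooth_on S f \<Longrightarrow> smooth_on S g"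
  unfolding smooth_on_def using Ck_on_cong by blast

lemma smoothly_compatible_recoordinate:
  assumes c: "chart_on X c" and S: "open S" "S \<subseteq> snd c ` fst c"
    and f: "smooth_on S f" "open (f ` S)" and g: "smooth_on (f ` S) g" "\<And>z. z \<in> S \<Longrightarrow> g (f z) = z"
    and e: "chart_on X e" "smoothly_compatible e c"
  shows "smoothly_compatible e (recoordinate c S f)" "smoothly_compatible (recoordinate c S f) e"
proof -
  let ?d = "recoordinate c S f"
  have d: "chart_on X ?d" by (rule chart_on_recoordinate[OF c S f g])
  have oe: "openin X (fst e)" "openin X (fst c)" "openin X (fst ?d)" using e c d by (auto simp: chart_on_def)
  have ed: "fst ?d \<subseteq> fst c" by (auto simp: recoordinate_def)
  have 1: "smooth_on (snd e ` (fst e \<inter> fst ?d)) (transition e ?d)"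
  proof -
    have "smooth_on (snd e ` (fst e \<inter> fst ?d)) (\<lambda>w. f (transition e c w))"
    proof (rule smooth_on_compose[OF open_chart_image[OF e(1) oe(3)] S(1) _ f(1)])
      show "smooth_on (snd e ` (fst e \<inter> fst ?d)) (transition e c)"
        using e(2) ed by (auto simp: smoothly_compatible_def intro: smooth_on_subset)
      show "transition e c ` snd e ` (fst e \<inter> fst ?d) \<subseteq> S"
        by (auto simp: transition_def chart_inv_eq[OF e(1)] recoordinate_def)
    qed
    then show ?thesis
      by (rule smooth_on_cong[OF open_chart_image[OF e(1) oe(3)], rotated]) (simp add: transition_def
        recoordinate_def)
  qed
  have 2: "smooth_on (snd ?d ` (fst e \<inter> fst ?d)) (transition ?d e)"
  proof -
    have o: "open (snd ?d ` (fst e \<inter> fst ?d))" using open_chart_image[OF d oe(1)] by (simp add: Int_commute)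
    have "smooth_on (snd ?d ` (fst e \<inter> fst ?d)) (\<lambda>w. transition c e (g w))"
    proof (rule smooth_on_compose[OF o open_chart_image[OF c oe(1)]])
      show "smooth_on (snd ?d ` (fst e \<inter> fst ?d)) g"
        by (rule smooth_on_subset[OF g(1)]) (auto simp: recoordinate_def)
      show "smooth_on (snd c ` (fst c \<inter> fst e)) (transition c e)"
        using e(2) by (simp add: smoothly_compatible_def Int_commute)
      show "g ` snd ?d ` (fst e \<inter> fst ?d) \<subseteq> snd c ` (fst c \<inter> fst e)"
        using g(2) by (auto simp: recoordinate_def)
    qed
    then show ?thesis
    proof (rule smooth_on_cong[OF o, rotated])
      fix w assume "w \<in> snd ?d ` (fst e \<inter> fst ?d)"
      then obtain y where y: "w = f (snd c y)" "snd c y \<in> S" by (auto simp: recoordinate_def)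
      have "chart_inv ?d (f (snd c y)) = chart_inv c (snd c y)" by (rule chart_inv_recoordinate[where f=f
        and g=g, OF c S(2) g(2) y(2)])
      then show "transition c e (g w) = transition ?d e w"
        unfolding transition_def o_apply y(1) g(2)[OF y(2)] by simp
    qed
  qed
  show "smoothly_compatible e ?d" "smoothly_compatible ?d e"
    using 1 2 by (auto simp: smoothly_compatible_def Int_commute)
qed

lemma smooth_manifoldD:
  assumes "smooth_manifold X A"
  shows "c \<in> A \<Longrightarrow> chart_on X c" "\<lbrakk>c \<in> A; d \<in> A\<rbrakk> \<Longrightarrow> smoothly_compatible c d"
    "x \<in> topspace X \<Longrightarrow> \<exists>c\<in>A. x \<in> fst c"
    "\<lbrakk>chart_on X d; \<And>c. c \<in> A \<Longrightarrow> smoothly_compatible d c\<rbrakk> \<Longrightarrow> d \<in> A"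
  using assms unfolding smooth_manifold_def by blast+

text \<open>The atlas is maximal, hence closed under local diffeomorphisms of the model space. This makes the
  hypotheses on \<open>\<omega>\<close>, which speak about charts of the atlas, available in every chart that is
  built below with values in the model space, and no pullback of forms has to be computed.\<close>

lemma recoordinate_in_atlas:
  assumes M: "smooth_manifold X A" and c: "c \<in> A" and S: "open S" "S \<subseteq> snd c ` fst c"
    and f: "smooth_on S f" "open (f ` S)" and g: "smooth_on (f ` S) g" "\<And>z. z \<in> S \<Longrightarrow> g (f z) = z"
  shows "recoordinate c S f \<in> A"
proof (rule smooth_manifoldD(4)[OF M])
  note cX = smooth_manifoldD(1)[OF M c]
  show "chart_on X (recoordinate c S f)" by (rule chart_on_recoordinate[OF cX S f g])
  show "smoothly_compatible (recoordinate c S f) e" if "e \<in> A" for e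
    by (rule smoothly_compatible_recoordinate(2)[OF cX S f g smooth_manifoldD(1)[OF M that]
      smooth_manifoldD(2)[OF M that c]])
qed

lemma transition_has_derivative:
  assumes "chart_on X c" "chart_on X d" "smoothly_compatible c d" "x \<in> fst c" "x \<in> fst d"
  shows "(transition c d has_derivative deriv_along (transition c d) (snd c x)) (at (snd c x))"
proof (rule smooth_on_has_derivative)
  show "smooth_on (snd c ` (fst c \<inter> fst d)) (transition c d)" using assms(3)
    by (simp add: smoothly_compatible_def)
qed (use assms in auto)

text \<open>The chain rule for changes of charts; it also covers the cases where two of the charts agree.\<close>

lemma transition_deriv_compose:
  assumes cde: "chart_on X c" "chart_on X d" "chart_on X e"
    and comp: "smoothly_compatible c d" "smoothly_compatible d e"
    and x: "x \<in> fst c" "x \<in> fst d" "x \<in> fst e"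
  shows "deriv_along (transition c e) (snd c x) b
    = deriv_along (transition d e) (snd d x) (deriv_along (transition c d) (snd c x) b)"
proof (rule deriv_along_eq)
  have "transition c d (snd c x) = snd d x" by (simp add: transition_def chart_inv_eq[OF cde(1) x(1)])
  then have "(transition d e has_derivative deriv_along (transition d e) (snd d x)) (at (transition c d (snd
    c x)))"
    using transition_has_derivative[OF cde(2,3) comp(2) x(2,3)] by simp
  from has_derivative_compose[OF transition_has_derivative[OF cde(1,2) comp(1) x(1,2)] this]
  show "(transition c e has_derivative (\<lambda>b. deriv_along (transition d e) (snd d x) (deriv_along (transition
    c d) (snd c x) b))) (at (snd c x))"
  proof (rule has_derivative_transform_within_open)
    show "open (snd c ` (fst c \<inter> fst d))" using open_chart_image[OF cde(1)] cde(2) by (simp add: chart_on_def)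
    show "snd c x \<in> snd c ` (fst c \<inter> fst d)" using x by auto
    show "transition d e (transition c d w) = transition c e w" if "w \<in> snd c ` (fst c \<inter> fst d)" for w
      using that by (auto simp: transition_def chart_inv_eq[OF cde(1)] chart_inv_eq[OF cde(2)])
  qed
qed

lemma transition_deriv_self:
  assumes c: "chart_on X c" "x \<in> fst c"
  shows "deriv_along (transition c c) (snd c x) b = b"
proof (rule deriv_along_eq)
  show "(transition c c has_derivative (\<lambda>b. b)) (at (snd c x))"
  proof (rule has_derivative_transform_within_open[OF has_derivative_ident])
    show "open (snd c ` fst c)" using c by (simp add: chart_on_def)
  qed (use c in \<open>auto simp: transition_def chart_inv_eq[OF c(1)]\<close>)
qed

context
  fixes X :: "'a topology" and A :: "('a, 'e::euclidean_space) chart set"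
  assumes M: "smooth_manifold X A"
begin

lemma charts_atD: "c \<in> charts_at A x \<Longrightarrow> c \<in> A" "c \<in> charts_at A x \<Longrightarrow> x \<in> fst c"
  "c \<in> charts_at A x \<Longrightarrow> chart_on X c"
  using smooth_manifoldD(1)[OF M] by (auto simp: charts_at_def)

lemma tangent_transition:
  "v \<in> tangent_space A x \<Longrightarrow> c \<in> charts_at A x \<Longrightarrow> d \<in> charts_at A x \<Longrightarrow>
    v d = deriv_along (transition c d) (snd c x) (v c)"
  unfolding tangent_space_def mem_Collect_eq by blast

lemma tangent_eqI:
  assumes v: "v \<in> tangent_space A x" and w: "w \<in> tangent_space A x" and c: "c \<in> charts_at A x" and "v c = w c"
  shows "v = w"
proof
  fix d
  show "v d = w d"
  proof (cases "d \<in> charts_at A x")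
    case True
    then show ?thesis using tangent_transition[OF v c] tangent_transition[OF w c] assms(4) by simp
  next
    case False
    have "u d = 0" if "u \<in> tangent_space A x" for u
      using that False unfolding tangent_space_def mem_Collect_eq by blast
    from this[OF v] this[OF w] show ?thesis by simp
  qed
qed

lemma chart_vector_tangent:
  assumes c: "chart_on X c" "\<And>d. d \<in> A \<Longrightarrow> smoothly_compatible c d" "x \<in> fst c"
  shows "chart_vector A c x b \<in> tangent_space A x"
  unfolding tangent_space_def mem_Collect_eq
proof (intro conjI allI impI ballI)
  fix d e assume d: "d \<in> charts_at A x" and e: "e \<in> charts_at A x"
  show "chart_vector A c x b e = deriv_along (transition d e) (snd d x) (chart_vector A c x b d)"
    using transition_deriv_compose[OF c(1) charts_atD(3)[OF d] charts_atD(3)[OF e] c(2)[OF charts_atD(1)[OF d]]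
      smooth_manifoldD(2)[OF M charts_atD(1)[OF d] charts_atD(1)[OF e]] c(3) charts_atD(2)[OF d]
        charts_atD(2)[OF e]] d e
    by (simp add: chart_vector_def)
qed (simp add: chart_vector_def)

lemma chart_vector_in_tangent: "c \<in> charts_at A x \<Longrightarrow> chart_vector A c x b \<in> tangent_space A x"
  by (rule chart_vector_tangent) (use charts_atD smooth_manifoldD(2)[OF M] in blast)+

lemma chart_vector_self: "c \<in> charts_at A x \<Longrightarrow> chart_vector A c x b c = b"
  using transition_deriv_self[of X c x b] charts_atD[of c x] by (simp add: chart_vector_def)

lemma chart_vector_of_tangent:
  "c \<in> charts_at A x \<Longrightarrow> v \<in> tangent_space A x \<Longrightarrow> chart_vector A c x (v c) = v"
  by (rule tangent_eqI[OF chart_vector_in_tangent _ _ chart_vector_self])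

lemma linear_chart_vector:
  assumes c: "chart_on X c" "\<And>d. d \<in> A \<Longrightarrow> smoothly_compatible c d" "x \<in> fst c"
  shows "linear (chart_vector A c x)"
proof -
  have lin: "linear (deriv_along (transition c d) (snd c x))" if "d \<in> charts_at A x" for d
    using transition_has_derivative[OF c(1) charts_atD(3)[OF that] c(2)[OF charts_atD(1)[OF that]] c(3)
      charts_atD(2)[OF that]]
    by (rule has_derivative_linear)
  show ?thesis
    by (rule linearI)
      (auto simp: chart_vector_def fun_eq_iff scaleR_fun_def linear_add[OF lin] linear_scale[OF lin])
qed

lemma local_form_apply:
  assumes c: "c \<in> charts_at A y" and "v \<in> tangent_space A y" "w \<in> tangent_space A y"
  shows "local_form A \<omega> c (snd c y) (v c) (w c) = \<omega> y v w"
  using assms charts_atD[OF c]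
  by (simp add: local_form_def Let_def chart_inv_eq[of X] chart_vector_of_tangent)

lemma closed_two_form_local_form:
  assumes \<omega>: "two_form X A \<omega>" "closed_form A \<omega>" and c: "c \<in> A"
  shows "closed_two_form (snd c ` fst c) (local_form A \<omega> c)"
  unfolding closed_two_form_def
proof (intro conjI ballI allI)
  note cX = smooth_manifoldD(1)[OF M c]
  fix z assume z: "z \<in> snd c ` fst c"
  let ?x = "chart_inv c z"
  have cx: "c \<in> charts_at A ?x" using c chart_inv_in[OF cX z] by (simp add: charts_at_def)
  have "?x \<in> topspace X" using chart_inv_in[OF cX z] chart_dom_subset[OF cX] by blast
  then have lin: "\<omega> ?x (r *\<^sub>R u + s *\<^sub>R v) w = r * \<omega> ?x u w + s * \<omega> ?x v w"
    and anti: "\<omega> ?x u v = - \<omega> ?x v u"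
    if "u \<in> tangent_space A ?x" "v \<in> tangent_space A ?x" "w \<in> tangent_space A ?x" for u v w r s
    using \<omega>(1) that unfolding two_form_def Let_def by blast+
  have cv: "chart_vector A c ?x b \<in> tangent_space A ?x" for b by (rule chart_vector_in_tangent[OF cx])
  have lc: "local_form A \<omega> c z a b = \<omega> ?x (chart_vector A c ?x a) (chart_vector A c ?x b)" for a b
    by (simp add: local_form_def Let_def)
  show anti': "local_form A \<omega> c z a b = - local_form A \<omega> c z b a" for a b
    unfolding lc by (rule anti[OF cv cv cv])
  have lcv: "linear (chart_vector A c ?x)"
    by (rule linear_chart_vector[OF cX smooth_manifoldD(2)[OF M c] charts_atD(2)[OF cx]])
  have l1: "linear (\<lambda>a. local_form A \<omega> c z a b)" for b
  proof (rule linearI)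
    show "local_form A \<omega> c z (a + a') b = local_form A \<omega> c z a b + local_form A \<omega> c z a' b" for a a'
      unfolding lc linear_add[OF lcv] using lin[OF cv cv cv, of 1 a 1 a' b] by simp
    show "local_form A \<omega> c z (r *\<^sub>R a) b = r *\<^sub>R local_form A \<omega> c z a b" for a r
      unfolding lc linear_scale[OF lcv] using lin[OF cv cv cv, of r a 0 a b] by simp
  qed
  have "linear (\<lambda>b. local_form A \<omega> c z a b)" for a
    using linear_compose_neg[OF l1[of a]] anti'[of a] by simp
  then show "bilinear (local_form A \<omega> c z)" using l1 by (simp add: bilinear_def)
  show "deriv_along (\<lambda>z. local_form A \<omega> c z b e) z a - deriv_along (\<lambda>z. local_form A \<omega> c z a e) z b
      + deriv_along (\<lambda>z. local_form A \<omega> c z a b) z e = 0" for a b e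
    using \<omega>(2) c z by (auto simp: closed_form_def local_ext_deriv_def)
next
  show "smooth_on (snd c ` fst c) (\<lambda>z. local_form A \<omega> c z a b)" for a b
    using \<omega>(1) c by (auto simp: two_form_def)
qed

end

section \<open>Flat charts of integrable distributions\<close>

lemma orth_projection_exists:
  fixes E :: "'a::euclidean_space set"
  assumes "subspace E"
  obtains P where "orth_projection P" "range P = E" "\<And>x y. P x \<bullet> y = x \<bullet> P y"
proof -
  obtain B where B: "B \<subseteq> E" "pairwise orthogonal B" "\<And>x. x \<in> B \<Longrightarrow> norm x = 1" "independent B" "span B = E"
    using orthonormal_basis_subspace[OF assms] by metis
  have fin: "finite B" by (rule independent_imp_finite[OF B(4)])
  define P where "P x = (\<Sum>b\<in>B. (x \<bullet> b) *\<^sub>R b)" for x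
  have lin: "linear P"
    unfolding P_def by (intro linear_compose_sum ballI) (auto simp: linear_iff inner_add_left scaleR_add_left)
  have PE: "P x \<in> E" for x
    unfolding P_def using B(1) by (intro subspace_sum[OF assms] subspace_scale[OF assms]) auto
  have Pb: "P b = b" if "b \<in> B" for b
  proof -
    have "P b = (\<Sum>b'\<in>B. if b' = b then b else 0)"
      unfolding P_def
    proof (rule sum.cong)
      fix b' assume "b' \<in> B"
      then show "(b \<bullet> b') *\<^sub>R b' = (if b' = b then b else 0)"
        using B(2,3) that by (auto simp: pairwise_def orthogonal_def dot_square_norm)
    qed simp
    then show ?thesis using fin that by simp
  qed
  have id: "P x = x" if "x \<in> E" for x
    using real_vector.linear_eq_on_span[OF lin linear_ident Pb] that B(5) by auto
  have self: "P x \<bullet> y = x \<bullet> P y" for x y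
    by (simp add: P_def inner_sum_left inner_sum_right inner_commute mult.commute)
  show thesis
  proof (rule that[of P])
    show "orth_projection P"
    proof (rule orth_projection.intro)
      show "linear P" by (rule lin)
      show "P (P x) = P x" for x using id[OF PE] .
      show "norm (x - P x) \<le> norm x" for x
      proof -
        have "P x \<bullet> P x = P x \<bullet> x" using self[of "P x" x] id[OF PE] by (simp add: inner_commute)
        then have "(norm (x - P x))\<^sup>2 = (norm x)\<^sup>2 - (norm (P x))\<^sup>2"
          by (simp add: power2_norm_eq_inner inner_diff_left inner_diff_right inner_commute)
        then have "(norm (x - P x))\<^sup>2 \<le> (norm x)\<^sup>2" using zero_le_power2[of "norm (P x)"] by linarith
        then show ?thesis by (rule power2_le_imp_le) (rule norm_ge_zero)
      qed
    qed
    show "range P = E" using PE id by (auto simp: image_iff) metis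
  qed (rule self)
qed

lemma line_has_derivative: "((\<lambda>t. z + t *\<^sub>R b) has_derivative (\<lambda>h. h *\<^sub>R b)) (at t)"
  by (auto intro!: derivative_eq_intros)

text \<open>The component of \<open>\<gamma>\<close> orthogonal to \<open>E\<close> vanishes, and so does its derivative.\<close>

lemma deriv_in_subspace:
  fixes \<gamma> :: "real \<Rightarrow> 'a::euclidean_space"
  assumes E: "subspace E" and T: "open T" "0 \<in> T" "\<And>t. t \<in> T \<Longrightarrow> \<gamma> t \<in> E"
    and \<gamma>: "(\<gamma> has_derivative (\<lambda>h. h *\<^sub>R w)) (at 0)"
  shows "w \<in> E"
proof -
  obtain P where P: "orth_projection P" "range P = E" using orth_projection_exists[OF E] by metis
  interpret orth_projection P by (rule P(1))
  have "((\<lambda>t. 0) has_derivative (\<lambda>h. h *\<^sub>R w - P (h *\<^sub>R w))) (at (0::real))"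
  proof (rule has_derivative_transform_within_open[OF _ T(1,2)])
    show "((\<lambda>t. \<gamma> t - P (\<gamma> t)) has_derivative (\<lambda>h. h *\<^sub>R w - P (h *\<^sub>R w))) (at 0)"
      by (intro has_derivative_diff \<gamma> bounded_linear.has_derivative[OF bounded_linear])
    show "\<gamma> t - P (\<gamma> t) = 0" if "t \<in> T" for t using T(3)[OF that] P(2) by auto
  qed
  from fun_cong[OF has_derivative_unique[OF this has_derivative_const], of 1]
  have "w = P w" by simp
  then show ?thesis using P(2) by (metis rangeI)
qed

context
  fixes X :: "'a topology" and A :: "('a, 'e::euclidean_space) chart set"
  assumes M: "smooth_manifold X A"
begin

text \<open>The straight segment through \<open>snd e x\<close> in direction \<open>w\<close> lies in the submanifold; seen in the other
  chart it lies in the subspace \<open>E'\<close>, and so does its velocity.\<close>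

lemma slice_charts_agree:
  assumes e: "e \<in> charts_at A x" and e': "e' \<in> charts_at A x"
    and sl: "slice_chart e E N" "slice_chart e' E' N" and "x \<in> N" "w \<in> E"
  shows "deriv_along (transition e e') (snd e x) w \<in> E'"
proof -
  note eX = charts_atD[OF M e] and e'X = charts_atD[OF M e']
  let ?\<zeta> = "snd e x" and ?W = "snd e ` (fst e \<inter> fst e')"
  have sE: "subspace E" "subspace E'" using sl by (auto simp: slice_chart_def)
  have W: "open ?W" using open_chart_image[OF eX(3)] e'X(3) by (simp add: chart_on_def)
  have \<zeta>E: "?\<zeta> \<in> E" using sl(1) eX(2) \<open>x \<in> N\<close> unfolding slice_chart_def by blast
  define T where "T = (\<lambda>t::real. ?\<zeta> + t *\<^sub>R w) -` ?W"
  have T: "open T" "0 \<in> T" unfolding T_def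
    using W eX(2) e'X(2) by (auto intro!: open_vimage continuous_intros)
  show ?thesis
  proof (rule deriv_in_subspace[OF sE(2) T])
    fix t assume "t \<in> T"
    then obtain y where y: "y \<in> fst e" "y \<in> fst e'" "?\<zeta> + t *\<^sub>R w = snd e y" by (auto simp: T_def)
    have "?\<zeta> + t *\<^sub>R w \<in> E" using \<zeta>E \<open>w \<in> E\<close> by (intro subspace_add[OF sE(1)] subspace_scale[OF sE(1)])
    then have "snd e y \<in> snd e ` (fst e \<inter> N)" using sl(1) y unfolding slice_chart_def by auto
    then have "y \<in> N" using y(1) chart_inj_on[OF eX(3)] by (auto dest: inj_onD)
    then have "snd e' y \<in> E'" using sl(2) y(2) unfolding slice_chart_def by blast
    then show "transition e e' (?\<zeta> + t *\<^sub>R w) \<in> E'"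
      unfolding y(3) by (simp add: transition_def chart_inv_eq[OF eX(3) y(1)])
  next
    have d: "(transition e e' has_derivative deriv_along (transition e e') ?\<zeta>) (at (?\<zeta> + 0 *\<^sub>R w))"
      using transition_has_derivative[OF eX(3) e'X(3) smooth_manifoldD(2)[OF M eX(1) e'X(1)] eX(2) e'X(2)]
        by simp
    from has_derivative_compose[OF line_has_derivative d]
    show "((\<lambda>t. transition e e' (?\<zeta> + t *\<^sub>R w)) has_derivative (\<lambda>h. h *\<^sub>R deriv_along (transition e e') ?\<zeta>
      w)) (at 0)"
      by (simp add: linear_scale[OF has_derivative_linear[OF d]])
  qed
qed

text \<open>An integral submanifold through a point is parametrised by a transition map \<open>\<phi>\<close> whose first
  derivatives are vectors of the distribution. Differentiating this relation once more and using the
  symmetry of the second derivative of \<open>\<phi>\<close> gives the condition.\<close>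

lemma integrability_condition:
  assumes P: "orth_projection P" and c: "c \<in> A" and ball: "ball 0 \<rho> \<subseteq> snd c ` fst c"
    and F: "\<And>z. z \<in> ball 0 \<rho> \<Longrightarrow> linear (F z)" "\<And>u. smooth_on (ball 0 \<rho>) (\<lambda>z. F z u)"
      "\<And>z u. z \<in> ball 0 \<rho> \<Longrightarrow> P (F z u) = 0"
    and V: "integrable_distribution X A r V"
    and graph: "\<And>y v. \<lbrakk>y \<in> fst c; snd c y \<in> ball 0 \<rho>; v \<in> tangent_space A y\<rbrakk> \<Longrightarrow>
      v \<in> V y \<longleftrightarrow> v c = P (v c) + F (snd c y) (P (v c))"
    and z: "z \<in> ball 0 \<rho>" and uv: "P u = u" "P v = v"
  shows "deriv_along (\<lambda>z. F z u) z (v + F z v) = deriv_along (\<lambda>z. F z v) z (u + F z u)"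
proof -
  interpret orth_projection P by (rule P)
  note cX = smooth_manifoldD(1)[OF M c]
  define x where "x = chart_inv c z"
  have x: "x \<in> fst c" "snd c x = z" using chart_inv_in[OF cX] chart_eq_inv[OF cX] z ball by (auto simp: x_def)
  have cx: "c \<in> charts_at A x" using c x by (simp add: charts_at_def)
  have "x \<in> topspace X" using x chart_dom_subset[OF cX] by blast
  then obtain N where N: "x \<in> N" "integral_submanifold X A V N"
    using V unfolding integrable_distribution_def by blast
  then obtain e E where e: "e \<in> charts_at A x" and sl: "slice_chart e E N"
    unfolding integral_submanifold_def submanifold_def by blast
  have NV: "V y = submanifold_tangent A N y" if "y \<in> N" for y
    using N(2) that unfolding integral_submanifold_def by blast
  note eX = charts_atD[OF M e]
  have sE: "subspace E" using sl by (simp add: slice_chart_def)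
  define \<phi> where "\<phi> = transition e c"
  define \<zeta> where "\<zeta> = snd e x"
  let ?W = "snd e ` (fst e \<inter> fst c)"
  have W: "open ?W" using open_chart_image[OF eX(3)] cX by (simp add: chart_on_def)
  have \<phi>S: "smooth_on ?W \<phi>" using smooth_manifoldD(2)[OF M eX(1) c] by (simp add: smoothly_compatible_def \<phi>_def)
  have \<phi>e: "\<phi> (snd e y) = snd c y" if "y \<in> fst e" for y
    by (simp add: \<phi>_def transition_def chart_inv_eq[OF eX(3) that])
  have \<zeta>W: "\<zeta> \<in> ?W" using x(1) eX(2) by (auto simp: \<zeta>_def)
  have \<phi>\<zeta>: "\<phi> \<zeta> = z" using \<phi>e[OF eX(2)] x by (simp add: \<zeta>_def)
  have \<zeta>E: "\<zeta> \<in> E" using sl eX(2) N(1) unfolding slice_chart_def \<zeta>_def by blast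
  have lift: "\<exists>a\<in>E. deriv_along \<phi> \<zeta> a = u + F z u" if u: "P u = u" for u
  proof -
    let ?Y = "chart_vector A c x (u + F z u)"
    have Y: "?Y \<in> tangent_space A x" "?Y c = u + F z u"
      using chart_vector_in_tangent[OF M cx] chart_vector_self[OF M cx] by auto
    then have "?Y \<in> V x" using graph[OF x(1)] x(2) z by (simp add: linear_add[OF linear] F(3) u)
    then obtain e' E' where e': "e' \<in> charts_at A x" "slice_chart e' E' N" "?Y e' \<in> E'"
      unfolding NV[OF N(1)] submanifold_tangent_def by blast
    have "?Y e \<in> E"
      using slice_charts_agree[OF e'(1) e e'(2) sl N(1) e'(3)] tangent_transition[OF M Y(1) e'(1) e] by simp
    moreover have "deriv_along \<phi> \<zeta> (?Y e) = ?Y c"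
      using tangent_transition[OF M Y(1) e cx] by (simp add: \<phi>_def \<zeta>_def)
    ultimately show ?thesis using Y(2) by metis
  qed
  have key: "deriv_along (\<lambda>z. F z (P (deriv_along \<phi> \<zeta> a))) z (deriv_along \<phi> \<zeta> b)
      = w - P w - F z (P w)" if a: "a \<in> E" and b: "b \<in> E" and w: "w
        = deriv_along (\<lambda>\<zeta>. deriv_along \<phi> \<zeta> a) \<zeta> b" for a b w
  proof -
    let ?W' = "?W \<inter> \<phi> -` ball 0 \<rho>"
    have W': "open ?W'"
      using continuous_open_preimage[OF Ck_on_continuous[OF smooth_on_Ck[OF \<phi>S]] W open_ball] .
    define T where "T = (\<lambda>t::real. \<zeta> + t *\<^sub>R b) -` ?W'"
    have T: "open T" "0 \<in> T"
      unfolding T_def by (rule open_vimage[OF W'], intro continuous_intros) (use \<zeta>W \<phi>\<zeta> z in simp)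
    let ?D = "\<lambda>t. deriv_along \<phi> (\<zeta> + t *\<^sub>R b) a"
    have rel: "?D t - P (?D t) = F (\<phi> (\<zeta> + t *\<^sub>R b)) (P (?D t))" if "t \<in> T" for t
    proof -
      obtain y where y: "y \<in> fst e" "y \<in> fst c" "\<zeta> + t *\<^sub>R b = snd e y" "snd c y \<in> ball 0 \<rho>"
        using \<open>t \<in> T\<close> \<phi>e unfolding T_def by auto
      have ey: "e \<in> charts_at A y" "c \<in> charts_at A y" using eX(1) c y by (auto simp: charts_at_def)
      have "\<zeta> + t *\<^sub>R b \<in> E" using \<zeta>E b by (intro subspace_add[OF sE] subspace_scale[OF sE])
      then have "snd e y \<in> snd e ` (fst e \<inter> N)" using sl y unfolding slice_chart_def by auto
      then have yN: "y \<in> N" using y(1) chart_inj_on[OF eX(3)] by (auto dest: inj_onD)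
      let ?Y = "chart_vector A e y a"
      have Y: "?Y \<in> tangent_space A y" "?Y e = a"
        using chart_vector_in_tangent[OF M ey(1)] chart_vector_self[OF M ey(1)] by auto
      have "?Y e \<in> E" using Y(2) a by simp
      then have "?Y \<in> V y" unfolding NV[OF yN] submanifold_tangent_def using Y(1) ey(1) sl by blast
      then have "?Y c = P (?Y c) + F (snd c y) (P (?Y c))" using graph[OF y(2,4) Y(1)] by simp
      moreover have "?Y c = ?D t"
        using tangent_transition[OF M Y(1) ey] Y(2) y(3) by (simp add: \<phi>_def)
      ultimately show ?thesis using \<phi>e[OF y(1)] y(3) by (metis add_diff_cancel_left')
    qed
    have at0: "\<zeta> + 0 *\<^sub>R b = \<zeta>" by simp
    have dD: "(?D has_derivative (\<lambda>h. h *\<^sub>R w)) (at 0)"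
    proof -
      have d: "((\<lambda>\<zeta>. deriv_along \<phi> \<zeta> a) has_derivative deriv_along (\<lambda>\<zeta>. deriv_along \<phi> \<zeta> a) \<zeta>) (at (\<zeta> + 0 *\<^sub>R
        b))"
        using smooth_on_has_derivative[OF smooth_on_deriv_along[OF \<phi>S] \<zeta>W] by simp
      from has_derivative_compose[OF line_has_derivative d] show ?thesis
        by (simp add: linear_scale[OF has_derivative_linear[OF d]] w)
    qed
    have d\<phi>: "((\<lambda>t. \<phi> (\<zeta> + t *\<^sub>R b)) has_derivative (\<lambda>h. h *\<^sub>R deriv_along \<phi> \<zeta> b)) (at 0)"
    proof -
      have d: "(\<phi> has_derivative deriv_along \<phi> \<zeta>) (at (\<zeta> + 0 *\<^sub>R b))"
        using smooth_on_has_derivative[OF \<phi>S \<zeta>W] by simp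
      from has_derivative_compose[OF line_has_derivative d] show ?thesis
        by (simp add: linear_scale[OF has_derivative_linear[OF d]])
    qed
    have dPD: "((\<lambda>t. P (?D t)) has_derivative (\<lambda>h. P (h *\<^sub>R w))) (at 0)"
      by (rule bounded_linear.has_derivative[OF bounded_linear dD])
    have mem: "\<phi> (\<zeta> + 0 *\<^sub>R b) \<in> ball 0 \<rho>" using \<phi>\<zeta> z by simp
    have 1: "((\<lambda>t. F (\<phi> (\<zeta> + t *\<^sub>R b)) (P (?D t))) has_derivative
      (\<lambda>h. deriv_along (\<lambda>z. F z (P (?D 0))) (\<phi> (\<zeta> + 0 *\<^sub>R b)) (h *\<^sub>R deriv_along \<phi> \<zeta> b) + F (\<phi> (\<zeta> + 0 *\<^sub>R
        b)) (P (h *\<^sub>R w)))) (at 0)"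
      using linear_apply_has_derivative[of "ball 0 \<rho>" F
        "\<lambda>t. \<phi> (\<zeta> + t *\<^sub>R b)" 0, OF open_ball F(1) smooth_on_Ck[OF F(2)] mem d\<phi> dPD] .
    have "((\<lambda>t. F (\<phi> (\<zeta> + t *\<^sub>R b)) (P (?D t))) has_derivative (\<lambda>h. h *\<^sub>R w - P (h *\<^sub>R w))) (at 0)"
      by (rule has_derivative_transform_within_open[OF has_derivative_diff[OF dD dPD] T rel])
    from fun_cong[OF has_derivative_unique[OF this 1], of 1]
    show ?thesis by (simp add: \<phi>\<zeta> algebra_simps)
  qed
  obtain a where a: "a \<in> E" "deriv_along \<phi> \<zeta> a = u + F z u" using lift[OF uv(1)] by blast
  obtain b where b: "b \<in> E" "deriv_along \<phi> \<zeta> b = v + F z v" using lift[OF uv(2)] by blast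
  have Pa: "P (u + F z u) = u" "P (v + F z v) = v" using F(3)[OF z] uv by (simp_all add: linear_add[OF linear])
  from key[OF a(1) b(1) refl] key[OF b(1) a(1) refl] show ?thesis
    by (simp add: a(2) b(2) Pa smooth_on_symmetric_second_derivative[OF \<phi>S W \<zeta>W, of b a])
qed

lemma linear_component: "linear (\<lambda>v :: ('a, 'e) tangent. v c)"
  by (simp add: linear_iff scaleR_fun_def)

text \<open>A local frame \<open>y\<close> of the distribution restricts to a basis of the plane \<open>E\<close> at the centre of the
  chart. With the functionals \<open>l\<close> dual to this basis the map \<open>B z\<close> sends \<open>y j 0\<close> to \<open>y j z\<close> and is the
  identity on the complement of \<open>E\<close>.\<close>

lemma distribution_graph:
  assumes V: "distribution X A r V" and c: "c \<in> A" and x: "x \<in> fst c" "snd c x = 0"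
  obtains P \<rho> F where "orth_projection P" "\<And>x y. P x \<bullet> y = x \<bullet> P y" "dim (range P) = r"
    "\<rho> > 0" "ball 0 \<rho> \<subseteq> snd c ` fst c" "\<And>z. z \<in> ball 0 \<rho> \<Longrightarrow> linear (F z)"
    "\<And>u. smooth_on (ball 0 \<rho>) (\<lambda>z. F z u)" "\<And>u. F 0 u = 0" "\<And>z u. z \<in> ball 0 \<rho> \<Longrightarrow> P (F z u) = 0"
    "\<And>y v. \<lbrakk>y \<in> fst c; snd c y \<in> ball 0 \<rho>; v \<in> tangent_space A y\<rbrakk> \<Longrightarrow>
      v \<in> V y \<longleftrightarrow> v c = P (v c) + F (snd c y) (P (v c))"
proof -
  note cX = smooth_manifoldD(1)[OF M c]
  have VT: "subspace (V y)" "V y \<subseteq> tangent_space A y" "dim (V y) = r" if "y \<in> fst c" for y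
    using V chart_dom_subset[OF cX] that unfolding distribution_def by blast+
  have "x \<in> topspace X" using x chart_dom_subset[OF cX] by blast
  with V have "\<exists>U Y. openin X U \<and> x \<in> U \<and> (\<forall>j<r. smooth_vector_field A U (Y j)) \<and>
      (\<forall>y\<in>U. V y = span ((\<lambda>j. Y j y) ` {..<r}))"
    unfolding distribution_def by (elim conjE) (rule bspec)
  then obtain U Y where U: "openin X U" "x \<in> U" and "\<forall>j<r. smooth_vector_field A U (Y j)"
    and "\<forall>y\<in>U. V y = span ((\<lambda>j. Y j y) ` {..<r})"
    by (elim exE conjE)
  then have Y: "\<And>j. j < r \<Longrightarrow> smooth_vector_field A U (Y j)"
    and VY: "\<And>y. y \<in> U \<Longrightarrow> V y = span ((\<lambda>j. Y j y) ` {..<r})"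
    by auto
  define Z where "Z = snd c ` (fst c \<inter> U)"
  have Z: "open Z" "0 \<in> Z" using open_chart_image[OF cX U(1)] x U(2) by (force simp: Z_def)+
  define y where "y j z = Y j (chart_inv c z) c" for j z
  have ysm: "smooth_on Z (y j)" if "j < r" for j
    using Y[OF that] c unfolding smooth_vector_field_def Z_def y_def[abs_def] by blast
  have span_y: "(\<lambda>v. v c) ` V p = span ((\<lambda>j. y j (snd c p)) ` {..<r})" if "p \<in> fst c" "p \<in> U" for p
    using span_linear_image[OF linear_component[of c], of "(\<lambda>j. Y j p) ` {..<r}"]
    by (simp add: VY[OF that(2)] image_image y_def chart_inv_eq[OF cX that(1)])
  let ?Y0 = "(\<lambda>j. y j 0) ` {..<r}"
  define E where "E = span ?Y0"
  have EV: "E = (\<lambda>v. v c) ` V x" using span_y[OF x(1) U(2)] x(2) by (simp add: E_def)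
  have cx: "c \<in> charts_at A x" using c x by (simp add: charts_at_def)
  have dimE: "dim E = r"
  proof -
    obtain B where B: "B \<subseteq> V x" "independent B" "V x \<subseteq> span B" "card B = r"
      using basis_exists[of "V x"] VT(3)[OF x(1)] by metis
    have sB: "span B = V x" using B(1,3) span_minimal[OF B(1) VT(1)[OF x(1)]] by blast
    have inj: "inj_on (\<lambda>v. v c) (span B)"
      unfolding sB using VT(2)[OF x(1)] tangent_eqI[OF M _ _ cx] by (auto intro!: inj_onI)
    have "independent ((\<lambda>v. v c) ` B)"
      by (rule real_vector.linear_independent_injective_image[OF linear_component B(2) inj])
    moreover have "span ((\<lambda>v. v c) ` B) = E" unfolding EV span_linear_image[OF linear_component] sB ..
    moreover have "card ((\<lambda>v. v c) ` B) = r"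
      using card_image[OF inj_on_subset[OF inj span_superset]] B(4) by simp
    ultimately show ?thesis using dim_span_eq_card_independent by metis
  qed
  have "card ?Y0 \<le> r" using card_image_le[of "{..<r}" "\<lambda>j. y j 0"] by simp
  then have ind: "independent ?Y0"
    using card_le_dim_spanning[of ?Y0 E] span_superset[of ?Y0] dimE by (simp add: E_def)
  then have "card ?Y0 = r" using dim_span_eq_card_independent dimE unfolding E_def by metis
  then have injY: "inj_on (\<lambda>j. y j 0) {..<r}" by (intro eq_card_imp_inj_on) auto
  have "\<exists>l :: 'e \<Rightarrow> real. linear l \<and> (\<forall>v\<in>?Y0. l v = (if v = y j 0 then 1 else 0))" for j
    by (rule linear_independent_extend[OF ind])
  then obtain l :: "nat \<Rightarrow> 'e \<Rightarrow> real" where l: "\<And>j. linear (l j)" "\<And>j v. v \<in> ?Y0 \<Longrightarrow> l j v = (if v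
    = y j 0 then 1 else 0)"
    by metis
  have ly: "l j (y i 0) = (if i = j then 1 else 0)" if "i < r" "j < r" for i j
    using l(2)[of "y i 0" j] injY that by (auto dest: inj_onD)
  obtain P where P: "orth_projection P" "range P = E" "\<And>x y. P x \<bullet> y = x \<bullet> P y"
    using orth_projection_exists[of E] unfolding E_def using subspace_span by metis
  interpret orth_projection P by (rule P(1))
  have PE: "P w = w" if "w \<in> E" for w using that P(2) idem by (metis imageE)
  have PinE: "P w \<in> E" for w using P(2) by blast
  have lsum: "linear (\<lambda>w. \<Sum>j<r. l j w *\<^sub>R y j z)" for z
    by (intro linear_compose_sum ballI) (auto simp: linear_iff linear_add[OF l(1)] linear_scale[OF l(1)]
      scaleR_add_left)
  have frame: "(\<Sum>j<r. l j (y i 0) *\<^sub>R y j z) = y i z" if "i < r" for i z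
  proof -
    have "(\<Sum>j<r. l j (y i 0) *\<^sub>R y j z) = (\<Sum>j<r. if j = i then y i z else 0)"
      by (rule sum.cong) (use ly that in auto)
    then show ?thesis using that by simp
  qed
  define B where "B z w = (w - P w) + (\<Sum>j<r. l j (P w) *\<^sub>R y j z)" for z w
  have Blin: "linear (B z)" for z
    unfolding B_def
    using linear_compose_add[OF linear_compose_sub[OF linear_ident linear] linear_compose[OF linear lsum]]
      by (simp add: o_def)
  have Bsm: "smooth_on Z (\<lambda>z. B z w)" for w
    unfolding B_def
    by (intro smooth_onI Ck_on_add Ck_on_sum Ck_on_scaleR Ck_on_const Z smooth_on_Ck[OF ysm]) auto
  have B0: "B 0 w = w" for w
  proof -
    have "(\<Sum>j<r. l j (P w) *\<^sub>R y j 0) = P w"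
      by (rule real_vector.linear_eq_on_span[OF lsum linear_ident, of ?Y0]) (use frame PinE in \<open>auto simp:
        E_def\<close>)
    then show ?thesis by (simp add: B_def)
  qed
  have By: "B z (y i 0) = y i z" if "i < r" for i z
  proof -
    have "y i 0 \<in> E" unfolding E_def using that by (intro span_base) auto
    then show ?thesis using frame[OF that] by (simp add: B_def PE)
  qed
  have Bimg: "B z ` range P = span ((\<lambda>j. y j z) ` {..<r})" for z
    using span_linear_image[OF Blin, of z ?Y0] By unfolding P(2) E_def
      by (simp add: image_image cong: image_cong_simp)
  obtain \<rho> F where \<rho>: "\<rho> > 0" "ball 0 \<rho> \<subseteq> Z" and F: "\<And>z. z \<in> ball 0 \<rho> \<Longrightarrow> linear (F z)"
    "\<And>u. smooth_on (ball 0 \<rho>) (\<lambda>z. F z u)" "\<And>u. F 0 u = 0" "\<And>z u. z \<in> ball 0 \<rho> \<Longrightarrow> P (F z u) = 0"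
    "\<And>z v. z \<in> ball 0 \<rho> \<Longrightarrow> v \<in> B z ` range P \<longleftrightarrow> v = P v + F z (P v)"
    by (rule smooth_frame_graph[OF Z Blin Bsm B0]) blast
  have graph: "v \<in> V p \<longleftrightarrow> v c = P (v c) + F (snd c p) (P (v c))"
    if p: "p \<in> fst c" "snd c p \<in> ball 0 \<rho>" and v: "v \<in> tangent_space A p" for p v
  proof -
    have "snd c p \<in> Z" using \<rho>(2) p by blast
    then have "p \<in> U" using chart_inj_on[OF cX] p unfolding Z_def by (auto dest: inj_onD)
    have cp: "c \<in> charts_at A p" using c p by (simp add: charts_at_def)
    have "v \<in> V p \<longleftrightarrow> v c \<in> (\<lambda>v. v c) ` V p"
      using VT(2)[OF p(1)] tangent_eqI[OF M v _ cp] by blast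
    also have "(\<lambda>v. v c) ` V p = B (snd c p) ` range P" unfolding span_y[OF p(1) \<open>p \<in> U\<close>] Bimg ..
    finally show ?thesis unfolding F(5)[OF p(2)] .
  qed
  have "ball 0 \<rho> \<subseteq> snd c ` fst c" using \<rho>(2) unfolding Z_def by blast
  moreover have "dim (range P) = r" unfolding P(2) by (rule dimE)
  ultimately show thesis
    using that[OF P(1) P(3) _ \<rho>(1) _ F(1-4) graph] by blast
qed

text \<open>The map \<open>G\<close> of \<open>frobenius_graph\<close> carries the translates of \<open>range P\<close> to the leaves; its local inverse
  is the change of coordinates that makes the distribution constant.\<close>

theorem flat_chart_exists:
  assumes V: "integrable_distribution X A r V" and "x \<in> topspace X"
  obtains d P where "d \<in> charts_at A x" "snd d x = 0" "orth_projection P" "\<And>x y. P x \<bullet> y = x \<bullet> P y"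
    "dim (range P) = r"
    "\<And>y v. \<lbrakk>y \<in> fst d; v \<in> tangent_space A y\<rbrakk> \<Longrightarrow> v \<in> V y \<longleftrightarrow> P (v d) = v d"
proof -
  obtain c0 where c0: "c0 \<in> A" "x \<in> fst c0" using smooth_manifoldD(3)[OF M assms(2)] by blast
  note c0X = smooth_manifoldD(1)[OF M c0(1)]
  have idl: "Ck_on m T (\<lambda>w::'e. w)" for m T by (rule Ck_on_bounded_linear) (rule bounded_linear_ident)
  define c where "c = recoordinate c0 (snd c0 ` fst c0) (\<lambda>z. z - snd c0 x)"
  have oi: "open (snd c0 ` fst c0)" using c0X by (simp add: chart_on_def)
  have oi': "open ((\<lambda>z. z - snd c0 x) ` snd c0 ` fst c0)" using open_translation_subtract[OF oi] .
  have c: "c \<in> A"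
    unfolding c_def
    by (rule recoordinate_in_atlas[OF M c0(1) oi order_refl, where g="\<lambda>z. z + snd c0 x"])
      (auto intro!: smooth_onI Ck_on_diff Ck_on_add oi oi' idl Ck_on_const)
  have cx: "x \<in> fst c" "snd c x = 0" using c0 by (auto simp: c_def recoordinate_def)
  note cX = smooth_manifoldD(1)[OF M c]
  obtain P \<rho> F where P: "orth_projection P" "\<And>x y. P x \<bullet> y = x \<bullet> P y" "dim (range P) = r"
    and \<rho>: "\<rho> > 0" "ball 0 \<rho> \<subseteq> snd c ` fst c" and F: "\<And>z. z \<in> ball 0 \<rho> \<Longrightarrow> linear (F z)"
    "\<And>u. smooth_on (ball 0 \<rho>) (\<lambda>z. F z u)" "\<And>u. F 0 u = 0" "\<And>z u. z \<in> ball 0 \<rho> \<Longrightarrow> P (F z u) = 0"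
    and graph: "\<And>y v. \<lbrakk>y \<in> fst c; snd c y \<in> ball 0 \<rho>; v \<in> tangent_space A y\<rbrakk> \<Longrightarrow>
      v \<in> V y \<longleftrightarrow> v c = P (v c) + F (snd c y) (P (v c))"
    by (rule distribution_graph[of r V c x]) (use V c cx in \<open>auto simp: integrable_distribution_def\<close>)
  interpret orth_projection P by (rule P(1))
  have integ: "deriv_along (\<lambda>z. F z u) z (v + F z v) = deriv_along (\<lambda>z. F z v) z (u + F z u)"
    if "z \<in> ball 0 \<rho>" "P u = u" "P v = v" for z u v
    by (rule integrability_condition[OF P(1) c \<rho>(2) F(1,2,4) V graph that])
  obtain d G where d: "d > 0" and G: "smooth_on (ball 0 d) G" "G ` ball 0 d \<subseteq> ball 0 \<rho>" "G 0 = 0"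
    "\<And>v. deriv_along G 0 v = v" "\<And>z u. \<lbrakk>z \<in> ball 0 d; P u = u\<rbrakk> \<Longrightarrow> deriv_along G z u = u + F (G z) u"
    by (rule frobenius_graph[OF \<rho>(1) F(1,2,3) integ]) blast+
  obtain W g where W: "open W" "0 \<in> W" "W \<subseteq> ball 0 d" "open (G ` W)" and g: "smooth_on (G ` W) g" "\<And>z. z \<in> W
    \<Longrightarrow> g (G z) = z"
    by (rule smooth_inverse_function[OF G(1) open_ball _ linear_ident]) (use d G(4) in auto)
  define e where "e = recoordinate c (G ` W) g"
  have GW: "G ` W \<subseteq> snd c ` fst c" using W(3) G(2) \<rho>(2) by blast
  have gGW: "g ` G ` W = W" using g(2) by force
  have eA: "e \<in> A"
    unfolding e_def
    by (rule recoordinate_in_atlas[OF M c W(4) GW g(1), where g=G])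
      (use gGW W(1) g(2) smooth_on_subset[OF G(1) W(3)] in auto)
  have ex: "x \<in> fst e" "snd e x = 0" using cx G(3) W(2) g(2)[OF W(2)] by (force simp: e_def recoordinate_def)+
  have flat: "v \<in> V y \<longleftrightarrow> P (v e) = v e" if y: "y \<in> fst e" and v: "v \<in> tangent_space A y" for y v
  proof -
    have yc: "y \<in> fst c" "snd c y \<in> G ` W" "snd e y = g (snd c y)" using y
      by (auto simp: e_def recoordinate_def)
    then have \<zeta>: "snd e y \<in> W" "G (snd e y) = snd c y" using g(2) by auto
    have cy: "c \<in> charts_at A y" "e \<in> charts_at A y" using c eA yc y by (auto simp: charts_at_def)
    note eX = smooth_manifoldD(1)[OF M eA]
    have dG: "(transition e c has_derivative deriv_along G (snd e y)) (at (snd e y))"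
    proof (rule has_derivative_transform_within_open[OF _ W(1) \<zeta>(1)])
      show "(G has_derivative deriv_along G (snd e y)) (at (snd e y))"
        using smooth_on_has_derivative[OF G(1)] W(3) \<zeta>(1) by blast
      fix w assume w: "w \<in> W"
      have "chart_inv e (g (G w)) = chart_inv c (G w)"
        unfolding e_def by (rule chart_inv_recoordinate[where f=g and g=G, OF cX GW]) (use g(2) w in auto)
      then show "G w = transition e c w"
        using chart_eq_inv[OF cX, of "G w"] GW w by (auto simp: transition_def g(2)[OF w])
    qed
    from deriv_along_eq[OF dG] have DG: "v c = deriv_along G (snd e y) (v e)"
      using tangent_transition[OF M v cy(2,1)] by simp
    have retract: "deriv_along (transition c e) (snd c y) (deriv_along G (snd e y) b) = b" for b
      using transition_deriv_compose[OF eX cX eX smooth_manifoldD(2)[OF M eA c] smooth_manifoldD(2)[OF M c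
        eA] y yc(1) y, of b]
        transition_deriv_self[OF eX y, of b] deriv_along_eq[OF dG] by simp
    have \<zeta>d: "snd e y \<in> ball 0 d" using W(3) \<zeta>(1) by blast
    have in\<rho>: "snd c y \<in> ball 0 \<rho>" using G(2) \<zeta>d \<zeta>(2) by (metis image_subset_iff)
    have "v \<in> V y \<longleftrightarrow> v c = P (v c) + F (snd c y) (P (v c))" by (rule graph[OF yc(1) in\<rho> v])
    also have "P (v c) + F (snd c y) (P (v c)) = deriv_along G (snd e y) (P (v c))"
      using G(5)[OF \<zeta>d, of "P (v c)"] \<zeta>(2) by simp
    also have "v c = deriv_along G (snd e y) (P (v c)) \<longleftrightarrow> P (v e) = v e"
    proof
      assume "v c = deriv_along G (snd e y) (P (v c))"
      then have "v e = P (v c)" using retract DG by metis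
      then show "P (v e) = v e" by simp
    next
      assume "P (v e) = v e"
      then have "v c = v e + F (snd c y) (v e)" using G(5)[OF \<zeta>d] DG \<zeta>(2) by simp
      then have "P (v c) = v e" using F(4)[OF in\<rho>] \<open>P (v e) = v e\<close> by (simp add: linear_add[OF linear])
      then show "v c = deriv_along G (snd e y) (P (v c))" using DG by simp
    qed
    finally show ?thesis .
  qed
  show thesis
    by (rule that[of e P, OF _ ex(2) P flat]) (use eA ex in \<open>auto simp: charts_at_def\<close>)
qed

end

section \<open>Darboux coordinates\<close>

lemma closed_two_form_subset: "closed_two_form Z \<Omega> \<Longrightarrow> Z' \<subseteq> Z \<Longrightarrow> closed_two_form Z' \<Omega>"
  unfolding closed_two_form_def using smooth_on_subset by blast

lemma smooth_on_vec:
  fixes f :: "'a::euclidean_space \<Rightarrow> real ^ 's::finite"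
  assumes "open S" "\<And>s. smooth_on S (\<lambda>x. f x $ s)"
  shows "smooth_on S f"
proof (rule smooth_onI, rule Ck_on_componentwise[OF assms(1)])
  fix m and b :: "real ^ 's" assume "b \<in> Basis"
  then obtain s where "b = axis s 1" by (auto simp: Basis_vec_def)
  then show "Ck_on m S (\<lambda>x. f x \<bullet> b)"
    using smooth_on_Ck[OF assms(2)[of s]] by (simp add: inner_axis)
qed

text \<open>The functions \<open>z \<mapsto> z \<bullet> e i\<close> are constant on the leaves, the translates of \<open>range P\<close>, and separate
  them; they become the coordinates \<open>q i\<close>.\<close>

lemma orthonormal_family_exists:
  fixes P :: "'e::euclidean_space \<Rightarrow> 'e"
  assumes "orth_projection P" and self: "\<And>x y. P x \<bullet> y = x \<bullet> P y"
    and dim: "dim (range P) + CARD('n::finite) = DIM('e)"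
  obtains e :: "'n::finite \<Rightarrow> 'e" where "\<And>z. z - P z = (\<Sum>i\<in>UNIV. (z \<bullet> e i) *\<^sub>R e i)" "\<And>i. P (e i) = 0"
    "\<And>z i. P z \<bullet> e i = 0"
proof -
  interpret orth_projection P by (rule assms(1))
  let ?K = "{z. P z = 0}"
  have sK: "subspace ?K" by (rule linear_subspace_kernel[OF linear])
  have "{y \<in> UNIV. \<forall>x\<in>range P. orthogonal x y} = ?K"
  proof -
    have "(\<forall>a. P a \<bullet> y = 0) \<longleftrightarrow> P y = 0" for y
      using self[of _ y] by (metis inner_eq_zero_iff inner_zero_right)
    then show ?thesis by (auto simp: orthogonal_def)
  qed
  then have "dim ?K + dim (range P) = DIM('e)"
    using dim_subspace_orthogonal_to_vectors[of "range P" UNIV] linear_subspace_image[OF linear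
      subspace_UNIV] by simp
  then have dK: "dim ?K = CARD('n)" using dim by simp
  obtain B where B: "B \<subseteq> ?K" "pairwise orthogonal B" "\<And>x. x \<in> B \<Longrightarrow> norm x = 1" "independent B" "card B
    = dim ?K" "span B = ?K"
    by (rule orthonormal_basis_subspace[OF sK]) blast
  have fin: "finite B" by (rule independent_imp_finite[OF B(4)])
  obtain e :: "'n \<Rightarrow> 'e" where e: "bij_betw e UNIV B"
    using finite_same_card_bij[of "UNIV :: 'n set" B] fin B(5) dK by auto
  have eB: "e i \<in> B" for i using e by (auto simp: bij_betw_def)
  have Pe: "P (e i) = 0" for i using eB B(1) by blast
  have Pz: "P z \<bullet> e i = 0" for z i using self[of z "e i"] Pe by simp
  have exp: "w = (\<Sum>i\<in>UNIV. (w \<bullet> e i) *\<^sub>R e i)" if "w \<in> span B" for w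
  proof (rule real_vector.linear_eq_on_span[OF linear_ident _ _ that])
    show "linear (\<lambda>w. \<Sum>i\<in>UNIV. (w \<bullet> e i) *\<^sub>R e i)"
      by (intro linear_compose_sum ballI) (auto simp: linear_iff inner_add_left scaleR_add_left)
    fix b assume b: "b \<in> B"
    then obtain j where j: "b = e j" using e by (auto simp: bij_betw_def)
    have "(\<Sum>i\<in>UNIV. (b \<bullet> e i) *\<^sub>R e i) = (\<Sum>i\<in>UNIV. if i = j then e j else 0)"
    proof (rule sum.cong)
      fix i
      have "e i \<bullet> e j = 0" if "i \<noteq> j"
        using B(2) eB e that unfolding pairwise_def orthogonal_def bij_betw_def by (metis injD)
      then show "(b \<bullet> e i) *\<^sub>R e i = (if i = j then e j else 0)"
        using B(3)[OF eB[of j]] by (auto simp: j inner_commute dot_square_norm)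
    qed simp
    then show "b = (\<Sum>i\<in>UNIV. (b \<bullet> e i) *\<^sub>R e i)" by (simp add: j)
  qed
  have "z - P z = (\<Sum>i\<in>UNIV. (z \<bullet> e i) *\<^sub>R e i)" for z
  proof -
    have "z - P z \<in> span B" unfolding B(6) by (simp add: linear_diff[OF linear])
    from exp[OF this] show ?thesis by (simp add: inner_diff_left Pz)
  qed
  then show thesis using that Pe Pz by blast
qed

text \<open>By the chain rule the differential does not depend on the chart chosen in its definition.\<close>

lemma differential_of_chart_function:
  assumes M: "smooth_manifold X A" and d: "d \<in> charts_at A y" and f: "f differentiable (at (snd d y))"
    and v: "v \<in> tangent_space A y"
  shows "differential A (\<lambda>p. f (snd d p)) y v = deriv_along f (snd d y) (v d)"
proof -
  define c where "c = (SOME c. c \<in> charts_at A y)"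
  have c: "c \<in> charts_at A y" unfolding c_def by (rule someI[of _ d]) (rule d)
  note cX = charts_atD[OF M c] and dX = charts_atD[OF M d]
  have eq: "transition c d (snd c y) = snd d y" by (simp add: transition_def chart_inv_eq[OF cX(3,2)])
  have "(f has_derivative deriv_along f (snd d y)) (at (transition c d (snd c y)))"
    unfolding eq by (rule has_derivative_deriv_along[OF f])
  from has_derivative_compose[OF transition_has_derivative[OF cX(3) dX(3) smooth_manifoldD(2)[OF M cX(1)
    dX(1)] cX(2) dX(2)] this]
  have "deriv_along (\<lambda>z. f (transition c d z)) (snd c y) (v c)
    = deriv_along f (snd d y) (deriv_along (transition c d) (snd c y) (v c))"
    by (rule deriv_along_eq)
  moreover have "(\<lambda>p. f (snd d p)) \<circ> chart_inv c = (\<lambda>z. f (transition c d z))"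
    by (simp add: fun_eq_iff transition_def)
  ultimately show ?thesis
    unfolding differential_def Let_def c_def[symmetric] using tangent_transition[OF M v c d] by simp
qed

text \<open>The primitive \<open>\<theta>\<close> annihilates the leaves, so it is a combination of the differentials of the
  functions \<open>z \<mapsto> z \<bullet> e i\<close>. Its coefficients are \<open>z \<mapsto> \<theta> z (e i)\<close>, the negatives of the momenta.\<close>

lemma form_from_primitive:
  fixes e :: "'n::finite \<Rightarrow> 'e::euclidean_space"
  assumes P: "\<And>z. z - P z = (\<Sum>i\<in>UNIV. (z \<bullet> e i) *\<^sub>R e i)" "\<And>z. P (P z) = P z"
    and \<theta>: "\<And>b. smooth_on Z (\<lambda>z. \<theta> z b)" "\<And>z. z \<in> Z \<Longrightarrow> linear (\<theta> z)"
      "\<And>z u. \<lbrakk>z \<in> Z; P u = u\<rbrakk> \<Longrightarrow> \<theta> z u = (0::real)"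
      "\<And>z a b. z \<in> Z \<Longrightarrow> deriv_along (\<lambda>z. \<theta> z b) z a - deriv_along (\<lambda>z. \<theta> z a) z b = \<Omega> z a b"
    and Z: "open Z" "z \<in> Z"
  shows "\<Omega> z a b = (\<Sum>i\<in>UNIV. wedge (\<lambda>v. v \<bullet> e i) (deriv_along (\<lambda>z. - \<theta> z (e i)) z) a b)"
proof -
  have exp: "\<theta> z b = (\<Sum>i\<in>UNIV. (b \<bullet> e i) * \<theta> z (e i))" if z: "z \<in> Z" for z b
  proof -
    have "\<theta> z (P b + (b - P b)) = \<theta> z (P b) + \<theta> z (b - P b)" by (rule linear_add[OF \<theta>(2)[OF z]])
    also have "\<theta> z (P b) = 0" by (rule \<theta>(3)[OF z P(2)])
    finally have "\<theta> z b = \<theta> z (b - P b)" by simp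
    then have "\<theta> z b = \<theta> z (\<Sum>i\<in>UNIV. (b \<bullet> e i) *\<^sub>R e i)" unfolding P(1) .
    then show ?thesis by (simp add: linear_sum[OF \<theta>(2)[OF z]] linear_scale[OF \<theta>(2)[OF z]])
  qed
  have D: "deriv_along (\<lambda>z. \<theta> z b) z a = (\<Sum>i\<in>UNIV. (b \<bullet> e i) * deriv_along (\<lambda>z. \<theta> z (e i)) z a)" for a b
  proof (rule deriv_along_eq)
    have "((\<lambda>z. \<Sum>i\<in>UNIV. (b \<bullet> e i) * \<theta> z (e i)) has_derivative
      (\<lambda>a. \<Sum>i\<in>UNIV. (b \<bullet> e i) * deriv_along (\<lambda>z. \<theta> z (e i)) z a)) (at z)"
      by (intro has_derivative_sum has_derivative_mult_right smooth_on_has_derivative[OF \<theta>(1) Z(2)])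
    then show "((\<lambda>z. \<theta> z b) has_derivative (\<lambda>a. \<Sum>i\<in>UNIV. (b \<bullet> e i) * deriv_along (\<lambda>z. \<theta> z (e i)) z a)) (at z)"
      by (rule has_derivative_transform_within_open[OF _ Z]) (use exp in simp)
  qed
  have Dm: "deriv_along (\<lambda>z. - \<theta> z (e i)) z a = - deriv_along (\<lambda>z. \<theta> z (e i)) z a" for i a
    by (rule deriv_along_eq[OF has_derivative_minus[OF smooth_on_has_derivative[OF \<theta>(1) Z(2)]]])
  show ?thesis
    unfolding \<theta>(4)[OF Z(2), symmetric] D[of a b] D[of b a] wedge_def Dm by (simp add: sum_subtractf sum_negf)
qed

theorem theorem3p5:
  fixes X :: "'a topology"
    and A :: "('a, 'e::euclidean_space) chart set"
    and \<omega> :: "'k::finite \<Rightarrow> ('a, 'e) form2"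
    and V :: "'a \<Rightarrow> ('a, 'e) tangent set"
    and x :: 'a
  assumes "k_symplectic_manifold X A CARD('n::finite) \<omega> V"
    and "x \<in> topspace X"
  shows "\<exists>U (q :: 'n \<Rightarrow> 'a \<Rightarrow> real) (p :: 'k \<Rightarrow> 'n \<Rightarrow> 'a \<Rightarrow> real).
    x \<in> U \<and> local_coordinates X A U (qp q p) \<and>
    (\<forall>y\<in>U.
      (\<forall>\<alpha>. \<forall>v\<in>tangent_space A y. \<forall>w\<in>tangent_space A y.
         \<omega> \<alpha> y v w = (\<Sum>i\<in>UNIV. wedge (differential A (q i) y) (differential A (p \<alpha> i) y) v w)) \<and>
      V y = span (range (\<lambda>(\<alpha>, i). coord_vector A U (qp q p) (Inr (\<alpha>, i)) y)))"
proof -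
  let ?r = "CARD('n) * CARD('k)"
  note ks = assms(1)[unfolded k_symplectic_manifold_def]
  from ks have M: "smooth_manifold X A" by (elim conjE)
  from ks have dim: "DIM('e) = CARD('n) * (CARD('k) + 1)" by (elim conjE)
  from ks have V: "integrable_distribution X A ?r V" by (elim conjE)
  from ks have "\<forall>\<alpha>. two_form X A (\<omega> \<alpha>) \<and> closed_form A (\<omega> \<alpha>)" by (elim conjE)
  then have two: "two_form X A (\<omega> \<alpha>)" and closed: "closed_form A (\<omega> \<alpha>)" for \<alpha> by simp_all
  from ks have "\<forall>y\<in>topspace X. \<forall>\<alpha>. \<forall>v\<in>V y. \<forall>w\<in>V y. \<omega> \<alpha> y v w = 0" by (elim conjE)
  then have iso: "\<omega> \<alpha> y v w = 0" if "y \<in> topspace X" "v \<in> V y" "w \<in> V y" for \<alpha> y v w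
    using that by blast
  from ks have "\<forall>y\<in>topspace X. (\<Inter>\<alpha>. form_kernel A (\<omega> \<alpha>) y) = {0}" by (elim conjE)
  then have ker: "(\<Inter>\<alpha>. form_kernel A (\<omega> \<alpha>) y) = {0}" if "y \<in> topspace X" for y
    using that by (rule bspec)
  obtain d P where d: "d \<in> charts_at A x" "snd d x = 0" and P: "orth_projection P" "\<And>x y. P x \<bullet> y = x \<bullet> P y"
    "dim (range P) = ?r"
    and flat: "\<And>y v. \<lbrakk>y \<in> fst d; v \<in> tangent_space A y\<rbrakk> \<Longrightarrow> v \<in> V y \<longleftrightarrow> P (v d) = v d"
    by (rule flat_chart_exists[OF M V assms(2)]) blast
  interpret orth_projection P by (rule P(1))
  note dX = charts_atD[OF M d(1)]
  have dcomp: "smoothly_compatible d c" "smoothly_compatible c d" if "c \<in> A" for c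
    using smooth_manifoldD(2)[OF M] dX(1) that by blast+
  have dat: "d \<in> charts_at A y" if "y \<in> fst d" for y using dX(1) that by (simp add: charts_at_def)
  obtain r where r: "r > 0" "ball 0 r \<subseteq> snd d ` fst d"
  proof -
    have "open (snd d ` fst d)" "0 \<in> snd d ` fst d" using dX d(2) by (auto simp: chart_on_def image_iff)
    then show thesis using openE that by blast
  qed
  let ?Z = "ball (0::'e) r"
  define \<Omega> where "\<Omega> \<alpha> = local_form A (\<omega> \<alpha>) d" for \<alpha>
  have \<Omega>: "closed_two_form ?Z (\<Omega> \<alpha>)" for \<alpha>
    unfolding \<Omega>_def by (rule closed_two_form_subset[OF closed_two_form_local_form[OF M two closed dX(1)] r(2)])
  have inv: "chart_inv d z \<in> fst d" "snd d (chart_inv d z) = z" if "z \<in> ?Z" for z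
    using chart_inv_in[OF dX(3)] chart_eq_inv[OF dX(3)] r(2) that by auto
  have top: "y \<in> topspace X" if "y \<in> fst d" for y using chart_dom_subset[OF dX(3)] that by blast
  have cv: "chart_vector A d y a \<in> tangent_space A y" "chart_vector A d y a d = a" if "y \<in> fst d" for y a
    using chart_vector_in_tangent[OF M dat[OF that]] chart_vector_self[OF M dat[OF that]] by auto
  have \<Omega>iso: "\<Omega> \<alpha> z u v = 0" if "z \<in> ?Z" "P u = u" "P v = v" for \<alpha> z u v
    unfolding \<Omega>_def local_form_def Let_def
    using cv[OF inv(1)[OF that(1)]] flat[OF inv(1)[OF that(1)]] that(2,3)
      by (intro iso top inv(1)[OF that(1)]) auto
  have "\<exists>\<theta>. (\<forall>b. smooth_on ?Z (\<lambda>z. \<theta> z b)) \<and> (\<forall>z\<in>?Z. linear (\<theta> z)) \<and> (\<forall>z\<in>?Z. \<forall>u. P u = u \<longrightarrow> \<theta> z u = 0) \<and>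
    (\<forall>z\<in>?Z. \<forall>a b. deriv_along (\<lambda>z. \<theta> z b) z a - deriv_along (\<lambda>z. \<theta> z a) z b = \<Omega> \<alpha> z a b)" for \<alpha>
    by (rule relative_poincare[OF \<Omega>[of \<alpha>] \<Omega>iso]) blast+
  then obtain \<theta> where \<theta>: "\<And>\<alpha> b. smooth_on ?Z (\<lambda>z. \<theta> \<alpha> z b)" "\<And>\<alpha> z. z \<in> ?Z \<Longrightarrow> linear (\<theta> \<alpha> z)"
    "\<And>\<alpha> z u. \<lbrakk>z \<in> ?Z; P u = u\<rbrakk> \<Longrightarrow> \<theta> \<alpha> z u = 0"
    "\<And>\<alpha> z a b. z \<in> ?Z \<Longrightarrow> deriv_along (\<lambda>z. \<theta> \<alpha> z b) z a - deriv_along (\<lambda>z. \<theta> \<alpha> z a) z b = \<Omega> \<alpha> z a b"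
    by metis
  have "dim (range P) + CARD('n) = DIM('e)" using P(3) dim by simp
  then obtain e :: "'n \<Rightarrow> 'e" where e: "\<And>z. z - P z = (\<Sum>i\<in>UNIV. (z \<bullet> e i) *\<^sub>R e i)" "\<And>z i. P z \<bullet> e i = 0"
    using orthonormal_family_exists[OF P(1,2)] by metis
  define q0 where "q0 i z = z \<bullet> e i" for i z
  define p0 where "p0 \<alpha> i z = - \<theta> \<alpha> z (e i)" for \<alpha> i z
  have q0D: "(q0 i has_derivative (\<lambda>v. v \<bullet> e i)) (at z)" for i z
    unfolding q0_def[abs_def] by (rule bounded_linear_imp_has_derivative[OF bounded_linear_inner_left])
  have q0S: "smooth_on ?Z (q0 i)" for i
    unfolding q0_def[abs_def] by (intro smooth_onI Ck_on_bounded_linear bounded_linear_inner_left)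
  have p0S: "smooth_on ?Z (p0 \<alpha> i)" for \<alpha> i
    unfolding p0_def[abs_def] by (intro smooth_onI Ck_on_uminus open_ball smooth_on_Ck[OF \<theta>(1)])
  have form: "\<Omega> \<alpha> z a b = (\<Sum>i\<in>UNIV. wedge (deriv_along (q0 i) z) (deriv_along (p0 \<alpha> i) z) a b)" if z:
    "z \<in> ?Z" for \<alpha> z a b
  proof -
    have "deriv_along (q0 i) z = (\<lambda>v. v \<bullet> e i)" for i using deriv_along_eq[OF q0D] by blast
    then show ?thesis
      unfolding p0_def[abs_def]
      using form_from_primitive[of P e ?Z "\<theta> \<alpha>" "\<Omega> \<alpha>" z a b, OF e(1) idem \<theta>(1,2,3,4) open_ball z] by simp
  qed
  define \<kappa> :: "'e \<Rightarrow> real ^ ('n + 'k \<times> 'n)" where "\<kappa> z = (\<chi> s. qp q0 p0 s z)" for z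
  have qpS: "smooth_on ?Z (qp q0 p0 s)" for s
    using q0S p0S by (cases s) (auto simp: qp_def split: prod.split)
  have \<kappa>S: "smooth_on ?Z \<kappa>"
    by (rule smooth_on_vec) (simp_all add: \<kappa>_def qpS)
  have \<kappa>D: "deriv_along \<kappa> z a $ s = deriv_along (qp q0 p0 s) z a" if "z \<in> ?Z" for z a s
  proof -
    have "\<kappa> differentiable (at z)" using smooth_on_has_derivative[OF \<kappa>S that] differentiable_def by blast
    from deriv_along_component[OF this, of "axis s 1" a] show ?thesis by (simp add: inner_axis \<kappa>_def)
  qed
  have \<kappa>lin: "linear (deriv_along \<kappa> z)" if "z \<in> ?Z" for z by (rule smooth_on_linear_deriv[OF \<kappa>S that])
  \<comment> \<open>A vector killed by all \<open>d q i\<close> and \<open>d p \<alpha> i\<close> lies in the kernel of every \<open>\<omega> \<alpha>\<close>.\<close>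
  have \<kappa>0: "a = 0" if z: "z \<in> ?Z" and a: "deriv_along \<kappa> z a = 0" for z a
  proof -
    let ?y = "chart_inv d z"
    note y = inv[OF z]
    have "deriv_along (q0 i) z a = 0" "deriv_along (p0 \<alpha> i) z a = 0" for i \<alpha>
      using \<kappa>D[OF z, of a "Inl i"] \<kappa>D[OF z, of a "Inr (\<alpha>, i)"] a by (auto simp: qp_def)
    then have \<Omega>0: "\<Omega> \<alpha> z a b = 0" for \<alpha> b unfolding form[OF z] by (simp add: wedge_def)
    have "\<omega> \<alpha> ?y (chart_vector A d ?y a) w = 0" if w: "w \<in> tangent_space A ?y" for \<alpha> w
      using local_form_apply[OF M dat[OF y(1)] cv(1)[OF y(1)] w, of "\<omega> \<alpha>" a] \<Omega>0[of \<alpha> "w d"] y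
      by (simp add: \<Omega>_def cv(2)[OF y(1)])
    then have "chart_vector A d ?y a \<in> (\<Inter>\<alpha>. form_kernel A (\<omega> \<alpha>) ?y)"
      using cv(1)[OF y(1)] by (auto simp: form_kernel_def)
    then have "chart_vector A d ?y a = 0" unfolding ker[OF top[OF y(1)]] by simp
    then show "a = 0" using cv(2)[OF y(1), of a] by simp
  qed
  have Z0: "0 \<in> ?Z" using r(1) by simp
  have inj0: "inj (deriv_along \<kappa> 0)" using linear_injective_0[OF \<kappa>lin[OF Z0]] \<kappa>0[OF Z0] by blast
  have "DIM('e) = DIM(real ^ ('n + 'k \<times> 'n))" by (simp add: dim)
  then have surj0: "surj (deriv_along \<kappa> 0)"
    using linear_injective_imp_surjective[OF \<kappa>lin[OF Z0] inj0] by simp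
  obtain L where L: "linear L" "L \<circ> deriv_along \<kappa> 0 = id"
    using linear_injective_left_inverse[OF \<kappa>lin[OF Z0] inj0] by blast
  have L1: "L (deriv_along \<kappa> 0 v) = v" for v using L(2) by (metis comp_apply id_apply)
  have L2: "deriv_along \<kappa> 0 (L w) = w" for w using surj0 L1 by (metis surjD)
  obtain W g where W: "open W" "0 \<in> W" "W \<subseteq> ?Z" "open (\<kappa> ` W)" and g: "smooth_on (\<kappa> ` W) g" "\<And>z. z \<in> W
    \<Longrightarrow> g (\<kappa> z) = z"
    by (rule smooth_inverse_function[OF \<kappa>S open_ball Z0 L(1) L1 L2]) blast
  have WS: "W \<subseteq> snd d ` fst d" using W(3) r(2) by blast
  define U where "U = {y \<in> fst d. snd d y \<in> W}"
  define q where "q i y = q0 i (snd d y)" for i y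
  define p where "p \<alpha> i y = p0 \<alpha> i (snd d y)" for \<alpha> i y
  have qp: "qp q p s y = qp q0 p0 s (snd d y)" for s y
    by (cases s) (auto simp: qp_def q_def p_def split: prod.split)
  let ?e = "coord_chart U (qp q p)"
  have e_eq: "?e = recoordinate d W \<kappa>"
    by (simp add: coord_chart_def recoordinate_def U_def fun_eq_iff \<kappa>_def qp)
  have \<kappa>W: "smooth_on W \<kappa>" by (rule smooth_on_subset[OF \<kappa>S W(3)])
  have eX: "chart_on X ?e"
    unfolding e_eq by (rule chart_on_recoordinate[OF dX(3) W(1) WS \<kappa>W W(4) g])
  have ecomp: "smoothly_compatible c ?e" "smoothly_compatible ?e c" if "c \<in> A" for c
    unfolding e_eq
    using smoothly_compatible_recoordinate[OF dX(3) W(1) WS \<kappa>W W(4) g(1) _ smooth_manifoldD(1)[OF M that]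
      dcomp(2)[OF that]] g(2)
    by blast+
  have "x \<in> U" using d dX(2) W(2) by (simp add: U_def)
  moreover have "local_coordinates X A U (qp q p)"
    using eX ecomp by (simp add: local_coordinates_def)
  moreover have "\<omega> \<alpha> y v w = (\<Sum>i\<in>UNIV. wedge (differential A (q i) y) (differential A (p \<alpha> i) y) v w)"
    if y: "y \<in> U" and v: "v \<in> tangent_space A y" and w: "w \<in> tangent_space A y" for y \<alpha> v w
  proof -
    have yd: "y \<in> fst d" "snd d y \<in> ?Z" using y W(3) by (auto simp: U_def)
    have diff: "q0 i differentiable (at (snd d y))" "p0 \<alpha> i differentiable (at (snd d y))" for i
      using smooth_on_has_derivative[OF q0S yd(2)] smooth_on_has_derivative[OF p0S yd(2)] differentiable_def
        by blast+
    have "\<omega> \<alpha> y v w = \<Omega> \<alpha> (snd d y) (v d) (w d)"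
      unfolding \<Omega>_def by (rule local_form_apply[OF M dat[OF yd(1)] v w, symmetric])
    also have "\<dots> = (\<Sum>i\<in>UNIV. wedge (differential A (q i) y) (differential A (p \<alpha> i) y) v w)"
      unfolding form[OF yd(2)] wedge_def q_def[abs_def] p_def[abs_def]
        differential_of_chart_function[OF M dat[OF yd(1)] diff(1) v] differential_of_chart_function[OF M
          dat[OF yd(1)] diff(1) w]
        differential_of_chart_function[OF M dat[OF yd(1)] diff(2) v] differential_of_chart_function[OF M
          dat[OF yd(1)] diff(2) w] ..
    finally show ?thesis .
  qed
  moreover have "V y = span (range (\<lambda>(\<alpha>, i). coord_vector A U (qp q p) (Inr (\<alpha>, i)) y))" if y: "y \<in> U" for y
  proof -
    let ?z = "snd d y"
    have yd: "y \<in> fst d" "?z \<in> W" "?z \<in> ?Z" using y W(3) by (auto simp: U_def)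
    have ye: "y \<in> fst ?e" using y by (simp add: coord_chart_def)
    have eT: "chart_vector A ?e y b \<in> tangent_space A y" for b
      by (rule chart_vector_tangent[OF M eX ecomp(2) ye])
    have elin: "linear (chart_vector A ?e y)" by (rule linear_chart_vector[OF M eX ecomp(2) ye])
    have de: "deriv_along (transition d ?e) ?z = deriv_along \<kappa> ?z"
    proof
      fix b
      show "deriv_along (transition d ?e) ?z b = deriv_along \<kappa> ?z b"
      proof (rule deriv_along_eq[OF has_derivative_transform_within_open[OF smooth_on_has_derivative[OF \<kappa>S
        yd(3)] W(1) yd(2)]])
        fix z assume "z \<in> W"
        then show "\<kappa> z = transition d ?e z"
          using chart_eq_inv[OF dX(3)] WS by (auto simp: e_eq transition_def recoordinate_def)
      qed
    qed
    \<comment> \<open>The coordinate frame is dual to the derivative of \<open>\<kappa>\<close>.\<close>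
    have ed: "deriv_along \<kappa> ?z (chart_vector A ?e y b d) = b" for b
    proof -
      have "chart_vector A ?e y b d = deriv_along (transition ?e d) (snd ?e y) b"
        using dat[OF yd(1)] by (simp add: chart_vector_def)
      then show ?thesis
        using transition_deriv_compose[OF eX dX(3) eX ecomp(2)[OF dX(1)] ecomp(1)[OF dX(1)] ye yd(1) ye, of b]
          transition_deriv_self[OF eX ye, of b] by (simp add: de)
    qed
    have sub: "subspace (V y)"
      using V top[OF yd(1)] unfolding integrable_distribution_def distribution_def by blast
    have VT: "V y \<subseteq> tangent_space A y"
      using V top[OF yd(1)] unfolding integrable_distribution_def distribution_def by blast
    have Vq: "v \<in> V y \<longleftrightarrow> (\<forall>i. deriv_along \<kappa> ?z (v d) $ Inl i = 0)" if v: "v \<in> tangent_space A y" for v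
    proof -
      have "deriv_along \<kappa> ?z (v d) $ Inl i = v d \<bullet> e i" for i
        using \<kappa>D[OF yd(3), of "v d" "Inl i"] deriv_along_eq[OF q0D] by (simp add: qp_def)
      moreover have "P (v d) = v d \<longleftrightarrow> (\<forall>i. v d \<bullet> e i = 0)"
      proof
        assume "P (v d) = v d"
        then show "\<forall>i. v d \<bullet> e i = 0" using e(2)[of "v d"] by simp
      next
        assume "\<forall>i. v d \<bullet> e i = 0"
        then have "v d - P (v d) = 0" unfolding e(1) by simp
        then show "P (v d) = v d" by simp
      qed
      ultimately show ?thesis using flat[OF yd(1) v] by simp
    qed
    let ?R = "range (\<lambda>(\<alpha>, i). coord_vector A U (qp q p) (Inr (\<alpha>, i)) y)"
    show ?thesis
    proof
      have "?R \<subseteq> V y"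
      proof clarify
        fix \<alpha> i
        have "chart_vector A ?e y (axis (Inr (\<alpha>, i)) 1) \<in> V y"
          unfolding Vq[OF eT] ed by (simp add: axis_def)
        then show "coord_vector A U (qp q p) (Inr (\<alpha>, i)) y \<in> V y" by (simp add: coord_vector_def)
      qed
      then show "span ?R \<subseteq> V y" using sub by (rule span_minimal)
      show "V y \<subseteq> span ?R"
      proof
        fix v assume v: "v \<in> V y"
        then have vT: "v \<in> tangent_space A y" using VT by blast
        let ?w = "deriv_along \<kappa> ?z (v d)"
        have "deriv_along \<kappa> ?z (chart_vector A ?e y ?w d - v d) = 0"
          by (simp add: linear_diff[OF \<kappa>lin[OF yd(3)]] ed)
        then have "chart_vector A ?e y ?w d = v d" using \<kappa>0[OF yd(3)] by fastforce
        then have "v = chart_vector A ?e y ?w" using tangent_eqI[OF M vT eT dat[OF yd(1)]] by simp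
        also have "\<dots> = chart_vector A ?e y (\<Sum>s\<in>UNIV. (?w $ s) *\<^sub>R axis s 1)"
          using basis_expansion[of ?w] by (simp only: scalar_mult_eq_scaleR)
        also have "\<dots> = (\<Sum>s\<in>UNIV. (?w $ s) *\<^sub>R chart_vector A ?e y (axis s 1))"
          by (simp add: linear_sum[OF elin] linear_scale[OF elin])
        also have "\<dots> \<in> span ?R"
        proof (rule span_sum)
          fix s :: "'n + 'k \<times> 'n"
          show "(?w $ s) *\<^sub>R chart_vector A ?e y (axis s 1) \<in> span ?R"
          proof (cases s)
            case (Inl i)
            then show ?thesis using v Vq[OF vT] by (simp add: span_zero)
          next
            case (Inr \<alpha>i)
            have "chart_vector A ?e y (axis s 1) \<in> ?R"
              unfolding Inr by (rule range_eqI[of _ _ \<alpha>i]) (auto simp: coord_vector_def split: prod.split)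
            then show ?thesis by (intro span_scale span_base)
          qed
        qed
        finally show "v \<in> span ?R" .
      qed
    qed
  qed
  ultimately show ?thesis by blast
qed

end
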